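(* Let $\mathbb{K}$ be an algebraically closed field of characteristic zero, let $$F = X_{11}^{l_{11}}\cdots X_{1n_1}^{l_{1n_1}} + \ldots + X_{m1}^{l_{m1}}\cdots X_{mn_m}^{l_{mn_m}}+Y_{11}^{q_1}+\ldots+Y_{1k_1}^{q_1}+\ldots+Y_{s1}^{q_s}+\ldots + Y_{sk_s}^{q_s}$$ be a polynomial with separated variables over $\mathbb{K}$ (with $n_i>1$ for all $i$ and $q_1>\ldots>q_s$), and let $X=\{F=0\}\subset\mathbb{A}^n$ be the hypersurface it defines, where $n$ is the total number of variables. Suppose that $X$ is rigid. Then the group $\mathrm{Aut}(X)$ of regular automorphisms of $X$ is isomorphic to the semidirect product $P(F)\ltimes \mathbb{H}$, where $P(F)$ is the permutation group of the polynomial $F$ and $\mathbb{H}$ is the quasitorus of diagonal transformations of $\mathbb{A}^n$ preserving the zero set of $F$.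
   Context: A polynomial has separated variables if each variable appears in exactly one of its monomials. After renaming (and rescaling) the variables it is written in the displayed form, where all variables $X_{ij}$ and $Y_{ik}$ are distinct, all exponents $l_{ij}$, $q_i$ are positive integers, the $X$-monomials are those involving at least two variables ($n_i>1$), and the $Y$-monomials are the powers of a single variable, grouped by exponent with $q_1>\ldots>q_s$ (either kind of monomial may be absent). An affine variety $X$ is rigid if there are no nontrivial algebraic actions of the additive group $\mathbb{G}_a=(\mathbb{K},+)$ on $X$. $P(F)$ is the subgroup of the symmetric group $S_n$ on the set of all variables $X_{ij},Y_{ik}$ consisting of those permutations $\tau$ whose induced action on the polynomial algebra $\mathbb{K}[X_{ij},Y_{ik}]$ satisfies $\tau(F)=F$. $\mathbb{H}$ is the subgroup of the torus $(\mathbb{K}^\times)^n$, acting on $\mathbb{A}^n$ by rescaling the coordinates, consisting of all elements that preserve the zero set of $F$. In $P(F)\ltimes\mathbb{H}$ the subgroup $\mathbb{H}$ is normal, and $P(F)$ acts on $\mathbb{H}$ by permuting the coordinates.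
   Formalization: Three families of F for which the claim is false are excluded: F = Y^q in one variable (X is a point with trivial Aut(X), but H is the whole torus), F = Y_1^2 + Y_2^2, and a single monomial in at least two variables whose exponents are not all equal. *)

theory Defs
  imports
    Complex_Main
    "HOL-Library.FuncSet"
    "HOL-Library.Poly_Mapping"
    "HOL-Combinatorics.Permutations"
    "HOL-Computational_Algebra.Polynomial"
    "HOL-Algebra.Group_Action"
begin

section \<open>Polynomials in several variables\<close>

text \<open>A monomial is a finitely supported exponent vector, a polynomial a finitely supported family
  of coefficients; multiplication is the convolution product of \<^theory>\<open>HOL-Library.Poly_Mapping\<close>.\<close>

type_synonym ('v, 'k) mpoly = "('v \<Rightarrow>\<^sub>0 nat) \<Rightarrow>\<^sub>0 'k"

definition var :: "'v \<Rightarrow> ('v, 'k::comm_ring_1) mpoly" where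
  "var v = Poly_Mapping.single (Poly_Mapping.single v 1) 1"

definition const :: "'k \<Rightarrow> ('v, 'k::comm_ring_1) mpoly" where
  "const c = Poly_Mapping.single 0 c"

definition poly_ring :: "'v set \<Rightarrow> ('v, 'k::comm_ring_1) mpoly set" where
  "poly_ring V = {p. \<forall>e \<in> Poly_Mapping.keys p. Poly_Mapping.keys e \<subseteq> V}"

text \<open>Coefficients are mapped by \<open>h\<close>, variables by \<open>x\<close>.\<close>

definition mpoly_hom ::
  "('k::comm_ring_1 \<Rightarrow> 'r::comm_ring_1) \<Rightarrow> ('v \<Rightarrow> 'r) \<Rightarrow> ('v, 'k) mpoly \<Rightarrow> 'r" where
  "mpoly_hom h x p =
     (\<Sum>e \<in> Poly_Mapping.keys p.
        h (Poly_Mapping.lookup p e) * (\<Prod>v \<in> Poly_Mapping.keys e. x v ^ Poly_Mapping.lookup e v))"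

definition eval_at :: "('v \<Rightarrow> 'k) \<Rightarrow> ('v, 'k::comm_ring_1) mpoly \<Rightarrow> 'k" where
  "eval_at x p = mpoly_hom (\<lambda>c. c) x p"

definition rename_vars :: "('v \<Rightarrow> 'v) \<Rightarrow> ('v, 'k::comm_ring_1) mpoly \<Rightarrow> ('v, 'k) mpoly" where
  "rename_vars \<tau> p = mpoly_hom const (\<lambda>v. var (\<tau> v)) p"


section \<open>Closed subsets of affine space and their automorphisms\<close>

text \<open>The coordinates are indexed by a set \<open>V\<close>; points are extensional functions on \<open>V\<close>.\<close>

definition affine_space :: "'v set \<Rightarrow> ('v \<Rightarrow> 'k) set" where
  "affine_space V = V \<rightarrow>\<^sub>E UNIV"

definition zero_set :: "'v set \<Rightarrow> ('v, 'k::comm_ring_1) mpoly \<Rightarrow> ('v \<Rightarrow> 'k) set" where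
  "zero_set V F = {x \<in> affine_space V. eval_at x F = 0}"

definition regular_on ::
  "'v set \<Rightarrow> ('v \<Rightarrow> 'k::comm_ring_1) set \<Rightarrow> (('v \<Rightarrow> 'k) \<Rightarrow> ('v \<Rightarrow> 'k)) \<Rightarrow> bool" where
  "regular_on V X f \<longleftrightarrow>
     (\<exists>g. (\<forall>v \<in> V. g v \<in> poly_ring V) \<and> (\<forall>x \<in> X. \<forall>v \<in> V. f x v = eval_at x (g v)))"

definition Aut ::
  "'v set \<Rightarrow> ('v \<Rightarrow> 'k::comm_ring_1) set \<Rightarrow> (('v \<Rightarrow> 'k) \<Rightarrow> ('v \<Rightarrow> 'k)) monoid" where
  "Aut V X = (BijGroup X)
     \<lparr>carrier := {f \<in> Bij X. regular_on V X f \<and> regular_on V X (inv_into X f)}\<rparr>"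

definition additive_group :: "'k::comm_ring_1 monoid" where
  "additive_group = \<lparr>carrier = UNIV, mult = (+), one = 0\<rparr>"

text \<open>The action map from \<open>\<bbbA>\<^sup>1 \<times> X\<close> to \<open>X\<close> is to be a morphism: the coordinates of \<open>\<Phi> s x\<close> are
  polynomials in \<open>s\<close> (variable \<open>None\<close>) and the coordinates \<open>x v\<close> (variables \<open>Some v\<close>).\<close>

definition algebraic_Ga_action ::
  "'v set \<Rightarrow> ('v \<Rightarrow> 'k::comm_ring_1) set \<Rightarrow> ('k \<Rightarrow> ('v \<Rightarrow> 'k) \<Rightarrow> ('v \<Rightarrow> 'k)) \<Rightarrow> bool" where
  "algebraic_Ga_action V X \<Phi> \<longleftrightarrow>
     group_action additive_group X \<Phi> \<and>
     (\<exists>g. (\<forall>v \<in> V. g v \<in> poly_ring (insert None (Some ` V))) \<and>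
          (\<forall>s. \<forall>x \<in> X. \<forall>v \<in> V. \<Phi> s x v = eval_at (case_option s x) (g v)))"

definition rigid :: "'v set \<Rightarrow> ('v \<Rightarrow> 'k::comm_ring_1) set \<Rightarrow> bool" where
  "rigid V X \<longleftrightarrow> (\<forall>\<Phi>. algebraic_Ga_action V X \<Phi> \<longrightarrow> (\<forall>s. \<forall>x \<in> X. \<Phi> s x = x))"


section \<open>The groups \<open>P(F)\<close>, \<open>\<bbbH>\<close> and their semidirect product\<close>

definition perm_group :: "'v set \<Rightarrow> ('v, 'k::comm_ring_1) mpoly \<Rightarrow> ('v \<Rightarrow> 'v) monoid" where
  "perm_group V F =
     \<lparr>carrier = {\<tau>. \<tau> permutes V \<and> rename_vars \<tau> F = F}, mult = (\<circ>), one = id\<rparr>"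

definition rescale :: "'v set \<Rightarrow> ('v \<Rightarrow> 'k::comm_ring_1) \<Rightarrow> ('v \<Rightarrow> 'k) \<Rightarrow> ('v \<Rightarrow> 'k)" where
  "rescale V t x = (\<lambda>v\<in>V. t v * x v)"

definition diag_group :: "'v set \<Rightarrow> ('v, 'k::field) mpoly \<Rightarrow> ('v \<Rightarrow> 'k) monoid" where
  "diag_group V F =
     \<lparr>carrier = {t \<in> V \<rightarrow>\<^sub>E (UNIV - {0}). rescale V t ` zero_set V F = zero_set V F},
      mult = rescale V, one = (\<lambda>v\<in>V. 1)\<rparr>"

text \<open>The left action on tuples for which moving the entry in place \<open>v\<close> to place \<open>\<tau> v\<close>
  corresponds to conjugating the diagonal transformation by the permutation of coordinates.\<close>

definition permute_coords :: "'v set \<Rightarrow> ('v \<Rightarrow> 'v) \<Rightarrow> ('v \<Rightarrow> 'k) \<Rightarrow> ('v \<Rightarrow> 'k)" where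
  "permute_coords V \<tau> t = (\<lambda>v\<in>V. t (inv_into V \<tau> v))"

text \<open>The pair \<open>(p, h)\<close> stands for the product \<open>h p\<close>, with \<open>p h p\<^sup>-\<^sup>1 = \<alpha> p h\<close>; the second factor \<open>N\<close> is
  the normal one.\<close>

definition semidirect ::
  "'p monoid \<Rightarrow> 'n monoid \<Rightarrow> ('p \<Rightarrow> 'n \<Rightarrow> 'n) \<Rightarrow> ('p \<times> 'n) monoid" where
  "semidirect P N \<alpha> =
     \<lparr>carrier = carrier P \<times> carrier N,
      mult = (\<lambda>(p, h) (p', h'). (p \<otimes>\<^bsub>P\<^esub> p', h \<otimes>\<^bsub>N\<^esub> \<alpha> p h')),
      one = (\<one>\<^bsub>P\<^esub>, \<one>\<^bsub>N\<^esub>)\<rparr>"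


section \<open>Polynomials with separated variables\<close>

datatype svar = X nat nat | Y nat nat

definition sep_vars :: "nat \<Rightarrow> (nat \<Rightarrow> nat) \<Rightarrow> nat \<Rightarrow> (nat \<Rightarrow> nat) \<Rightarrow> svar set" where
  "sep_vars m n s k =
     {X i j | i j. i \<in> {1..m} \<and> j \<in> {1..n i}} \<union> {Y i j | i j. i \<in> {1..s} \<and> j \<in> {1..k i}}"

definition sep_poly ::
  "nat \<Rightarrow> (nat \<Rightarrow> nat) \<Rightarrow> (nat \<Rightarrow> nat \<Rightarrow> nat) \<Rightarrow> nat \<Rightarrow> (nat \<Rightarrow> nat) \<Rightarrow> (nat \<Rightarrow> nat) \<Rightarrow>
     (svar, 'k::comm_ring_1) mpoly" where
  "sep_poly m n l s k q =
     (\<Sum>i=1..m. \<Prod>j=1..n i. var (X i j) ^ l i j) + (\<Sum>i=1..s. \<Sum>j=1..k i. var (Y i j) ^ q i)"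

text \<open>Degenerate polynomials, for which \<open>Aut(X)\<close> is not isomorphic to \<open>P(F) \<ltimes> \<bbbH>\<close> although
  \<open>X\<close> is rigid:
  \<^item> \<open>Y\<^sub>1\<^sub>1\<^sup>q\<close>: here \<open>X\<close> is a point, but \<open>\<bbbH>\<close> is the whole torus \<open>\<bbbK>\<^sup>\<times>\<close>.
  \<^item> \<open>Y\<^sub>1\<^sub>1\<^sup>2 + Y\<^sub>1\<^sub>2\<^sup>2\<close>: here \<open>X\<close> is a pair of lines through the origin, each of which can be rescaled
    independently, but \<open>\<bbbH>\<close> is one-dimensional.
  \<^item> A single monomial in at least two variables with unequal exponents: \<open>X\<close> is the union of the
    coordinate hyperplanes, which all permutations of the variables preserve, but \<open>P(F)\<close> is not
    the full symmetric group.\<close>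

definition degenerate ::
  "nat \<Rightarrow> (nat \<Rightarrow> nat) \<Rightarrow> (nat \<Rightarrow> nat \<Rightarrow> nat) \<Rightarrow> nat \<Rightarrow> (nat \<Rightarrow> nat) \<Rightarrow> (nat \<Rightarrow> nat) \<Rightarrow> bool" where
  "degenerate m n l s k q \<longleftrightarrow>
     m = 0 \<and> s = 1 \<and> k 1 = 1 \<or>
     m = 0 \<and> s = 1 \<and> k 1 = 2 \<and> q 1 = 2 \<or>
     m = 1 \<and> s = 0 \<and> (\<exists>j \<in> {1..n 1}. l 1 j \<noteq> l 1 1)"

end

theory Submission
  imports Defs "HOL-Library.Function_Algebras"
begin

text \<open>
  Why the group is no larger. A positive weight \<open>\<mu>\<close> of the variables for which \<open>F\<close> is homogeneous gives the
  action \<open>x\<^sub>v \<mapsto> t\<^bsup>\<mu> v\<^esup> x\<^sub>v\<close> on \<open>X\<close>, which extends to \<open>t = 0\<close>: it is an action of the multiplicative monoid, and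
  the regular functions on \<open>X\<close> are graded by natural numbers. Its infinitesimal generator, the Euler
  derivation, multiplies the component of degree \<open>d\<close> by \<open>d\<close>. Given two such actions \<open>\<alpha>\<close> and \<open>\<beta>\<close>, the Euler
  derivation of \<open>\<alpha>\<close> is a finite sum of derivations homogeneous for \<open>\<beta>\<close>, and the extreme ones, unless their
  degree is zero, are locally nilpotent. A locally nilpotent derivation \<open>D\<close> exponentiates to the additive
  action \<open>exp (s D)\<close>, so on a rigid \<open>X\<close> it vanishes (\<open>rigid_locally_nilpotent\<close>). Hence the Euler
  derivation of \<open>\<alpha>\<close> preserves the grading of \<open>\<beta>\<close> (\<open>rigid_euler_homogeneous\<close>).

  Let \<open>\<beta>\<close> run through the diagonal actions and \<open>\<alpha>\<close> be any action of the multiplicative monoid. The Euler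
  derivation \<open>E\<close> of \<open>\<alpha>\<close> then maps \<open>x\<^sub>v\<close> to a polynomial in which every monomial has the degree of \<open>x\<^sub>v\<close> for all
  weights. If \<open>x\<^sub>v\<close> shares its monomial of \<open>F\<close> with another variable, weights can be shifted between the two,
  and the only such monomial is \<open>x\<^sub>v\<close> itself (\<open>shared_extremal\<close>). If \<open>x\<^sub>v\<close> is alone in its monomial, the relation
  that \<open>E F\<close> is a multiple of \<open>F\<close> leads to the same conclusion, since rigidity forbids linear terms of \<open>F\<close>
  and, for more than two variables, two squares (\<open>euler_lone\<close>). So every coordinate is an eigenfunction of
  \<open>E\<close>, that is, every action of the multiplicative monoid on \<open>X\<close> is diagonal (\<open>coord_homogeneous\<close>). Applied
  to the conjugates of diagonal actions, this says that automorphisms permute the diagonal actions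
  (\<open>automorphism_transports\<close>).

  Consequently the coordinates of an automorphism \<open>\<phi>\<close> are multihomogeneous polynomials. They vanish at the
  origin, and their linear parts form the invertible Jacobian matrix there (\<open>lift_linear_inverse\<close>), because
  \<open>F\<close> has no linear terms. A coordinate of \<open>\<phi>\<close> with the degree of a shared variable is a multiple of
  that variable, again by extremality, and comparing degrees shows that shared variables correspond to shared
  ones (\<open>lift_shared_to_shared\<close>). For the variables \<open>x\<close> that occur as \<open>x\<^sup>q\<close>, the pullback of \<open>F\<close> is a multiple of \<open>F\<close>, so the linear part
  preserves \<open>\<Sum> x\<^sup>q\<close> up to a factor; for \<open>q \<ge> 3\<close> this form is preserved by monomial matrices only, and for
  \<open>q = 2\<close> there is just one such variable. Comparing the powers of one variable excludes further terms
  (\<open>lone_monomial\<close>). Therefore \<open>\<phi> x v = m v * x (\<sigma> v)\<close> for a permutation \<open>\<sigma>\<close> of the variables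
  (\<open>automorphism_monomial\<close>).

  It remains to see that \<open>\<sigma>\<close> preserves \<open>F\<close>. A coordinate can be multiplied by a root of unity whose order is
  its exponent, and two coordinates in the same monomial can be rescaled in opposite directions, without leaving \<open>X\<close>. Transported
  by \<open>\<phi>\<close>, these freedoms show that \<open>\<sigma>\<close> preserves the exponents (\<open>exponent_eq\<close>) and the partition of the
  variables into monomials (\<open>partition_preserved\<close>). The diagonal part of \<open>\<phi>\<close> then preserves \<open>X\<close>, and the
  pairs of a permutation and a diagonal transformation compose as in the semidirect product
  (\<open>Aut_iso_semidirect\<close>).\<close>

abbreviation lookup where "lookup \<equiv> Poly_Mapping.lookup"
abbreviation keys where "keys \<equiv> Poly_Mapping.keys"
abbreviation single where "single \<equiv> Poly_Mapping.single"

section \<open>Polynomials and evaluation\<close>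

definition monom_at :: "('v \<Rightarrow> 'r::comm_ring_1) \<Rightarrow> ('v \<Rightarrow>\<^sub>0 nat) \<Rightarrow> 'r" where
  "monom_at x e = (\<Prod>v\<in>keys e. x v ^ lookup e v)"

lemma monom_at_superset:
  assumes "finite S" "keys e \<subseteq> S"
  shows "monom_at x e = (\<Prod>v\<in>S. x v ^ lookup e v)"
  unfolding monom_at_def using assms
  by (intro prod.mono_neutral_left) (auto simp: in_keys_iff)

lemma monom_at_zero [simp]: "monom_at x 0 = 1"
  by (simp add: monom_at_def)

lemma monom_at_add: "monom_at x (a + b) = monom_at x a * monom_at x b"
proof -
  let ?S = "keys a \<union> keys b"
  have "keys (a + b) \<subseteq> ?S" by (rule Poly_Mapping.keys_add)
  then show ?thesis
    by (simp add: monom_at_superset[of ?S] lookup_add power_add prod.distrib)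
qed

lemma monom_at_single: "monom_at x (single v n) = x v ^ n"
  by (cases "n = 0") (simp_all add: monom_at_def)

lemma poly_mapping_sum_singles: "(\<Sum>e\<in>keys p. single e (lookup p e)) = p"
proof (rule poly_mapping_eqI)
  fix k
  have "lookup (\<Sum>e\<in>keys p. single e (lookup p e)) k
      = (\<Sum>e\<in>keys p. if e = k then lookup p e else 0)"
    by (simp add: lookup_sum lookup_single when_def)
  then show "lookup (\<Sum>e\<in>keys p. single e (lookup p e)) k = lookup p k"
    by (simp add: in_keys_iff)
qed

definition ring_map :: "('a::comm_ring_1 \<Rightarrow> 'b::comm_ring_1) \<Rightarrow> bool" where
  "ring_map h \<longleftrightarrow> h 1 = 1 \<and> (\<forall>a b. h (a + b) = h a + h b) \<and> (\<forall>a b. h (a * b) = h a * h b)"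

lemma ring_mapD:
  assumes "ring_map h"
  shows "h 0 = 0" "h 1 = 1" "h (a + b) = h a + h b" "h (a * b) = h a * h b"
proof -
  have "h (0 + 0) = h 0 + h 0" using assms unfolding ring_map_def by blast
  then show "h 0 = 0" by simp
qed (use assms in \<open>auto simp: ring_map_def\<close>)

lemma ring_map_sum: "ring_map h \<Longrightarrow> h (sum f S) = (\<Sum>i\<in>S. h (f i))"
  by (induction S rule: infinite_finite_induct) (auto simp: ring_mapD)

lemma ring_map_prod: "ring_map h \<Longrightarrow> h (prod f S) = (\<Prod>i\<in>S. h (f i))"
  by (induction S rule: infinite_finite_induct) (auto simp: ring_mapD)

lemma ring_map_power: "ring_map h \<Longrightarrow> h (a ^ n) = h a ^ n"
  by (induction n) (auto simp: ring_mapD)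

lemma ring_map_uminus: "ring_map h \<Longrightarrow> h (- a) = - h a"
  using ring_mapD(3)[of h a "- a"] ring_mapD(1)[of h] by (simp add: eq_neg_iff_add_eq_0 add.commute)

lemma ring_map_diff: "ring_map h \<Longrightarrow> h (a - b) = h a - h b"
  using ring_mapD(3)[of h a "- b"] by (simp add: ring_map_uminus)

lemma ring_map_id: "ring_map (\<lambda>c. c)"
  by (simp add: ring_map_def)

lemma ring_map_const: "ring_map const"
  by (auto simp: ring_map_def const_def single_add mult_single)

lemma ring_map_pCons: "ring_map (\<lambda>c. [:c:])"
  by (auto simp: ring_map_def)

lemma mpoly_hom_superset:
  assumes "finite S" "keys p \<subseteq> S" "h 0 = 0"
  shows "mpoly_hom h x p = (\<Sum>e\<in>S. h (lookup p e) * monom_at x e)"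
  unfolding mpoly_hom_def monom_at_def using assms
  by (intro sum.mono_neutral_left) (auto simp: in_keys_iff)

lemma mpoly_hom_monoms: "mpoly_hom h x p = (\<Sum>e\<in>keys p. h (lookup p e) * monom_at x e)"
  by (simp add: mpoly_hom_def monom_at_def)

lemma mpoly_hom_single: "h 0 = 0 \<Longrightarrow> mpoly_hom h x (single e c) = h c * monom_at x e"
  by (subst mpoly_hom_superset[of "{e}"]) auto

lemma mpoly_hom_add:
  assumes "ring_map h"
  shows "mpoly_hom h x (p + q) = mpoly_hom h x p + mpoly_hom h x q"
proof -
  let ?S = "keys p \<union> keys q"
  have "keys (p + q) \<subseteq> ?S" by (rule Poly_Mapping.keys_add)
  then show ?thesis
    by (simp add: mpoly_hom_superset[of ?S] ring_mapD[OF assms] lookup_add sum.distrib algebra_simps)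
qed

lemma mpoly_hom_sum:
  assumes "ring_map h"
  shows "mpoly_hom h x (sum f S) = (\<Sum>i\<in>S. mpoly_hom h x (f i))"
  by (induction S rule: infinite_finite_induct)
    (auto simp: mpoly_hom_add[OF assms], auto simp: mpoly_hom_def)

lemma mpoly_hom_mult:
  assumes "ring_map h"
  shows "mpoly_hom h x (p * q) = mpoly_hom h x p * mpoly_hom h x q"
proof -
  have "p * q = (\<Sum>a\<in>keys p. \<Sum>b\<in>keys q. single (a + b) (lookup p a * lookup q b))"
    by (subst (1 2) poly_mapping_sum_singles[symmetric])
      (simp add: sum_product mult_single)
  then show ?thesis
    by (simp add: mpoly_hom_sum[OF assms] mpoly_hom_single ring_mapD[OF assms] monom_at_add
        mpoly_hom_monoms[of h x p] mpoly_hom_monoms[of h x q] sum_product mult_ac)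
qed

lemma ring_map_mpoly_hom: "ring_map h \<Longrightarrow> ring_map (mpoly_hom h x)"
  unfolding ring_map_def
  using mpoly_hom_add[of h x] mpoly_hom_mult[of h x] mpoly_hom_single[of h x 0 1]
  by (auto simp: ring_map_def ring_mapD(1))

lemma mpoly_hom_var: "ring_map h \<Longrightarrow> mpoly_hom h x (var v) = x v"
  by (simp add: var_def mpoly_hom_single ring_mapD monom_at_single)

lemma mpoly_hom_const: "ring_map h \<Longrightarrow> mpoly_hom h x (const c) = h c"
  by (simp add: const_def mpoly_hom_single ring_mapD)

lemma ring_map_mpoly_hom_comp:
  assumes "ring_map h" "ring_map H"
  shows "H (mpoly_hom h x p) = mpoly_hom (\<lambda>c. H (h c)) (\<lambda>v. H (x v)) p"
  by (simp add: mpoly_hom_monoms ring_map_sum[OF assms(2)] ring_mapD[OF assms(2)] monom_at_def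
      ring_map_prod[OF assms(2)] ring_map_power[OF assms(2)])

lemma mpoly_hom_cong:
  assumes "\<And>v. v \<in> V \<Longrightarrow> x v = y v" "p \<in> poly_ring V"
  shows "mpoly_hom h x p = mpoly_hom h y p"
  unfolding mpoly_hom_def
  by (intro sum.cong arg_cong2[where f="(*)"] prod.cong arg_cong2[where f="(^)"] assms(1))
    (use assms(2) in \<open>auto simp: poly_ring_def\<close>)

lemma ring_map_eval_at: "ring_map (eval_at x)"
  unfolding eval_at_def by (intro ring_map_mpoly_hom ring_map_id)

lemmas eval_at_simps = ring_mapD[OF ring_map_eval_at] ring_map_sum[OF ring_map_eval_at]
  ring_map_prod[OF ring_map_eval_at] ring_map_power[OF ring_map_eval_at]
  ring_map_uminus[OF ring_map_eval_at] ring_map_diff[OF ring_map_eval_at]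

lemma eval_at_var [simp]: "eval_at x (var v) = x v"
  by (simp add: eval_at_def mpoly_hom_var ring_map_id)

lemma eval_at_const [simp]: "eval_at x (const c) = c"
  by (simp add: eval_at_def mpoly_hom_const ring_map_id)

lemma eval_at_monoms: "eval_at x p = (\<Sum>e\<in>keys p. lookup p e * monom_at x e)"
  by (simp add: eval_at_def mpoly_hom_monoms)

lemma eval_at_cong:
  assumes "\<And>v. v \<in> V \<Longrightarrow> x v = y v" "p \<in> poly_ring V"
  shows "eval_at x p = eval_at y p"
  unfolding eval_at_def using assms by (rule mpoly_hom_cong)

lemma eval_at_subst:
  "eval_at x (mpoly_hom const g p) = eval_at (\<lambda>v. eval_at x (g v)) p"
  using ring_map_mpoly_hom_comp[OF ring_map_const ring_map_eval_at, of x g p]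
  by (simp add: eval_at_def[of _ p])

lemma eval_at_rename_vars: "eval_at x (rename_vars \<tau> p) = eval_at (\<lambda>v. x (\<tau> v)) p"
  by (simp add: rename_vars_def eval_at_subst)

lemma poly_mpoly_hom:
  "poly (mpoly_hom (\<lambda>a. [:a:]) c p) t = eval_at (\<lambda>v. poly (c v) t) p"
proof -
  have "ring_map (\<lambda>q. poly q t)" by (auto simp: ring_map_def)
  from ring_map_mpoly_hom_comp[OF ring_map_pCons this] show ?thesis
    by (simp add: eval_at_def)
qed


subsection \<open>The polynomial ring on a set of variables\<close>

lemma poly_ring_const [intro, simp]: "const c \<in> poly_ring V"
  by (auto simp: poly_ring_def const_def)

lemma poly_ring_one [intro, simp]: "1 \<in> poly_ring V"
  by (auto simp: poly_ring_def)

lemma poly_ring_zero [intro, simp]: "0 \<in> poly_ring V"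
  by (auto simp: poly_ring_def)

lemma poly_ring_var [intro, simp]: "v \<in> V \<Longrightarrow> var v \<in> poly_ring V"
  by (auto simp: poly_ring_def var_def)

lemma poly_ring_add [intro]: "p \<in> poly_ring V \<Longrightarrow> q \<in> poly_ring V \<Longrightarrow> p + q \<in> poly_ring V"
  using Poly_Mapping.keys_add[of p q] by (auto simp: poly_ring_def)

lemma poly_ring_uminus [intro]: "p \<in> poly_ring V \<Longrightarrow> - p \<in> poly_ring V"
  by (auto simp: poly_ring_def in_keys_iff)

lemma poly_ring_diff [intro]: "p \<in> poly_ring V \<Longrightarrow> q \<in> poly_ring V \<Longrightarrow> p - q \<in> poly_ring V"
  using poly_ring_add[of p V "- q"] poly_ring_uminus[of q V] by simp

lemma poly_ring_mult [intro]: "p \<in> poly_ring V \<Longrightarrow> q \<in> poly_ring V \<Longrightarrow> p * q \<in> poly_ring V"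
  unfolding poly_ring_def
proof (intro CollectI ballI)
  fix e assume pq: "p \<in> {p. \<forall>e\<in>keys p. keys e \<subseteq> V}" "q \<in> {p. \<forall>e\<in>keys p. keys e \<subseteq> V}"
    and "e \<in> keys (p * q)"
  then obtain a b where "e = a + b" "a \<in> keys p" "b \<in> keys q"
    using Poly_Mapping.keys_mult[of p q] by blast
  then show "keys e \<subseteq> V" using pq Poly_Mapping.keys_add[of a b] by blast
qed

lemma poly_ring_sum [intro]: "(\<And>i. i \<in> S \<Longrightarrow> f i \<in> poly_ring V) \<Longrightarrow> sum f S \<in> poly_ring V"
  by (induction S rule: infinite_finite_induct) auto

lemma poly_ring_prod [intro]: "(\<And>i. i \<in> S \<Longrightarrow> f i \<in> poly_ring V) \<Longrightarrow> prod f S \<in> poly_ring V"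
  by (induction S rule: infinite_finite_induct) auto

lemma poly_ring_power [intro]: "p \<in> poly_ring V \<Longrightarrow> p ^ n \<in> poly_ring V"
  by (induction n) auto

lemma poly_ring_subst:
  assumes "p \<in> poly_ring V" "\<And>v. v \<in> V \<Longrightarrow> g v \<in> poly_ring V'"
  shows "mpoly_hom const g p \<in> poly_ring V'"
  unfolding mpoly_hom_def
  by (intro poly_ring_sum poly_ring_mult poly_ring_const poly_ring_prod poly_ring_power assms(2))
    (use assms(1) in \<open>auto simp: poly_ring_def\<close>)

lemma poly_ring_induct [consumes 1, case_names const var add mult]:
  assumes "p \<in> poly_ring V"
    and "\<And>c. P (const c)" and "\<And>v. v \<in> V \<Longrightarrow> P (var v)"
    and "\<And>p q. P p \<Longrightarrow> P q \<Longrightarrow> P (p + q)" and "\<And>p q. P p \<Longrightarrow> P q \<Longrightarrow> P (p * q)"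
  shows "P p"
proof -
  have P0: "P 0" using assms(2)[of 0] by (simp add: const_def)
  have P1: "P 1" using assms(2)[of 1] by (simp add: const_def)
  have pw: "P (var v ^ n)" if "v \<in> V" for v n
    by (induction n) (use that assms P1 in auto)
  have pr: "P (prod f S)" if "\<And>v. v \<in> S \<Longrightarrow> P (f v)" for f :: "'a \<Rightarrow> ('a, 'b) mpoly" and S
    using that by (induction S rule: infinite_finite_induct) (use assms P1 in auto)
  have sm: "P (sum f S)" if "\<And>v. v \<in> S \<Longrightarrow> P (f v)" for f :: "('a \<Rightarrow>\<^sub>0 nat) \<Rightarrow> ('a, 'b) mpoly" and S
    using that by (induction S rule: infinite_finite_induct) (use assms P0 in auto)
  have single_eq: "single e c = const c * (\<Prod>v\<in>keys e. var v ^ lookup e v)" for e :: "'a \<Rightarrow>\<^sub>0 nat" and c :: 'b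
  proof -
    have vp: "var v ^ n = (single (single v n) 1 :: ('a, 'b) mpoly)" for v n
      by (induction n) (simp_all add: var_def mult_single flip: single_add)
    have "(\<Prod>v\<in>S. single (g v) (1::'b)) = single (sum g S) 1" for S and g :: "'a \<Rightarrow> ('a \<Rightarrow>\<^sub>0 nat)"
      by (induction S rule: infinite_finite_induct) (auto simp: mult_single)
    then have "(\<Prod>v\<in>keys e. var v ^ lookup e v) = (single e 1 :: ('a, 'b) mpoly)"
      by (simp add: vp poly_mapping_sum_singles)
    then show ?thesis by (simp add: const_def mult_single)
  qed
  have "P (\<Sum>e\<in>keys p. single e (lookup p e))"
    unfolding single_eq
    by (intro sm assms(5) assms(2) pr pw) (use assms(1) in \<open>auto simp: poly_ring_def\<close>)
  then show ?thesis by (simp add: poly_mapping_sum_singles)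
qed

text \<open>Whether a map is given by polynomials can be read off from its formula with this predicate, without
  writing the polynomials down.\<close>

definition poly_fun :: "'v set \<Rightarrow> (('v \<Rightarrow> 'k::comm_ring_1) \<Rightarrow> 'k) \<Rightarrow> bool" where
  "poly_fun V f \<longleftrightarrow> (\<exists>p\<in>poly_ring V. \<forall>x. f x = eval_at x p)"

named_theorems poly_fun_intros

lemma poly_fun_const [poly_fun_intros]: "poly_fun V (\<lambda>x. c)"
  unfolding poly_fun_def by (rule bexI[of _ "const c"]) auto

lemma poly_fun_var [poly_fun_intros]: "v \<in> V \<Longrightarrow> poly_fun V (\<lambda>x. x v)"
  unfolding poly_fun_def by (rule bexI[of _ "var v"]) auto

lemma poly_fun_add [poly_fun_intros]:
  "poly_fun V f \<Longrightarrow> poly_fun V g \<Longrightarrow> poly_fun V (\<lambda>x. f x + g x)"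
  unfolding poly_fun_def by (metis poly_ring_add eval_at_simps(3))

lemma poly_fun_mult [poly_fun_intros]:
  "poly_fun V f \<Longrightarrow> poly_fun V g \<Longrightarrow> poly_fun V (\<lambda>x. f x * g x)"
  unfolding poly_fun_def by (metis poly_ring_mult eval_at_simps(4))

lemma poly_fun_diff [poly_fun_intros]:
  "poly_fun V f \<Longrightarrow> poly_fun V g \<Longrightarrow> poly_fun V (\<lambda>x. f x - g x)"
  unfolding poly_fun_def by (metis poly_ring_diff ring_map_diff[OF ring_map_eval_at])

lemma poly_fun_power [poly_fun_intros]: "poly_fun V f \<Longrightarrow> poly_fun V (\<lambda>x. f x ^ n)"
  by (induction n) (auto intro: poly_fun_intros)

lemma poly_fun_sum [poly_fun_intros]:
  "(\<And>i. i \<in> S \<Longrightarrow> poly_fun V (f i)) \<Longrightarrow> poly_fun V (\<lambda>x. \<Sum>i\<in>S. f i x)"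
  by (induction S rule: infinite_finite_induct) (auto intro: poly_fun_intros)

lemma poly_fun_prod [poly_fun_intros]:
  "(\<And>i. i \<in> S \<Longrightarrow> poly_fun V (f i)) \<Longrightarrow> poly_fun V (\<lambda>x. \<Prod>i\<in>S. f i x)"
  by (induction S rule: infinite_finite_induct) (auto intro: poly_fun_intros)

lemma poly_fun_eval_at [poly_fun_intros]:
  assumes "p \<in> poly_ring V" "\<And>v. v \<in> V \<Longrightarrow> poly_fun V' (g v)"
  shows "poly_fun V' (\<lambda>x. eval_at (\<lambda>v. g v x) p)"
  using assms(1)
  by (induction p rule: poly_ring_induct)
    (auto simp: eval_at_simps intro: poly_fun_intros assms(2))

subsection \<open>Weights of monomials\<close>

definition wt :: "('v \<Rightarrow> nat) \<Rightarrow> ('v \<Rightarrow>\<^sub>0 nat) \<Rightarrow> nat" where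
  "wt w e = (\<Sum>v\<in>keys e. lookup e v * w v)"

lemma wt_superset:
  assumes "finite S" "keys e \<subseteq> S"
  shows "wt w e = (\<Sum>v\<in>S. lookup e v * w v)"
  unfolding wt_def using assms
  by (intro sum.mono_neutral_left) (auto simp: in_keys_iff)

lemma wt_zero [simp]: "wt w 0 = 0"
  by (simp add: wt_def)

lemma wt_add: "wt w (a + b) = wt w a + wt w b"
proof -
  let ?S = "keys a \<union> keys b"
  have "keys (a + b) \<subseteq> ?S" by (rule Poly_Mapping.keys_add)
  then show ?thesis
    by (simp add: wt_superset[of ?S] lookup_add algebra_simps sum.distrib)
qed

lemma wt_single [simp]: "wt w (single v n) = n * w v"
  by (cases "n = 0") (simp_all add: wt_def)

lemma single_Suc_0_eq_iff [simp]: "single u (Suc 0) = single v (Suc 0) \<longleftrightarrow> u = v"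
  by (metis lookup_single_eq lookup_single_not_eq nat.distinct(1))

lemma single_Suc_0_neq_0 [simp]: "single v (Suc 0) \<noteq> 0" "0 \<noteq> single v (Suc 0)"
  by (metis lookup_single_eq lookup_zero nat.distinct(1))+

lemma wt_sum: "wt w (sum f S) = (\<Sum>i\<in>S. wt w (f i))"
  by (induction S rule: infinite_finite_induct) (auto simp: wt_add)

lemma wt_ge: "lookup e v * w v \<le> wt w e"
proof (cases "v \<in> keys e")
  case True
  then show ?thesis unfolding wt_def by (intro member_le_sum) auto
qed (simp add: in_keys_iff)

lemma monom_at_scale:
  "monom_at (\<lambda>v. t ^ w v * x v) e = t ^ wt w e * monom_at x e"
  by (simp add: monom_at_def wt_def power_mult_distrib prod.distrib power_sum mult.commute
      flip: power_mult)

lemma eval_at_scale: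
  "eval_at (\<lambda>v. t ^ w v * x v) p = (\<Sum>e\<in>keys p. lookup p e * monom_at x e * t ^ wt w e)"
  unfolding eval_at_monoms monom_at_scale by (simp add: mult_ac)

text \<open>With a condition on the weight of the monomial, this is a homogeneous component.\<close>

definition filter_keys :: "(('v \<Rightarrow>\<^sub>0 nat) \<Rightarrow> bool) \<Rightarrow> ('v, 'k::comm_ring_1) mpoly \<Rightarrow> ('v, 'k) mpoly" where
  "filter_keys P p = (\<Sum>e\<in>{e \<in> keys p. P e}. single e (lookup p e))"

lemma lookup_filter_keys: "lookup (filter_keys P p) e = (if P e then lookup p e else 0)"
proof -
  have "lookup (filter_keys P p) e = (\<Sum>e'\<in>{e \<in> keys p. P e}. if e' = e then lookup p e' else 0)"
    by (simp add: filter_keys_def lookup_sum lookup_single when_def)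
  then show ?thesis by (auto simp: in_keys_iff)
qed

lemma keys_filter_keys: "keys (filter_keys P p) = {e \<in> keys p. P e}"
  by (auto simp: in_keys_iff lookup_filter_keys split: if_splits)

lemma filter_keys_poly_ring: "p \<in> poly_ring V \<Longrightarrow> filter_keys P p \<in> poly_ring V"
  by (auto simp: poly_ring_def keys_filter_keys)

lemma eval_at_filter_keys:
  "eval_at x (filter_keys P p) = (\<Sum>e\<in>{e \<in> keys p. P e}. lookup p e * monom_at x e)"
  by (simp add: eval_at_monoms keys_filter_keys lookup_filter_keys)

text \<open>The weighted homogeneous polynomials; zero belongs to every degree, so that each degree is a module.\<close>

definition graded :: "'v set \<Rightarrow> ('v \<Rightarrow> nat) \<Rightarrow> nat \<Rightarrow> ('v, 'k::comm_ring_1) mpoly set" where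
  "graded V w n = {p \<in> poly_ring V. \<forall>e\<in>keys p. wt w e = n}"

lemma gradedD: "p \<in> graded V w n \<Longrightarrow> p \<in> poly_ring V" "p \<in> graded V w n \<Longrightarrow> e \<in> keys p \<Longrightarrow> wt w e = n"
  by (auto simp: graded_def)

lemma graded_zero [simp]: "0 \<in> graded V w n"
  by (auto simp: graded_def)

lemma graded_add: "p \<in> graded V w n \<Longrightarrow> q \<in> graded V w n \<Longrightarrow> p + q \<in> graded V w n"
  using Poly_Mapping.keys_add[of p q] by (auto simp: graded_def)

lemma graded_uminus: "p \<in> graded V w n \<Longrightarrow> - p \<in> graded V w n"
  by (auto simp: graded_def in_keys_iff)

lemma graded_diff: "p \<in> graded V w n \<Longrightarrow> q \<in> graded V w n \<Longrightarrow> p - q \<in> graded V w n"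
  using graded_add[of p V w n "- q"] graded_uminus[of q V w n] by simp

lemma graded_sum: "(\<And>i. i \<in> S \<Longrightarrow> f i \<in> graded V w n) \<Longrightarrow> sum f S \<in> graded V w n"
  by (induction S rule: infinite_finite_induct) (auto intro: graded_add)

lemma graded_mult:
  assumes "p \<in> graded V w m" "q \<in> graded V w n"
  shows "p * q \<in> graded V w (m + n)"
proof -
  have "wt w e = m + n" if e: "e \<in> keys (p * q)" for e
  proof -
    obtain a b where "e = a + b" "a \<in> keys p" "b \<in> keys q"
      using e Poly_Mapping.keys_mult[of p q] by blast
    then show ?thesis using assms by (simp add: wt_add graded_def)
  qed
  then show ?thesis using assms by (auto simp: graded_def)
qed

lemma graded_const: "const c \<in> graded V w 0"
  by (auto simp: graded_def const_def poly_ring_def)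

lemma graded_one: "1 \<in> graded V w 0"
  by (auto simp: graded_def)

lemma graded_var: "v \<in> V \<Longrightarrow> var v \<in> graded V w (w v)"
  by (auto simp: graded_def var_def poly_ring_def)

lemma graded_smult: "p \<in> graded V w n \<Longrightarrow> const c * p \<in> graded V w n"
  using graded_mult[OF graded_const, of p V w n c] by simp

lemma graded_prod:
  "(\<And>i. i \<in> S \<Longrightarrow> f i \<in> graded V w (n i)) \<Longrightarrow> prod f S \<in> graded V w (sum n S)"
  by (induction S rule: infinite_finite_induct) (auto intro: graded_mult graded_one)

lemma graded_power: "p \<in> graded V w n \<Longrightarrow> p ^ m \<in> graded V w (m * n)"
  by (induction m) (auto intro: graded_mult graded_one)

subsection \<open>Polynomials and polynomial functions\<close>

text \<open>Base-\<open>b\<close> digits: on finitely many monomials a sufficiently lacunary weight is injective, so that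
  substituting powers of a single indeterminate loses nothing (Kronecker substitution).\<close>

lemma separating_weight:
  assumes "finite V" "finite S" "\<And>e. e \<in> S \<Longrightarrow> keys e \<subseteq> V"
  shows "\<exists>w. inj_on (wt w) S"
proof -
  have "\<exists>w. \<forall>e\<in>S. \<forall>e'\<in>S. (\<Sum>v\<in>V. lookup e v * w v) = (\<Sum>v\<in>V. lookup e' v * w v) \<longrightarrow>
      (\<forall>v\<in>V. lookup e v = lookup e' v)"
    using assms(1)
  proof (induction V rule: finite_induct)
    case (insert u V)
    then obtain w where w: "\<forall>e\<in>S. \<forall>e'\<in>S. (\<Sum>v\<in>V. lookup e v * w v) = (\<Sum>v\<in>V. lookup e' v * w v) \<longrightarrow>
      (\<forall>v\<in>V. lookup e v = lookup e' v)" by blast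
    define s where "s e = (\<Sum>v\<in>V. lookup e v * w v)" for e
    define b where "b = Suc (Max (s ` S))"
    have lt: "s e < b" if "e \<in> S" for e
      using that assms(2) by (simp add: b_def less_Suc_eq_le)
    have sum_eq: "(\<Sum>v\<in>insert u V. lookup e v * (w(u := b)) v) = lookup e u * b + s e" for e
      using insert.hyps by (simp add: s_def) (intro sum.cong, auto)
    have "lookup e u = lookup e' u \<and> s e = s e'"
      if "e \<in> S" "e' \<in> S" "lookup e u * b + s e = lookup e' u * b + s e'" for e e'
    proof -
      have "(lookup e u * b + s e) div b = lookup e u" "(lookup e u * b + s e) mod b = s e" if "e \<in> S" for e
        using lt[OF that] by (simp_all add: div_mult_self3)
      from this[OF that(1)] this[OF that(2)] that(3) show ?thesis by metis
    qed
    then show ?case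
      using w unfolding s_def[symmetric] by (intro exI[of _ "w(u := b)"]) (simp only: sum_eq, blast)
  qed simp
  then obtain w where w: "\<forall>e\<in>S. \<forall>e'\<in>S. (\<Sum>v\<in>V. lookup e v * w v) = (\<Sum>v\<in>V. lookup e' v * w v) \<longrightarrow>
      (\<forall>v\<in>V. lookup e v = lookup e' v)" by blast
  have "e = e'" if "e \<in> S" "e' \<in> S" "wt w e = wt w e'" for e e'
  proof (rule poly_mapping_eqI)
    fix v
    have "(\<Sum>v\<in>V. lookup e v * w v) = (\<Sum>v\<in>V. lookup e' v * w v)"
      using that(3) by (simp only: wt_superset[OF assms(1) assms(3)[OF that(1)]]
          wt_superset[OF assms(1) assms(3)[OF that(2)]])
    then have "\<forall>v\<in>V. lookup e v = lookup e' v"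
      using w that(1,2) by blast
    then show "lookup e v = lookup e' v"
      using assms(3)[OF that(1)] assms(3)[OF that(2)] by (metis in_keys_iff subsetD)
  qed
  then show ?thesis by (auto simp: inj_on_def)
qed

text \<open>Substituting \<open>T\<^bsup>w v\<^esup>\<close> for the variable \<open>v\<close> sends each monomial \<open>e\<close> to \<open>T\<^bsup>wt w e\<^esup>\<close>.\<close>

lemma coeff_kronecker:
  fixes p :: "('v, 'k::comm_ring_1) mpoly"
  assumes "inj_on (wt w) (keys p)" "e \<in> keys p"
  shows "coeff (mpoly_hom (\<lambda>a. [:a:]) (\<lambda>v. monom 1 (w v)) p) (wt w e) = lookup p e"
proof -
  have m: "monom_at (\<lambda>v. monom (1::'k) (w v)) e = monom 1 (wt w e)" for e :: "'v \<Rightarrow>\<^sub>0 nat"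
  proof -
    have "(\<Prod>v\<in>S. monom (1::'k) (f v)) = monom 1 (sum f S)" for f :: "'v \<Rightarrow> nat" and S
      by (induction S rule: infinite_finite_induct) (auto simp: mult_monom)
    then show ?thesis
      by (simp add: monom_at_def wt_def monom_power mult.commute)
  qed
  have "coeff (mpoly_hom (\<lambda>a. [:a:]) (\<lambda>v. monom 1 (w v)) p) (wt w e)
      = (\<Sum>e'\<in>keys p. if e' = e then lookup p e' else 0)"
    unfolding mpoly_hom_monoms m coeff_sum
    using assms by (intro sum.cong) (auto simp: inj_on_def)
  then show ?thesis using assms(2) by simp
qed

text \<open>After a Kronecker substitution that separates the monomials of both factors, the product of two nonzero
  polynomials is a nonzero polynomial in one variable, which has a point where it does not vanish.\<close>

lemma eval_at_mult_eq_zero: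
  fixes p q :: "('v, 'k::field_char_0) mpoly"
  assumes "finite V" "p \<in> poly_ring V" "q \<in> poly_ring V" "\<And>x. eval_at x p * eval_at x q = 0"
  shows "p = 0 \<or> q = 0"
proof (rule ccontr)
  assume "\<not> (p = 0 \<or> q = 0)"
  then obtain a b where ab: "a \<in> keys p" "b \<in> keys q"
    by (metis ex_in_conv poly_mapping_eqI in_keys_iff lookup_zero)
  obtain w where "inj_on (wt w) (keys p \<union> keys q)"
    using separating_weight[OF assms(1), of "keys p \<union> keys q"] assms(2,3)
    by (auto simp: poly_ring_def)
  then have inj: "inj_on (wt w) (keys p)" "inj_on (wt w) (keys q)"
    by (auto intro: inj_on_subset)
  let ?h = "mpoly_hom (\<lambda>a. [:a:]) (\<lambda>v. monom 1 (w v)) :: ('v, 'k) mpoly \<Rightarrow> 'k poly"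
  have "poly (?h p * ?h q) t = 0" for t
    using assms(4) by (simp add: poly_mpoly_hom)
  then have "?h p * ?h q = 0" by (metis poly_all_0_iff_0)
  moreover have "coeff (?h p) (wt w a) \<noteq> 0" "coeff (?h q) (wt w b) \<noteq> 0"
    using ab coeff_kronecker[OF inj(1) ab(1)] coeff_kronecker[OF inj(2) ab(2)]
    by (auto simp: in_keys_iff)
  ultimately show False by auto
qed

lemma eval_at_eq_zero:
  fixes p :: "('v, 'k::field_char_0) mpoly"
  assumes "finite V" "p \<in> poly_ring V" "\<And>x. eval_at x p = 0"
  shows "p = 0"
  using eval_at_mult_eq_zero[OF assms(1,2,2)] assms(3) by auto

lemma eval_at_inject:
  fixes p :: "('v, 'k::field_char_0) mpoly"
  assumes "finite V" "p \<in> poly_ring V" "q \<in> poly_ring V" "\<And>x. eval_at x p = eval_at x q"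
  shows "p = q"
  using eval_at_eq_zero[of V "p - q"] assms by (auto simp: eval_at_simps)

text \<open>The linear part of a polynomial is its derivative at the origin, along any curve.\<close>

lemma coeff_1_curve:
  fixes p :: "('v, 'k::comm_ring_1) mpoly" and c :: "'v \<Rightarrow> 'k poly"
  assumes "finite V" "p \<in> poly_ring V" "\<And>v. v \<in> V \<Longrightarrow> coeff (c v) 0 = 0"
  shows "coeff (mpoly_hom (\<lambda>a. [:a:]) c p) 1 = (\<Sum>v\<in>V. lookup p (single v 1) * coeff (c v) 1)"
  using assms(2)
proof -
  have c0: "coeff (p * q) 1 = coeff p 0 * coeff q 1 + coeff p 1 * coeff q 0" for p q :: "'k poly"
    by (simp add: coeff_mult)
  have c00: "coeff (p * q) 0 = coeff p 0 * coeff q 0" for p q :: "'k poly"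
    by (simp add: coeff_mult)
  have m0: "coeff (monom_at c e) 0 = (if e = 0 then 1 else 0)" if "keys e \<subseteq> V" for e
  proof (cases "e = 0")
    case False
    then obtain v where v: "v \<in> keys e" by (metis ex_in_conv poly_mapping_eqI in_keys_iff lookup_zero)
    have "coeff (c v ^ lookup e v) 0 = 0"
    proof -
      have "lookup e v = Suc (lookup e v - 1)" using v by (simp add: in_keys_iff)
      then have "c v ^ lookup e v = c v * c v ^ (lookup e v - 1)" by (metis power_Suc)
      then show ?thesis using assms(3)[of v] v that by (auto simp: c00)
    qed
    moreover have "monom_at c e = c v ^ lookup e v * (\<Prod>u\<in>keys e - {v}. c u ^ lookup e u)"
      using v by (simp add: monom_at_def prod.remove)
    ultimately show ?thesis using False by (simp add: c00)
  qed simp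
  have m1: "coeff (monom_at c e) 1 = (\<Sum>v\<in>V. if e = single v 1 then coeff (c v) 1 else 0)"
    if V: "keys e \<subseteq> V" for e
  proof (cases "e = 0")
    case True
    then show ?thesis by simp
  next
    case False
    then obtain v where v: "v \<in> keys e" by (metis ex_in_conv poly_mapping_eqI in_keys_iff lookup_zero)
    define e' where "e' = e - single v 1"
    have e: "e = single v 1 + e'"
      using v by (intro poly_mapping_eqI) (auto simp: e'_def lookup_add lookup_minus lookup_single when_def in_keys_iff)
    have V': "keys e' \<subseteq> V"
      using V by (auto simp: e'_def in_keys_iff lookup_minus)
    have "monom_at c e = c v * monom_at c e'"
      by (simp add: e monom_at_add monom_at_single)
    then have "coeff (monom_at c e) 1 = coeff (c v) 0 * coeff (monom_at c e') 1
        + coeff (c v) 1 * (if e' = 0 then 1 else 0)"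
      by (simp only: c0 m0[OF V'])
    moreover have "coeff (c v) 0 = 0" using assms(3) v V by blast
    ultimately have "coeff (monom_at c e) 1 = coeff (c v) 1 * (if e' = 0 then 1 else 0)"
      by simp
    also have "\<dots> = (\<Sum>u\<in>V. if e = single u 1 then coeff (c u) 1 else 0)"
    proof (cases "e' = 0")
      case True
      have "(\<Sum>u\<in>V. if e = single u 1 then coeff (c u) 1 else 0) = (\<Sum>u\<in>V. if v = u then coeff (c u) 1 else 0)"
        unfolding e True by simp
      moreover have "v \<in> V" using v V by blast
      ultimately show ?thesis using True assms(1) by simp
    next
      case False
      have "e \<noteq> single u 1" for u
      proof
        assume "e = single u 1"
        with v have "v = u" by simp
        then have "single v 1 + e' = single v 1 + 0" using \<open>e = single u 1\<close> e by (metis add_0_right)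
        then show False using False by (simp only: add_left_cancel)
      qed
      then show ?thesis using False by simp
    qed
    finally show ?thesis .
  qed
  have "coeff (mpoly_hom (\<lambda>a. [:a:]) c p) 1 = (\<Sum>e\<in>keys p. lookup p e * coeff (monom_at c e) 1)"
    by (simp add: mpoly_hom_monoms coeff_sum)
  also have "\<dots> = (\<Sum>e\<in>keys p. \<Sum>v\<in>V. if e = single v 1 then lookup p e * coeff (c v) 1 else 0)"
  proof (rule sum.cong[OF refl])
    fix e assume "e \<in> keys p"
    then have "keys e \<subseteq> V" using assms(2) by (auto simp: poly_ring_def)
    from m1[OF this] show "lookup p e * coeff (monom_at c e) 1
        = (\<Sum>v\<in>V. if e = single v 1 then lookup p e * coeff (c v) 1 else 0)"
      by (simp only: sum_distrib_left if_distrib[of "(*) (lookup p e)"] mult_zero_right)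
  qed
  also have "\<dots> = (\<Sum>v\<in>V. \<Sum>e\<in>keys p. if e = single v 1 then lookup p e * coeff (c v) 1 else 0)"
    by (rule sum.swap)
  also have "\<dots> = (\<Sum>v\<in>V. lookup p (single v 1) * coeff (c v) 1)"
  proof (rule sum.cong[OF refl])
    fix v
    have "(\<Sum>e\<in>keys p. if e = single v 1 then lookup p e * coeff (c v) 1 else 0)
        = (if single v 1 \<in> keys p then lookup p (single v 1) * coeff (c v) 1 else 0)"
      by (rule sum.delta) simp
    also have "\<dots> = lookup p (single v 1) * coeff (c v) 1"
      by (metis in_keys_iff mult_zero_left)
    finally show "(\<Sum>e\<in>keys p. if e = single v 1 then lookup p e * coeff (c v) 1 else 0)
        = lookup p (single v 1) * coeff (c v) 1" .
  qed
  finally show ?thesis .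
qed

lemma lookup_single_mult:
  fixes p :: "('v, 'k::comm_ring_1) mpoly"
  shows "lookup (single a c * p) (a + e) = c * lookup p e"
proof -
  have "single a c * p = single a c * (\<Sum>e'\<in>keys p. single e' (lookup p e'))"
    by (simp only: poly_mapping_sum_singles)
  also have "\<dots> = (\<Sum>e'\<in>keys p. single (a + e') (c * lookup p e'))"
    by (simp only: sum_distrib_left mult_single)
  finally have "lookup (single a c * p) (a + e) = (\<Sum>e'\<in>keys p. lookup (single (a + e') (c * lookup p e')) (a + e))"
    by (simp only: lookup_sum)
  also have "\<dots> = (\<Sum>e'\<in>keys p. if e' = e then c * lookup p e' else 0)"
    by (rule sum.cong) (simp_all add: lookup_single when_def)
  also have "\<dots> = (if e \<in> keys p then c * lookup p e else 0)"
    by (rule sum.delta) simp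
  finally show ?thesis by (simp add: in_keys_iff)
qed

lemma keys_single_mult:
  assumes "e \<in> keys (single a c * p)"
  shows "\<exists>e'\<in>keys p. e = a + e'"
proof -
  obtain a' e' where "e = a' + e'" "a' \<in> keys (single a c)" "e' \<in> keys p"
    using assms Poly_Mapping.keys_mult[of "single a c" p] by blast
  then show ?thesis by (auto split: if_splits)
qed

section \<open>Multiplicative actions on a rigid hypersurface commute\<close>

text \<open>Regular functions are added and multiplied as elements of the ring of functions; these rules
  would expand the ring operations into pointwise ones.\<close>

declare plus_fun_apply [simp del] times_fun_apply [simp del] zero_fun_apply [simp del]
lemmas fun_app = plus_fun_apply times_fun_apply zero_fun_apply

lemma poly_eqI_all: "(\<And>t. poly p t = poly q t) \<Longrightarrow> p = (q :: 'k::field_char_0 poly)"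
  by (metis poly_eq_poly_eq_iff ext)

lemma poly_sum_coeff:
  fixes p :: "'a::comm_semiring_1 poly"
  assumes "degree p \<le> N"
  shows "poly p t = (\<Sum>i\<le>N. coeff p i * t ^ i)"
  by (subst poly_as_sum_of_monoms'[OF assms, symmetric]) (simp add: poly_sum poly_monom)

text \<open>With \<open>a k = (D\<^sup>k f) x\<close> for a nilpotent operator \<open>D\<close>, this is the law \<open>exp (s D) exp (t D) = exp ((s + t) D)\<close>;
  the square array on the left can be cut down to its triangle because \<open>a\<close> vanishes beyond \<open>M\<close>.\<close>

lemma sum_exponential_array:
  fixes a :: "nat \<Rightarrow> 'k::field_char_0"
  assumes "\<And>k. k > M \<Longrightarrow> a k = 0"
  shows "(\<Sum>n\<le>M. \<Sum>m\<le>M. a (n + m) / (fact n * fact m) * s ^ n * t ^ m)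
       = (\<Sum>k\<le>M. a k / fact k * (s + t) ^ k)"
proof -
  define f where "f n m = a (n + m) / (fact n * fact m) * s ^ n * t ^ m" for n m
  have "(\<Sum>n\<le>M. \<Sum>m\<le>M. f n m) = (\<Sum>(n, m)\<in>{..M} \<times> {..M}. f n m)"
    by (simp add: sum.cartesian_product)
  also have "\<dots> = (\<Sum>(n, m)\<in>{(n, m). n + m \<le> M}. f n m)"
  proof (rule sum.mono_neutral_right)
    show "\<forall>i\<in>{..M} \<times> {..M} - {(n, m). n + m \<le> M}. (case i of (n, m) \<Rightarrow> f n m) = 0"
      using assms[of "_ + _"] by (auto simp: f_def) (meson not_le)
  qed auto
  also have "\<dots> = (\<Sum>k\<le>M. \<Sum>n\<le>k. f n (k - n))"
    by (rule sum.triangle_reindex_eq)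
  also have "\<dots> = (\<Sum>k\<le>M. a k / fact k * (s + t) ^ k)"
  proof (rule sum.cong[OF refl])
    fix k
    have "f n (k - n) = a k / fact k * (of_nat (k choose n) * s ^ n * t ^ (k - n))" if "n \<le> k" for n
      using that by (simp add: f_def binomial_fact field_simps)
    then show "(\<Sum>n\<le>k. f n (k - n)) = a k / fact k * (s + t) ^ k"
      by (simp add: binomial_ring sum_distrib_left)
  qed
  finally show ?thesis by (simp add: f_def)
qed

locale hypersurface =
  fixes V :: "'v set" and F :: "('v, 'k::field_char_0) mpoly"
  assumes finite_V: "finite V" and F_poly: "F \<in> poly_ring V"
begin

abbreviation X :: "('v \<Rightarrow> 'k) set" where "X \<equiv> zero_set V F"

lemma X_ext: "x \<in> X \<Longrightarrow> y \<in> X \<Longrightarrow> (\<And>v. v \<in> V \<Longrightarrow> x v = y v) \<Longrightarrow> x = y"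
  by (rule PiE_ext[of x V "\<lambda>_. UNIV" y]) (auto simp: zero_set_def affine_space_def)

lemma eval_F: "x \<in> X \<Longrightarrow> eval_at x F = 0"
  by (simp add: zero_set_def)

subsection \<open>Regular functions\<close>

text \<open>Extending by zero makes equality on \<open>X\<close> an honest equality of functions.\<close>

definition zext :: "(('v \<Rightarrow> 'k) \<Rightarrow> 'k) \<Rightarrow> ('v \<Rightarrow> 'k) \<Rightarrow> 'k" where
  "zext f = (\<lambda>x. if x \<in> X then f x else 0)"

definition reg :: "(('v \<Rightarrow> 'k) \<Rightarrow> 'k) set" where
  "reg = {zext (\<lambda>x. eval_at x p) | p. p \<in> poly_ring V}"

abbreviation coord :: "'v \<Rightarrow> ('v \<Rightarrow> 'k) \<Rightarrow> 'k" where
  "coord v \<equiv> zext (\<lambda>x. x v)"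

lemma zext_apply [simp]: "x \<in> X \<Longrightarrow> zext f x = f x"
  by (simp add: zext_def)

lemma zext_cong: "(\<And>x. x \<in> X \<Longrightarrow> f x = g x) \<Longrightarrow> zext f = zext g"
  by (auto simp: zext_def)

lemma zext_add: "zext (\<lambda>x. f x + g x) = zext f + zext g"
  by (auto simp: zext_def fun_app)

lemma zext_mult: "zext (\<lambda>x. f x * g x) = zext f * zext g"
  by (auto simp: zext_def fun_app)

lemma zext_eqI: "f \<in> reg \<Longrightarrow> (\<And>x. x \<in> X \<Longrightarrow> f x = g x) \<Longrightarrow> f = zext g"
  by (auto simp: reg_def zext_def)

lemma reg_eqI: "f \<in> reg \<Longrightarrow> g \<in> reg \<Longrightarrow> (\<And>x. x \<in> X \<Longrightarrow> f x = g x) \<Longrightarrow> f = g"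
  by (auto simp: reg_def zext_def)

lemma reg_eval: "p \<in> poly_ring V \<Longrightarrow> zext (\<lambda>x. eval_at x p) \<in> reg"
  by (auto simp: reg_def)

lemma reg_poly: "f \<in> reg \<Longrightarrow> \<exists>p\<in>poly_ring V. \<forall>x\<in>X. f x = eval_at x p"
  by (auto simp: reg_def)

lemma reg_add:
  assumes "f \<in> reg" "g \<in> reg"
  shows "f + g \<in> reg"
proof -
  obtain p q where "p \<in> poly_ring V" "f = zext (\<lambda>x. eval_at x p)"
    and "q \<in> poly_ring V" "g = zext (\<lambda>x. eval_at x q)"
    using assms by (auto simp: reg_def)
  then show ?thesis
    using reg_eval[of "p + q"] by (simp add: eval_at_simps zext_add poly_ring_add)
qed

lemma reg_mult:
  assumes "f \<in> reg" "g \<in> reg"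
  shows "f * g \<in> reg"
proof -
  obtain p q where "p \<in> poly_ring V" "f = zext (\<lambda>x. eval_at x p)"
    and "q \<in> poly_ring V" "g = zext (\<lambda>x. eval_at x q)"
    using assms by (auto simp: reg_def)
  then show ?thesis
    using reg_eval[of "p * q"] by (simp add: eval_at_simps zext_mult poly_ring_mult)
qed

lemma reg_smult:
  assumes "f \<in> reg" shows "(\<lambda>_. c) * f \<in> reg"
proof -
  obtain p where p: "p \<in> poly_ring V" "f = zext (\<lambda>x. eval_at x p)"
    using assms by (auto simp: reg_def)
  have "(\<lambda>_. c) * f = zext (\<lambda>x. eval_at x (const c * p))"
    by (auto simp: p(2) zext_def eval_at_simps fun_app)
  then show ?thesis using p(1) by (simp add: reg_eval poly_ring_mult)
qed

lemma reg_zero: "0 \<in> reg"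
  unfolding reg_def by (auto simp: zext_def eval_at_simps fun_app intro!: exI[of _ 0])

lemma reg_sum: "(\<And>i. i \<in> S \<Longrightarrow> f i \<in> reg) \<Longrightarrow> sum f S \<in> reg"
  by (induction S rule: infinite_finite_induct) (auto intro: reg_add reg_zero)

lemma reg_const: "zext (\<lambda>_. c) \<in> reg"
  unfolding reg_def by (auto intro!: exI[of _ "const c"])

lemma reg_coord: "v \<in> V \<Longrightarrow> coord v \<in> reg"
  unfolding reg_def by (auto intro!: exI[of _ "var v"])

lemma reg_induct [consumes 1, case_names const coord add mult]:
  assumes "f \<in> reg"
    and "\<And>c. P (zext (\<lambda>_. c))" and "\<And>v. v \<in> V \<Longrightarrow> P (coord v)"
    and "\<And>f g. f \<in> reg \<Longrightarrow> g \<in> reg \<Longrightarrow> P f \<Longrightarrow> P g \<Longrightarrow> P (f + g)"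
    and "\<And>f g. f \<in> reg \<Longrightarrow> g \<in> reg \<Longrightarrow> P f \<Longrightarrow> P g \<Longrightarrow> P (f * g)"
  shows "P f"
proof -
  obtain p where p: "p \<in> poly_ring V" "f = zext (\<lambda>x. eval_at x p)"
    using assms(1) by (auto simp: reg_def)
  have "zext (\<lambda>x. eval_at x p) \<in> reg \<and> P (zext (\<lambda>x. eval_at x p))"
    using p(1)
    by (induction p rule: poly_ring_induct)
      (auto simp: eval_at_simps zext_add zext_mult intro: assms reg_const reg_coord reg_add reg_mult)
  then show ?thesis using p(2) by simp
qed

lemma smult_zext: "(\<lambda>_. c) * f = zext (\<lambda>_. c) * f" if "f \<in> reg"
  using that by (auto simp: reg_def zext_def fun_app)

subsection \<open>Derivations\<close>

text \<open>Scalars enter as constant functions; only the values on \<open>reg\<close> are constrained.\<close>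

definition derivation :: "((('v \<Rightarrow> 'k) \<Rightarrow> 'k) \<Rightarrow> (('v \<Rightarrow> 'k) \<Rightarrow> 'k)) \<Rightarrow> bool" where
  "derivation D \<longleftrightarrow> (\<forall>f\<in>reg. D f \<in> reg) \<and> (\<forall>f\<in>reg. \<forall>g\<in>reg. D (f + g) = D f + D g) \<and>
     (\<forall>c. \<forall>f\<in>reg. D ((\<lambda>_. c) * f) = (\<lambda>_. c) * D f) \<and>
     (\<forall>f\<in>reg. \<forall>g\<in>reg. D (f * g) = D f * g + f * D g)"

lemma derivationD:
  assumes "derivation D" "f \<in> reg"
  shows "D f \<in> reg" "D ((\<lambda>_. c) * f) = (\<lambda>_. c) * D f"
    and "g \<in> reg \<Longrightarrow> D (f + g) = D f + D g" "g \<in> reg \<Longrightarrow> D (f * g) = D f * g + f * D g"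
  using assms by (auto simp: derivation_def)

lemma derivation_0:
  assumes "derivation D" shows "D 0 = 0"
  using derivationD(3)[OF assms reg_zero reg_zero] by simp

lemma derivation_sum:
  assumes "derivation D" "\<And>i. i \<in> S \<Longrightarrow> f i \<in> reg"
  shows "D (sum f S) = (\<Sum>i\<in>S. D (f i))"
  using assms(2)
  by (induction S rule: infinite_finite_induct)
    (auto simp: derivation_0[OF assms(1)] derivationD(3)[OF assms(1)] reg_sum)

lemma derivation_const:
  assumes "derivation D" shows "D (zext (\<lambda>_. c)) = 0"
proof -
  let ?e = "zext (\<lambda>_. 1)"
  have e: "f = ?e * f" if "f \<in> reg" for f
    using smult_zext[OF that, of 1] by (simp add: fun_eq_iff fun_app)
  have De: "D ?e \<in> reg" by (rule derivationD(1)[OF assms reg_const])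
  have "D ?e = D ?e * ?e + ?e * D ?e"
    using derivationD(4)[OF assms reg_const reg_const, of 1 1] e[OF reg_const] by metis
  also have "\<dots> = D ?e + D ?e" using e[OF De] by (simp add: mult.commute)
  finally have "D ?e = 0" by simp
  moreover have "zext (\<lambda>_. c) = (\<lambda>_. c) * ?e" by (auto simp: zext_def fun_app)
  ultimately show ?thesis using derivationD(2)[OF assms reg_const] by simp
qed

lemma derivation_eq_zero:
  assumes "derivation D" "\<And>v. v \<in> V \<Longrightarrow> D (coord v) = 0" "f \<in> reg"
  shows "D f = 0"
  using assms(3)
  by (induction f rule: reg_induct)
    (auto simp: derivation_const[OF assms(1)] assms(2) derivationD(3,4)[OF assms(1)])

lemma derivation_funpow:
  assumes "derivation D" "f \<in> reg"
  shows "(D ^^ n) f \<in> reg"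
  by (induction n) (auto simp: assms derivationD(1)[OF assms(1)])

lemma derivation_funpow_0:
  assumes "derivation D"
  shows "(D ^^ n) 0 = 0"
  by (induction n) (auto simp: derivation_0[OF assms])

lemma derivation_funpow_mono:
  assumes "derivation D" "(D ^^ n) f = 0" "m \<ge> n"
  shows "(D ^^ m) f = 0"
proof -
  have "(D ^^ m) f = (D ^^ (m - n)) ((D ^^ n) f)"
    using assms(3) by (metis funpow_add comp_apply le_add_diff_inverse2)
  then show ?thesis by (simp add: assms(2) derivation_funpow_0[OF assms(1)])
qed

lemma derivation_funpow_add:
  assumes "derivation D" "f \<in> reg" "g \<in> reg"
  shows "(D ^^ n) (f + g) = (D ^^ n) f + (D ^^ n) g"
  by (induction n) (auto simp: derivationD(3)[OF assms(1)] derivation_funpow assms)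

lemma derivation_funpow_sum:
  assumes "derivation D" "\<And>i. i \<in> S \<Longrightarrow> f i \<in> reg"
  shows "(D ^^ n) (sum f S) = (\<Sum>i\<in>S. (D ^^ n) (f i))"
  using assms(2)
  by (induction S rule: infinite_finite_induct)
    (auto simp: derivation_funpow_0[OF assms(1)] derivation_funpow_add[OF assms(1)] reg_sum)

text \<open>Leibniz' rule in divided powers, which makes the exponential series of \<open>D\<close> multiplicative.\<close>

lemma derivation_funpow_mult:
  assumes D: "derivation D" and f: "f \<in> reg" and g: "g \<in> reg"
  shows "(D ^^ n) (f * g) x / fact n
    = (\<Sum>k\<le>n. ((D ^^ k) f x / fact k) * ((D ^^ (n - k)) g x / fact (n - k)))"
proof -
  let ?T = "\<lambda>n k. (\<lambda>_. of_nat (n choose k)) * ((D ^^ k) f * (D ^^ (n - k)) g)"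
  have r: "(D ^^ k) f * (D ^^ m) g \<in> reg" for k m
    by (intro reg_mult derivation_funpow D f g)
  have "(D ^^ n) (f * g) = (\<Sum>k\<le>n. ?T n k)"
  proof (induction n)
    case 0
    show ?case by (simp add: fun_eq_iff fun_app)
  next
    case (Suc n)
    have "(D ^^ Suc n) (f * g) = D (\<Sum>k\<le>n. ?T n k)" by (simp add: Suc.IH)
    also have "\<dots> = (\<Sum>k\<le>n. (\<lambda>_. of_nat (n choose k)) *
        ((D ^^ Suc k) f * (D ^^ (n - k)) g + (D ^^ k) f * (D ^^ (Suc n - k)) g))"
      by (subst derivation_sum[OF D])
        (auto simp: derivationD(2,4)[OF D] r derivation_funpow[OF D] f g reg_smult Suc_diff_le
          intro!: sum.cong)
    also have "\<dots> = (\<Sum>k\<le>Suc n. ?T (Suc n) k)"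
    proof
      fix x
      define A where "A k = (D ^^ k) f x" for k
      define B where "B k = (D ^^ k) g x" for k
      have app: "(\<Sum>i\<in>S. h i) x = (\<Sum>i\<in>S. h i x)" for h :: "nat \<Rightarrow> ('v \<Rightarrow> 'k) \<Rightarrow> 'k" and S
        by (induction S rule: infinite_finite_induct) (auto simp: fun_app)
      have "(\<Sum>k\<le>n. of_nat (n choose k) * (A (Suc k) * B (n - k) + A k * B (Suc n - k)))
          = (\<Sum>k\<le>n. of_nat (n choose k) * A (Suc k) * B (n - k))
          + (\<Sum>k\<le>n. of_nat (n choose k) * A k * B (Suc n - k))"
        by (simp add: sum.distrib algebra_simps)
      also have "(\<Sum>k\<le>n. of_nat (n choose k) * A k * B (Suc n - k))
          = (\<Sum>k\<le>Suc n. of_nat (n choose k) * A k * B (Suc n - k))"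
        by simp
      also have "\<dots> = A 0 * B (Suc n) + (\<Sum>k\<le>n. of_nat (n choose Suc k) * A (Suc k) * B (n - k))"
        by (simp add: sum.atMost_Suc_shift del: sum.atMost_Suc)
      also have "(\<Sum>k\<le>n. of_nat (n choose k) * A (Suc k) * B (n - k)) + \<dots>
          = (\<Sum>k\<le>Suc n. of_nat (Suc n choose k) * A k * B (Suc n - k))"
        by (simp add: sum.atMost_Suc_shift sum.distrib algebra_simps del: sum.atMost_Suc)
      finally show "(\<Sum>k\<le>n. (\<lambda>_. of_nat (n choose k)) *
        ((D ^^ Suc k) f * (D ^^ (n - k)) g + (D ^^ k) f * (D ^^ (Suc n - k)) g)) x
        = (\<Sum>k\<le>Suc n. ?T (Suc n) k) x"
        unfolding app by (simp add: A_def B_def mult.assoc fun_app del: sum.atMost_Suc)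
    qed
    finally show ?case .
  qed
  moreover have app: "(\<Sum>i\<in>S. h i) x = (\<Sum>i\<in>S. h i x)" for h :: "nat \<Rightarrow> ('v \<Rightarrow> 'k) \<Rightarrow> 'k" and S
    by (induction S rule: infinite_finite_induct) (auto simp: fun_app)
  ultimately have "(D ^^ n) (f * g) x = (\<Sum>k\<le>n. of_nat (n choose k) * ((D ^^ k) f x * (D ^^ (n - k)) g x))"
    by (simp add: fun_app)
  then show ?thesis
    by (auto simp: sum_divide_distrib binomial_fact intro!: sum.cong)
qed

subsection \<open>Actions of the additive group\<close>

text \<open>It is convenient to describe an action by maps on all points and by polynomial functions; their
  restrictions to \<open>X\<close> form the homomorphism to the group of bijections that the definition asks for.\<close>

lemma rigidD:
  assumes rig: "rigid V X"
    and mem: "\<And>s x. x \<in> X \<Longrightarrow> \<Phi> s x \<in> X"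
    and id: "\<And>x. x \<in> X \<Longrightarrow> \<Phi> 0 x = x"
    and add: "\<And>s t x. x \<in> X \<Longrightarrow> \<Phi> s (\<Phi> t x) = \<Phi> (s + t) x"
    and reg: "\<And>v. v \<in> V \<Longrightarrow> \<exists>h. poly_fun (insert None (Some ` V)) h \<and>
       (\<forall>s. \<forall>x\<in>X. \<Phi> s x v = h (case_option s x))"
    and x: "x \<in> X"
  shows "\<Phi> s x = x"
proof -
  let ?P = "\<lambda>s. restrict (\<Phi> s) X"
  have bij: "?P s \<in> Bij X" for s
  proof -
    have "bij_betw (\<Phi> s) X X"
      by (rule bij_betw_byWitness[where f' = "\<Phi> (- s)"]) (auto simp: add id mem)
    then show ?thesis by (auto simp: Bij_def cong: bij_betw_cong)
  qed
  have g: "group (additive_group :: 'k monoid)"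
    by (rule groupI) (auto simp: additive_group_def add.assoc intro: exI[of _ "- _"])
  have "group_hom additive_group (BijGroup X) ?P"
  proof (rule group_hom.intro[OF g group_BijGroup], unfold_locales, rule homI)
    fix s t :: 'k
    show "?P s \<in> carrier (BijGroup X)" using bij by (simp add: BijGroup_def)
    show "?P (s \<otimes>\<^bsub>additive_group\<^esub> t) = ?P s \<otimes>\<^bsub>BijGroup X\<^esub> ?P t"
      using bij by (auto simp: BijGroup_def additive_group_def compose_def fun_eq_iff mem add)
  qed
  moreover have "\<exists>g. (\<forall>v \<in> V. g v \<in> poly_ring (insert None (Some ` V))) \<and>
          (\<forall>s. \<forall>x \<in> X. \<forall>v \<in> V. ?P s x v = eval_at (case_option s x) (g v))"
  proof -
    have "\<forall>v\<in>V. \<exists>g. g \<in> poly_ring (insert None (Some ` V)) \<and>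
        (\<forall>s. \<forall>x \<in> X. \<Phi> s x v = eval_at (case_option s x) g)"
      using reg unfolding poly_fun_def by metis
    from bchoice[OF this] show ?thesis by auto
  qed
  ultimately have "algebraic_Ga_action V X ?P"
    by (simp add: algebraic_Ga_action_def group_action_def)
  then show ?thesis using rig x by (auto simp: rigid_def)
qed

text \<open>Here \<open>P f x\<close> is the polynomial \<open>s \<mapsto> (exp (s D) f) x\<close>. Since \<open>exp (s D)\<close> is a ring homomorphism, there is a
  point \<open>\<Phi> s x\<close> of \<open>X\<close> at which every \<open>f\<close> has the value \<open>(exp (s D) f) x\<close>. As \<open>\<Phi>\<close> is an action of the additive
  group, it is trivial, so that \<open>P f x\<close> is constant; its linear coefficient is \<open>(D f) x\<close>.\<close>

lemma rigid_locally_nilpotent: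
  assumes rig: "rigid V X" and D: "derivation D"
    and nil: "\<And>f. f \<in> reg \<Longrightarrow> \<exists>n. (D ^^ n) f = 0" and f: "f \<in> reg"
  shows "D f = 0"
proof -
  define P where "P f x = Abs_poly (\<lambda>n. (D ^^ n) f x / fact n)" for f x
  have coeff_P: "coeff (P f x) n = (D ^^ n) f x / fact n" if f: "f \<in> reg" for f x n
  proof -
    obtain N where "(D ^^ N) f = 0" using nil f by blast
    then have "(D ^^ m) f x / fact m = 0" if "m > N" for m
      using derivation_funpow_mono[OF D, of N f m] that by (simp add: fun_app)
    then show ?thesis unfolding P_def by (subst coeff_Abs_poly) auto
  qed
  have P_add: "P (f + g) x = P f x + P g x" if "f \<in> reg" "g \<in> reg" for f g x
    by (rule poly_eqI)
      (simp add: coeff_P that reg_add derivation_funpow_add[OF D] add_divide_distrib fun_app)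
  have P_mult: "P (f * g) x = P f x * P g x" if "f \<in> reg" "g \<in> reg" for f g x
    by (rule poly_eqI)
      (simp add: coeff_P that reg_mult derivation_funpow_mult[OF D] coeff_mult)
  have P_const: "P (zext (\<lambda>_. c)) x = [:c:]" if "x \<in> X" for c x
  proof (rule poly_eqI)
    fix n
    show "coeff (P (zext (\<lambda>_. c)) x) n = coeff [:c:] n"
    proof (cases n)
      case 0
      then show ?thesis using that by (simp add: coeff_P reg_const)
    next
      case (Suc m)
      have "(D ^^ Suc m) (zext (\<lambda>_. c)) = 0"
        by (simp only: funpow_Suc_right comp_apply derivation_const[OF D] derivation_funpow_0[OF D])
      then show ?thesis using Suc by (simp only: coeff_P[OF reg_const]) (simp add: fun_app)
    qed
  qed
  define \<Phi> where "\<Phi> s x = (\<lambda>v\<in>V. poly (P (coord v) x) s)" for s x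
  have eval: "eval_at (\<Phi> s x) p = poly (P (zext (\<lambda>x. eval_at x p)) x) s"
    if x: "x \<in> X" and p: "p \<in> poly_ring V" for s x p
  proof -
    have "zext (\<lambda>x. eval_at x p) \<in> reg \<and> eval_at (\<Phi> s x) p = poly (P (zext (\<lambda>x. eval_at x p)) x) s"
      using p
      by (induction p rule: poly_ring_induct)
        (auto simp: eval_at_simps zext_add zext_mult P_add P_mult P_const[OF x] \<Phi>_def
          intro: reg_const reg_coord reg_add reg_mult)
    then show ?thesis by simp
  qed
  have P_0: "P 0 x = 0" for x
    by (rule poly_eqI) (simp add: coeff_P reg_zero derivation_funpow_0[OF D] fun_app)
  have mem: "\<Phi> s x \<in> X" if "x \<in> X" for s x
  proof -
    have "zext (\<lambda>x. eval_at x F) = 0" by (auto simp: zext_def eval_F fun_app)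
    then have "eval_at (\<Phi> s x) F = 0" using eval[OF that F_poly] by (simp add: P_0)
    then show ?thesis by (auto simp: zero_set_def affine_space_def \<Phi>_def)
  qed
  have reg_\<Phi>: "f (\<Phi> s x) = poly (P f x) s" if "x \<in> X" "f \<in> reg" for f s x
    using that mem[OF that(1)] eval[OF that(1)] by (auto simp: reg_def)
  have poly_P: "poly (P f x) s = (\<Sum>n\<le>N. (D ^^ n) f x / fact n * s ^ n)"
    if f: "f \<in> reg" and N: "(D ^^ N) f = 0" for f x s N
  proof -
    have "coeff (P f x) n = 0" if "n > N" for n
      using derivation_funpow_mono[OF D N, of n] that f by (simp add: coeff_P fun_app)
    then have "degree (P f x) \<le> N" by (intro degree_le) auto
    then show ?thesis by (simp add: poly_sum_coeff coeff_P f)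
  qed
  have id: "\<Phi> 0 x = x" if "x \<in> X" for x
    by (rule X_ext[OF mem[OF that] that])
      (use that in \<open>simp add: \<Phi>_def poly_0_coeff_0 coeff_P reg_coord\<close>)
  have comp: "\<Phi> s (\<Phi> t x) = \<Phi> (s + t) x" if x: "x \<in> X" for s t x
  proof (rule X_ext[OF mem[OF mem[OF x]] mem[OF x]])
    fix v assume v: "v \<in> V"
    let ?c = "coord v"
    obtain N where N: "(D ^^ N) ?c = 0" using nil reg_coord[OF v] by blast
    have N': "(D ^^ N) ((D ^^ n) ?c) = 0" for n
      using derivation_funpow_mono[OF D N, of "N + n"] by (simp add: funpow_add)
    have "\<Phi> s (\<Phi> t x) v = (\<Sum>n\<le>N. (D ^^ n) ?c (\<Phi> t x) / fact n * s ^ n)"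
      using v by (simp add: \<Phi>_def poly_P[OF reg_coord[OF v] N])
    also have "\<dots> = (\<Sum>n\<le>N. \<Sum>m\<le>N. (D ^^ (n + m)) ?c x / (fact n * fact m) * s ^ n * t ^ m)"
    proof (rule sum.cong[OF refl])
      fix n
      have r: "(D ^^ n) ?c \<in> reg" by (intro derivation_funpow D reg_coord v)
      have "(D ^^ n) ?c (\<Phi> t x) = (\<Sum>m\<le>N. (D ^^ (n + m)) ?c x / fact m * t ^ m)"
        by (simp add: reg_\<Phi>[OF x r] poly_P[OF r N'] funpow_add add.commute[of n])
      then show "(D ^^ n) ?c (\<Phi> t x) / fact n * s ^ n
          = (\<Sum>m\<le>N. (D ^^ (n + m)) ?c x / (fact n * fact m) * s ^ n * t ^ m)"
        by (simp add: sum_divide_distrib sum_distrib_left mult_ac)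
    qed
    also have "\<dots> = (\<Sum>k\<le>N. (D ^^ k) ?c x / fact k * (s + t) ^ k)"
      by (rule sum_exponential_array) (use derivation_funpow_mono[OF D N] in \<open>simp add: fun_app\<close>)
    also have "\<dots> = \<Phi> (s + t) x v"
      using v by (simp add: \<Phi>_def poly_P[OF reg_coord[OF v] N])
    finally show "\<Phi> s (\<Phi> t x) v = \<Phi> (s + t) x v" .
  qed
  have algebraic: "\<exists>h. poly_fun (insert None (Some ` V)) h \<and> (\<forall>s. \<forall>x\<in>X. \<Phi> s x v = h (case_option s x))"
    if v: "v \<in> V" for v
  proof -
    obtain N where N: "(D ^^ N) (coord v) = 0" using nil reg_coord[OF v] by blast
    have "\<forall>n. \<exists>p\<in>poly_ring V. \<forall>x\<in>X. (D ^^ n) (coord v) x = eval_at x p"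
      by (intro allI reg_poly derivation_funpow D reg_coord v)
    then obtain p where p: "\<And>n. p n \<in> poly_ring V" "\<And>n x. x \<in> X \<Longrightarrow> (D ^^ n) (coord v) x = eval_at x (p n)"
      by metis
    let ?h = "\<lambda>y. \<Sum>n\<le>N. eval_at (\<lambda>v. y (Some v)) (p n) * (1 / fact n) * y None ^ n"
    have "poly_fun (insert None (Some ` V)) ?h"
      by (intro poly_fun_sum poly_fun_mult poly_fun_eval_at[OF p(1)] poly_fun_const poly_fun_power
          poly_fun_var) auto
    moreover have "\<forall>s. \<forall>x\<in>X. \<Phi> s x v = ?h (case_option s x)"
      using v by (auto simp: \<Phi>_def poly_P[OF reg_coord[OF v] N] p)
    ultimately show ?thesis by blast
  qed
  have "D (coord v) = 0" if v: "v \<in> V" for v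
  proof (rule reg_eqI)
    show "D (coord v) \<in> reg" "0 \<in> reg" by (rule derivationD(1)[OF D reg_coord[OF v]], rule reg_zero)
    fix x assume x: "x \<in> X"
    have "poly (P (coord v) x) s = poly [:x v:] s" for s
    proof -
      have "\<Phi> s x = x"
        by (rule rigidD[of \<Phi>, OF rig mem id comp algebraic x])
      then have "\<Phi> s x v = x v" by simp
      then show ?thesis using v by (simp add: \<Phi>_def)
    qed
    then have "P (coord v) x = [:x v:]" by (rule poly_eqI_all)
    then have "coeff (P (coord v) x) 1 = 0" by simp
    then show "D (coord v) x = 0 x" by (simp add: coeff_P reg_coord v fun_app)
  qed
  then show ?thesis by (rule derivation_eq_zero[OF D _ f])
qed

subsection \<open>Actions of the multiplicative monoid\<close>

text \<open>The function \<open>t \<mapsto> f (\<alpha> t x)\<close> is a polynomial whose coefficients are regular functions of \<open>x\<close>.\<close>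

definition expands :: "('k \<Rightarrow> ('v \<Rightarrow> 'k) \<Rightarrow> ('v \<Rightarrow> 'k)) \<Rightarrow> (('v \<Rightarrow> 'k) \<Rightarrow> 'k) \<Rightarrow> bool" where
  "expands \<alpha> f \<longleftrightarrow> (\<exists>P N. (\<forall>x\<in>X. \<forall>t. poly (P x) t = f (\<alpha> t x)) \<and>
     (\<forall>d. zext (\<lambda>x. coeff (P x) d) \<in> reg) \<and> (\<forall>x\<in>X. degree (P x) \<le> N))"

text \<open>The action includes \<open>t = 0\<close>. This is what makes \<open>f (\<alpha> t x)\<close> a polynomial in \<open>t\<close>, and not a Laurent
  polynomial, so that the induced grading has no negative degrees.\<close>

definition mult_action :: "('k \<Rightarrow> ('v \<Rightarrow> 'k) \<Rightarrow> ('v \<Rightarrow> 'k)) \<Rightarrow> bool" where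
  "mult_action \<alpha> \<longleftrightarrow> (\<forall>t. \<forall>x\<in>X. \<alpha> t x \<in> X) \<and> (\<forall>x\<in>X. \<alpha> 1 x = x) \<and>
     (\<forall>s t. \<forall>x\<in>X. \<alpha> s (\<alpha> t x) = \<alpha> (s * t) x) \<and> (\<forall>v\<in>V. expands \<alpha> (coord v))"

text \<open>The polynomial \<open>t \<mapsto> f (\<alpha> t x)\<close>. Its coefficients are the homogeneous components of \<open>f\<close> for the grading
  defined by \<open>\<alpha>\<close>, and its derivative at \<open>t = 1\<close> is the derivative of \<open>f\<close> along the action.\<close>

definition orbit_poly :: "('k \<Rightarrow> ('v \<Rightarrow> 'k) \<Rightarrow> ('v \<Rightarrow> 'k)) \<Rightarrow> (('v \<Rightarrow> 'k) \<Rightarrow> 'k) \<Rightarrow> ('v \<Rightarrow> 'k) \<Rightarrow> 'k poly" where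
  "orbit_poly \<alpha> f x = (THE P. \<forall>t. poly P t = f (\<alpha> t x))"

definition component where
  "component \<alpha> d f = zext (\<lambda>x. coeff (orbit_poly \<alpha> f x) d)"

definition euler where
  "euler \<alpha> f = zext (\<lambda>x. poly (pderiv (orbit_poly \<alpha> f x)) 1)"

definition homogeneous where
  "homogeneous \<alpha> d f \<longleftrightarrow> f \<in> reg \<and> (\<forall>s. \<forall>x\<in>X. f (\<alpha> s x) = s ^ d * f x)"

lemma mult_actionD:
  assumes "mult_action \<alpha>" "x \<in> X"
  shows "\<alpha> t x \<in> X" "\<alpha> 1 x = x" "\<alpha> s (\<alpha> t x) = \<alpha> (s * t) x"
  using assms by (auto simp: mult_action_def)

lemma expands_reg:
  assumes \<alpha>: "mult_action \<alpha>" and f: "f \<in> reg"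
  shows "expands \<alpha> f"
  using f
proof (induction f rule: reg_induct)
  case (const c)
  show ?case
    unfolding expands_def
    by (intro exI[of _ "\<lambda>_. [:c:]"] exI[of _ 0])
      (auto simp: mult_actionD[OF \<alpha>] coeff_pCons reg_const split: nat.split)
next
  case (coord v)
  then show ?case using \<alpha> by (simp add: mult_action_def)
next
  case (add f g)
  then obtain P N Q M where
    "\<forall>x\<in>X. \<forall>t. poly (P x) t = f (\<alpha> t x)" "\<forall>d. zext (\<lambda>x. coeff (P x) d) \<in> reg" "\<forall>x\<in>X. degree (P x) \<le> N"
    "\<forall>x\<in>X. \<forall>t. poly (Q x) t = g (\<alpha> t x)" "\<forall>d. zext (\<lambda>x. coeff (Q x) d) \<in> reg" "\<forall>x\<in>X. degree (Q x) \<le> M"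
    unfolding expands_def by metis
  then show ?case
    unfolding expands_def
    by (intro exI[of _ "\<lambda>x. P x + Q x"] exI[of _ "max N M"])
      (auto simp: zext_add reg_add fun_app max.coboundedI1 max.coboundedI2 intro!: degree_add_le)
next
  case (mult f g)
  then obtain P N Q M where PQ:
    "\<forall>x\<in>X. \<forall>t. poly (P x) t = f (\<alpha> t x)" "\<forall>d. zext (\<lambda>x. coeff (P x) d) \<in> reg" "\<forall>x\<in>X. degree (P x) \<le> N"
    "\<forall>x\<in>X. \<forall>t. poly (Q x) t = g (\<alpha> t x)" "\<forall>d. zext (\<lambda>x. coeff (Q x) d) \<in> reg" "\<forall>x\<in>X. degree (Q x) \<le> M"
    unfolding expands_def by metis
  have zs: "zext (\<lambda>x. \<Sum>i\<in>S. h i x) = (\<Sum>i\<in>S. zext (h i))" for S :: "nat set" and h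
    by (induction S rule: infinite_finite_induct) (auto simp: zext_add, auto simp: zext_def fun_app)
  have "zext (\<lambda>x. coeff (P x * Q x) d) \<in> reg" for d
    unfolding coeff_mult zs zext_mult using PQ by (intro reg_sum reg_mult) auto
  moreover have "degree (P x * Q x) \<le> N + M" if "x \<in> X" for x
    using degree_mult_le[of "P x" "Q x"] PQ that by (meson add_mono order_trans)
  ultimately show ?case
    unfolding expands_def
    by (intro exI[of _ "\<lambda>x. P x * Q x"] exI[of _ "N + M"]) (use PQ in \<open>auto simp: fun_app\<close>)
qed

context
  fixes \<alpha> assumes \<alpha>: "mult_action \<alpha>"
begin

lemma orbit_poly_eqI:
  assumes "\<And>t. poly P t = f (\<alpha> t x)"
  shows "orbit_poly \<alpha> f x = P"
  unfolding orbit_poly_def using assms by (intro the_equality) (auto intro: poly_eqI_all)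

lemma poly_orbit_poly:
  assumes "f \<in> reg" "x \<in> X"
  shows "poly (orbit_poly \<alpha> f x) t = f (\<alpha> t x)"
proof -
  obtain P where "\<forall>x\<in>X. \<forall>t. poly (P x) t = f (\<alpha> t x)"
    using expands_reg[OF \<alpha> assms(1)] unfolding expands_def by blast
  then show ?thesis using orbit_poly_eqI[of "P x" f x] assms(2) by auto
qed

lemma orbit_poly_add:
  "f \<in> reg \<Longrightarrow> g \<in> reg \<Longrightarrow> x \<in> X \<Longrightarrow> orbit_poly \<alpha> (f + g) x = orbit_poly \<alpha> f x + orbit_poly \<alpha> g x"
  by (rule orbit_poly_eqI) (simp add: poly_orbit_poly fun_app)

lemma orbit_poly_mult:
  "f \<in> reg \<Longrightarrow> g \<in> reg \<Longrightarrow> x \<in> X \<Longrightarrow> orbit_poly \<alpha> (f * g) x = orbit_poly \<alpha> f x * orbit_poly \<alpha> g x"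
  by (rule orbit_poly_eqI) (simp add: poly_orbit_poly fun_app)

lemma orbit_poly_smult:
  "f \<in> reg \<Longrightarrow> x \<in> X \<Longrightarrow> orbit_poly \<alpha> ((\<lambda>_. c) * f) x = smult c (orbit_poly \<alpha> f x)"
  by (rule orbit_poly_eqI) (simp add: poly_orbit_poly fun_app)

lemma orbit_poly_act:
  "f \<in> reg \<Longrightarrow> x \<in> X \<Longrightarrow> orbit_poly \<alpha> f (\<alpha> s x) = pcompose (orbit_poly \<alpha> f x) [:0, s:]"
  by (rule orbit_poly_eqI)
    (simp add: poly_orbit_poly poly_pcompose mult_actionD[OF \<alpha>] mult.commute)

lemma component_bounded:
  assumes "f \<in> reg"
  shows "\<exists>N. (\<forall>d>N. component \<alpha> d f = 0) \<and> (\<forall>x\<in>X. degree (orbit_poly \<alpha> f x) \<le> N)"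
proof -
  obtain P N where P: "\<forall>x\<in>X. \<forall>t. poly (P x) t = f (\<alpha> t x)" "\<forall>x\<in>X. degree (P x) \<le> N"
    using expands_reg[OF \<alpha> assms] unfolding expands_def by blast
  then have eq: "orbit_poly \<alpha> f x = P x" if "x \<in> X" for x
    using orbit_poly_eqI[of "P x" f x] that by auto
  have "component \<alpha> d f = 0" if "d > N" for d
  proof -
    have "coeff (P x) d = 0" if "x \<in> X" for x
      by (rule coeff_eq_0) (use P(2) that \<open>d > N\<close> in \<open>auto intro: le_less_trans\<close>)
    then show ?thesis using eq by (auto simp: component_def zext_def fun_app)
  qed
  then show ?thesis using P(2) eq by auto
qed

lemma component_boundedE:
  assumes "f \<in> reg"
  obtains N where "\<And>d. d > N \<Longrightarrow> component \<alpha> d f = 0"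
  using component_bounded[OF assms] by blast

lemma component_reg:
  assumes "f \<in> reg" shows "component \<alpha> d f \<in> reg"
proof -
  obtain P where P: "\<forall>x\<in>X. \<forall>t. poly (P x) t = f (\<alpha> t x)" "\<forall>d. zext (\<lambda>x. coeff (P x) d) \<in> reg"
    using expands_reg[OF \<alpha> assms] unfolding expands_def by blast
  then have "component \<alpha> d f = zext (\<lambda>x. coeff (P x) d)"
    unfolding component_def
    by (intro zext_cong arg_cong2[where f = coeff] orbit_poly_eqI refl) auto
  then show ?thesis using P(2) by simp
qed

lemma component_add:
  "f \<in> reg \<Longrightarrow> g \<in> reg \<Longrightarrow> component \<alpha> d (f + g) = component \<alpha> d f + component \<alpha> d g"
  by (auto simp: component_def orbit_poly_add simp flip: zext_add intro!: zext_cong)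

lemma component_smult:
  "f \<in> reg \<Longrightarrow> component \<alpha> d ((\<lambda>_. c) * f) = (\<lambda>_. c) * component \<alpha> d f"
  by (auto simp: component_def orbit_poly_smult zext_def fun_app)

lemma component_0: "component \<alpha> d 0 = 0"
  using component_add[OF reg_zero reg_zero, of d] by simp

lemma component_sum:
  assumes "\<And>i. i \<in> S \<Longrightarrow> f i \<in> reg"
  shows "component \<alpha> d (sum f S) = (\<Sum>i\<in>S. component \<alpha> d (f i))"
  using assms
  by (induction S rule: infinite_finite_induct) (auto simp: component_0 component_add reg_sum)

lemma sum_app: "(\<Sum>i\<in>S. h i) x = (\<Sum>i\<in>S. h i x)" for h :: "nat \<Rightarrow> ('v \<Rightarrow> 'k) \<Rightarrow> 'k"
  by (induction S rule: infinite_finite_induct) (auto simp: fun_app)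

lemma component_mult:
  "f \<in> reg \<Longrightarrow> g \<in> reg \<Longrightarrow>
    component \<alpha> d (f * g) = (\<Sum>i\<le>d. component \<alpha> i f * component \<alpha> (d - i) g)"
  by (auto simp: component_def orbit_poly_mult coeff_mult zext_def sum_app fun_app fun_eq_iff)

lemma degree_orbit_poly:
  assumes "\<And>d. d > N \<Longrightarrow> component \<alpha> d f = 0" "x \<in> X"
  shows "degree (orbit_poly \<alpha> f x) \<le> N"
proof (rule degree_le, intro allI impI)
  fix d assume "d > N"
  then have "component \<alpha> d f x = 0" by (simp add: assms(1) fun_app)
  then show "coeff (orbit_poly \<alpha> f x) d = 0" using assms(2) by (simp add: component_def)
qed

lemma act_expand:
  assumes "f \<in> reg" "\<And>d. d > N \<Longrightarrow> component \<alpha> d f = 0" "x \<in> X"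
  shows "f (\<alpha> t x) = (\<Sum>d\<le>N. component \<alpha> d f x * t ^ d)"
  using poly_sum_coeff[OF degree_orbit_poly[OF assms(2,3)], where t = t] assms(1,3)
  by (simp add: poly_orbit_poly component_def)

lemma sum_component:
  assumes "f \<in> reg" "\<And>d. d > N \<Longrightarrow> component \<alpha> d f = 0"
  shows "(\<Sum>d\<le>N. component \<alpha> d f) = f"
proof (rule reg_eqI)
  show "(\<Sum>d\<le>N. component \<alpha> d f) \<in> reg" "f \<in> reg"
    by (intro reg_sum component_reg assms(1))+
  fix x assume x: "x \<in> X"
  show "(\<Sum>d\<le>N. component \<alpha> d f) x = f x"
    using act_expand[OF assms x, where t = 1] by (simp only: sum_app mult_actionD(2)[OF \<alpha> x] power_one mult_1_right)
qed

lemma homogeneous_component: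
  assumes "f \<in> reg" shows "homogeneous \<alpha> d (component \<alpha> d f)"
  unfolding homogeneous_def
proof (intro conjI allI ballI)
  show "component \<alpha> d f \<in> reg" by (rule component_reg[OF assms])
  fix s x assume x: "x \<in> X"
  show "component \<alpha> d f (\<alpha> s x) = s ^ d * component \<alpha> d f x"
    using x mult_actionD(1)[OF \<alpha> x, of s]
    by (simp add: component_def orbit_poly_act[OF assms x] coeff_pcompose_linear)
qed

lemma component_homogeneous:
  assumes "homogeneous \<alpha> d f"
  shows "component \<alpha> e f = (if e = d then f else 0)"
proof -
  have f: "f \<in> reg" using assms by (simp add: homogeneous_def)
  have "orbit_poly \<alpha> f x = monom (f x) d" if "x \<in> X" for x
    using assms that by (intro orbit_poly_eqI) (auto simp: homogeneous_def poly_monom)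
  then have "component \<alpha> e f = zext (\<lambda>x. coeff (monom (f x) d) e)"
    by (auto simp: component_def intro!: zext_cong)
  also have "\<dots> = (if e = d then zext f else 0)"
    by (auto simp: zext_def fun_app)
  also have "zext f = f" using zext_eqI[OF f, of f] by simp
  finally show ?thesis .
qed

lemma homogeneous_mult:
  "homogeneous \<alpha> d f \<Longrightarrow> homogeneous \<alpha> e g \<Longrightarrow> homogeneous \<alpha> (d + e) (f * g)"
  by (auto simp: homogeneous_def reg_mult fun_app power_add)

lemma euler_sum:
  assumes "f \<in> reg" "\<And>d. d > N \<Longrightarrow> component \<alpha> d f = 0"
  shows "euler \<alpha> f = (\<Sum>d\<le>N. (\<lambda>_. of_nat d) * component \<alpha> d f)"
proof
  fix x
  show "euler \<alpha> f x = (\<Sum>d\<le>N. (\<lambda>_. of_nat d) * component \<alpha> d f) x"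
  proof (cases "x \<in> X")
    case True
    let ?P = "orbit_poly \<alpha> f x"
    have "?P = (\<Sum>d\<le>N. monom (coeff ?P d) d)"
      by (rule poly_as_sum_of_monoms'[symmetric, OF degree_orbit_poly[OF assms(2) True]])
    moreover have "pderiv (sum g S) = (\<Sum>i\<in>S. pderiv (g i))" for g :: "nat \<Rightarrow> 'k poly" and S
      by (induction S rule: infinite_finite_induct) (auto simp: pderiv_add)
    ultimately have "pderiv ?P = (\<Sum>d\<le>N. pderiv (monom (coeff ?P d) d))"
      by metis
    then have "poly (pderiv ?P) 1 = (\<Sum>d\<le>N. of_nat d * coeff ?P d)"
      by (simp add: poly_sum pderiv_monom poly_monom)
    then show ?thesis using True by (simp add: euler_def sum_app component_def fun_app)
  next
    case False
    then show ?thesis by (simp add: euler_def component_def sum_app times_fun_apply zext_def)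
  qed
qed

lemma euler_reg:
  assumes "f \<in> reg" shows "euler \<alpha> f \<in> reg"
proof -
  obtain N where "\<forall>d>N. component \<alpha> d f = 0" using component_bounded[OF assms] by blast
  then show ?thesis
    using euler_sum[OF assms, of N] assms by (auto intro!: reg_sum reg_smult component_reg)
qed

lemma derivation_euler: "derivation (euler \<alpha>)"
  unfolding derivation_def
proof (intro conjI ballI allI)
  fix f g c assume fg: "f \<in> reg" "g \<in> reg"
  show "euler \<alpha> f \<in> reg" using fg by (rule_tac euler_reg)
  show "euler \<alpha> (f + g) = euler \<alpha> f + euler \<alpha> g"
    using fg by (auto simp: euler_def orbit_poly_add pderiv_add simp flip: zext_add intro!: zext_cong)
  show "euler \<alpha> ((\<lambda>_. c) * f) = (\<lambda>_. c) * euler \<alpha> f"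
    using fg by (auto simp: euler_def orbit_poly_smult pderiv_smult zext_def fun_app)
  show "euler \<alpha> (f * g) = euler \<alpha> f * g + f * euler \<alpha> g"
    using fg
    by (auto simp: euler_def zext_def fun_app fun_eq_iff orbit_poly_mult pderiv_mult poly_orbit_poly
        mult_actionD[OF \<alpha>] algebra_simps reg_def)
qed

lemma component_euler:
  assumes "f \<in> reg"
  shows "component \<alpha> i (euler \<alpha> f) = (\<lambda>_. of_nat i) * component \<alpha> i f"
proof -
  obtain N where N: "\<forall>d>N. component \<alpha> d f = 0" using component_bounded[OF assms] by blast
  have "component \<alpha> i (euler \<alpha> f)
      = (\<Sum>d\<le>N. (\<lambda>_. of_nat d) * component \<alpha> i (component \<alpha> d f))"
    using N assms euler_sum[OF assms, of N]
    by (simp add: component_sum component_smult component_reg reg_smult)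
  also have "\<dots> = (\<Sum>d\<le>N. if d = i then (\<lambda>_. of_nat i) * component \<alpha> i f else 0)"
    by (intro sum.cong refl)
      (simp add: component_homogeneous[OF homogeneous_component[OF assms]])
  also have "\<dots> = (\<lambda>_. of_nat i) * component \<alpha> i f"
    using N by (simp add: not_le)
  finally show ?thesis .
qed

text \<open>Eigenfunctions of the Euler derivation are homogeneous, and the eigenvalue is their degree.\<close>

lemma euler_eigen:
  assumes f: "f \<in> reg" "f \<noteq> 0" and E: "euler \<alpha> f = (\<lambda>_. c) * f"
  shows "\<exists>d. c = of_nat d \<and> homogeneous \<alpha> d f"
proof -
  obtain N where N: "\<And>d. d > N \<Longrightarrow> component \<alpha> d f = 0" using component_boundedE[OF f(1)] by blast
  have c: "c = of_nat i" if ne: "component \<alpha> i f \<noteq> 0" for i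
  proof -
    obtain x where x: "component \<alpha> i f x \<noteq> 0" using ne by (auto simp: fun_eq_iff fun_app)
    have "(\<lambda>_. of_nat i) * component \<alpha> i f = (\<lambda>_. c) * component \<alpha> i f"
      using component_euler[OF f(1), of i] E component_smult[OF f(1), of i c] by metis
    from fun_cong[OF this, of x] have "of_nat i * component \<alpha> i f x = c * component \<alpha> i f x"
      by (simp add: fun_app)
    then show ?thesis using x by simp
  qed
  obtain d where d: "component \<alpha> d f \<noteq> 0"
    using sum_component[OF f(1) N] f(2) by (metis sum.neutral)
  have "component \<alpha> e f = 0" if "e \<noteq> d" for e
    using c[OF d] c[of e] that by auto
  then have "(\<Sum>e\<le>N. component \<alpha> e f) = (\<Sum>e\<le>N. if e = d then component \<alpha> d f else 0)"
    by (intro sum.cong) auto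
  also have "\<dots> = component \<alpha> d f" using N d by (auto simp: not_le)
  finally have "f = component \<alpha> d f" using sum_component[OF f(1) N] by simp
  then show ?thesis using homogeneous_component[OF f(1), of d] c[OF d] by auto
qed

end

subsection \<open>Homogeneous components of a derivation\<close>

text \<open>The part of \<open>D\<close> that raises \<open>\<beta>\<close>-degrees by the integer \<open>k\<close>.\<close>

definition derivation_part where
  "derivation_part \<beta> D k f = (\<Sum>d | component \<beta> d f \<noteq> 0.
     if int d + k < 0 then 0 else component \<beta> (nat (int d + k)) (D (component \<beta> d f)))"

context
  fixes \<beta> D assumes \<beta>: "mult_action \<beta>" and D: "derivation D"
begin

abbreviation int_component :: "int \<Rightarrow> (('v \<Rightarrow> 'k) \<Rightarrow> 'k) \<Rightarrow> (('v \<Rightarrow> 'k) \<Rightarrow> 'k)" where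
  "int_component k f \<equiv> (if k < 0 then 0 else component \<beta> (nat k) f)"

lemma int_component_reg: "f \<in> reg \<Longrightarrow> int_component k f \<in> reg"
  by (auto simp: component_reg[OF \<beta>] reg_zero)

lemma int_component_add: "f \<in> reg \<Longrightarrow> g \<in> reg \<Longrightarrow> int_component k (f + g) = int_component k f + int_component k g"
  by (auto simp: component_add[OF \<beta>])

lemma int_component_mult_homogeneous:
  assumes "homogeneous \<beta> j g" "h \<in> reg"
  shows "int_component (a + int j) (h * g) = int_component a h * g"
proof -
  have g: "g \<in> reg" using assms by (simp add: homogeneous_def)
  have *: "component \<beta> n (h * g) = (if n \<ge> j then component \<beta> (n - j) h * g else 0)" for n
  proof -
    have "component \<beta> n (h * g) = (\<Sum>i\<le>n. component \<beta> i h * (if n - i = j then g else 0))"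
      by (simp add: component_mult[OF \<beta> assms(2) g] component_homogeneous[OF \<beta> assms(1)])
    also have "\<dots> = (\<Sum>i\<le>n. if i = n - j \<and> j \<le> n then component \<beta> (n - j) h * g else 0)"
      by (intro sum.cong) auto
    also have "\<dots> = (if n \<ge> j then component \<beta> (n - j) h * g else 0)"
      by (auto intro: sum.delta)
    finally show ?thesis .
  qed
  show ?thesis
  proof (cases "a < 0")
    case True
    have "int_component (a + int j) (h * g) = 0" using True *[of "nat (a + int j)"] by (auto simp: nat_less_iff not_less)
    then show ?thesis using True by simp
  next
    case False
    then have "nat (a + int j) = nat a + j" by (simp add: nat_add_distrib)
    then show ?thesis using False *[of "nat a + j"] by simp
  qed
qed

lemma derivation_part_eq:
  assumes "\<And>d. d > N \<Longrightarrow> component \<beta> d f = 0"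
  shows "derivation_part \<beta> D k f = (\<Sum>d\<le>N. int_component (int d + k) (D (component \<beta> d f)))"
  unfolding derivation_part_def
proof (rule sum.mono_neutral_left)
  show "{d. component \<beta> d f \<noteq> 0} \<subseteq> {..N}" using assms not_le by blast
qed (auto simp: derivation_0[OF D] component_0[OF \<beta>])

lemma derivation_part_homogeneous:
  assumes "homogeneous \<beta> d f"
  shows "derivation_part \<beta> D k f = int_component (int d + k) (D f)"
proof -
  have "derivation_part \<beta> D k f = (\<Sum>e\<le>d. int_component (int e + k) (D (component \<beta> e f)))"
    by (rule derivation_part_eq) (simp add: component_homogeneous[OF \<beta> assms])
  also have "\<dots> = (\<Sum>e\<le>d. if e = d then int_component (int d + k) (D f) else 0)"
    by (intro sum.cong refl)
      (simp add: component_homogeneous[OF \<beta> assms] derivation_0[OF D] component_0[OF \<beta>])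
  also have "\<dots> = int_component (int d + k) (D f)" by (subst sum.delta) auto
  finally show ?thesis .
qed

lemma derivation_part_reg:
  "f \<in> reg \<Longrightarrow> derivation_part \<beta> D k f \<in> reg"
  unfolding derivation_part_def
  by (intro reg_sum int_component_reg derivationD(1)[OF D] component_reg[OF \<beta>])

lemma derivation_part_add:
  assumes "f \<in> reg" "g \<in> reg"
  shows "derivation_part \<beta> D k (f + g) = derivation_part \<beta> D k f + derivation_part \<beta> D k g"
proof -
  obtain M N where MN: "\<And>d. d > M \<Longrightarrow> component \<beta> d f = 0" "\<And>d. d > N \<Longrightarrow> component \<beta> d g = 0"
    using component_bounded[OF \<beta> assms(1)] component_bounded[OF \<beta> assms(2)] by metis
  let ?L = "max M N"
  have c: "component \<beta> d f \<in> reg" "component \<beta> d g \<in> reg" for d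
    using assms by (auto intro: component_reg[OF \<beta>])
  have "derivation_part \<beta> D k (f + g) = (\<Sum>d\<le>?L. int_component (int d + k) (D (component \<beta> d (f + g))))"
    by (rule derivation_part_eq) (simp add: component_add[OF \<beta> assms] MN)
  also have "\<dots> = (\<Sum>d\<le>?L. int_component (int d + k) (D (component \<beta> d f)) + int_component (int d + k) (D (component \<beta> d g)))"
    by (intro sum.cong refl)
      (simp add: component_add[OF \<beta>] assms c derivationD[OF D])
  also have "\<dots> = derivation_part \<beta> D k f + derivation_part \<beta> D k g"
    unfolding sum.distrib by (subst (1 2) derivation_part_eq[of ?L]) (use MN in auto)
  finally show ?thesis .
qed

lemma derivation_part_0: "derivation_part \<beta> D k 0 = 0"
  unfolding derivation_part_def by (rule sum.neutral) (use component_0[OF \<beta>] in blast)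

lemma derivation_part_sum:
  assumes "\<And>i. i \<in> S \<Longrightarrow> f i \<in> reg"
  shows "derivation_part \<beta> D k (sum f S) = (\<Sum>i\<in>S. derivation_part \<beta> D k (f i))"
  using assms
proof (induction S rule: infinite_finite_induct)
  case (insert i S)
  then have "derivation_part \<beta> D k (f i + sum f S) = derivation_part \<beta> D k (f i) + derivation_part \<beta> D k (sum f S)"
    by (intro derivation_part_add reg_sum) auto
  then show ?case using insert by simp
qed (simp_all only: sum.empty sum.infinite derivation_part_0 not_False_eq_True)

lemma derivation_part_smult:
  assumes "f \<in> reg"
  shows "derivation_part \<beta> D k ((\<lambda>_. c) * f) = (\<lambda>_. c) * derivation_part \<beta> D k f"
proof -
  obtain N where N: "\<And>d. d > N \<Longrightarrow> component \<beta> d f = 0"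
    using component_boundedE[OF \<beta> assms(1)] by blast
  have c: "component \<beta> d f \<in> reg" for d
    using assms by (auto intro: component_reg[OF \<beta>])
  have "derivation_part \<beta> D k ((\<lambda>_. c) * f) = (\<Sum>d\<le>N. int_component (int d + k) (D (component \<beta> d ((\<lambda>_. c) * f))))"
    by (rule derivation_part_eq) (simp add: component_smult[OF \<beta> assms] N)
  also have "\<dots> = (\<Sum>d\<le>N. (\<lambda>_. c) * int_component (int d + k) (D (component \<beta> d f)))"
    by (intro sum.cong refl)
      (simp add: component_smult[OF \<beta>] assms c derivationD[OF D])
  also have "\<dots> = (\<lambda>_. c) * derivation_part \<beta> D k f"
    by (simp only: derivation_part_eq[OF N] sum_distrib_left)
  finally show ?thesis .
qed

lemma derivation_derivation_part: "derivation (derivation_part \<beta> D k)"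
  unfolding derivation_def
proof (intro conjI ballI allI)
  let ?D = "derivation_part \<beta> D k"
  fix f g c assume f: "f \<in> reg" and g: "g \<in> reg"
  show "?D f \<in> reg" "?D (f + g) = ?D f + ?D g" "?D ((\<lambda>_. c) * f) = (\<lambda>_. c) * ?D f"
    using f g by (auto intro: derivation_part_reg derivation_part_add derivation_part_smult)
  obtain M N where MN: "\<And>d. d > M \<Longrightarrow> component \<beta> d f = 0" "\<And>d. d > N \<Longrightarrow> component \<beta> d g = 0"
    using component_bounded[OF \<beta> f] component_bounded[OF \<beta> g] by metis
  define a where "a i = component \<beta> i f" for i
  define b where "b j = component \<beta> j g" for j
  have f_eq: "f = (\<Sum>i\<le>M. a i)" and g_eq: "g = (\<Sum>j\<le>N. b j)"
    unfolding a_def b_def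
    using sum_component[OF \<beta> f MN(1)] sum_component[OF \<beta> g MN(2)] by simp_all
  have ha: "homogeneous \<beta> i (a i)" and hb: "homogeneous \<beta> i (b i)" for i
    unfolding a_def b_def using f g by (auto intro: homogeneous_component[OF \<beta>])
  have ra: "a i \<in> reg" and rb: "b i \<in> reg" for i
    using ha hb by (auto simp: homogeneous_def)
  have ab: "?D (a i * b j) = ?D (a i) * b j + a i * ?D (b j)" for i j
  proof -
    have Da: "D (a i) \<in> reg" and Db: "D (b j) \<in> reg"
      by (auto intro: derivationD(1)[OF D] ra rb)
    have "?D (a i * b j) = int_component (int (i + j) + k) (D (a i) * b j + a i * D (b j))"
      by (subst derivation_part_homogeneous[OF homogeneous_mult[OF \<beta> ha hb]])
        (simp only: derivationD(4)[OF D ra rb])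
    also have "\<dots> = int_component ((int i + k) + int j) (D (a i) * b j) + int_component ((int j + k) + int i) (D (b j) * a i)"
      by (subst int_component_add) (auto intro: reg_mult Da Db ra rb simp: algebra_simps)
    also have "\<dots> = ?D (a i) * b j + ?D (b j) * a i"
      by (simp only: int_component_mult_homogeneous[OF hb Da] int_component_mult_homogeneous[OF ha Db]
          derivation_part_homogeneous[OF ha] derivation_part_homogeneous[OF hb])
    finally show ?thesis by (simp add: mult.commute)
  qed
  have "?D (f * g) = (\<Sum>i\<le>M. \<Sum>j\<le>N. ?D (a i * b j))"
    by (simp add: f_eq g_eq sum_product derivation_part_sum reg_sum reg_mult ra rb)
  also have "\<dots> = ?D f * g + f * ?D g"
    by (simp add: ab f_eq g_eq derivation_part_sum ra rb sum_product sum.distrib)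
  finally show "?D (f * g) = ?D f * g + f * ?D g" .
qed

text \<open>A derivation is determined by its values on the finitely many coordinates.\<close>

lemma finite_derivation_parts: "finite {k. \<exists>f\<in>reg. derivation_part \<beta> D k f \<noteq> 0}"
proof -
  have fin: "finite {k. derivation_part \<beta> D k f \<noteq> 0}" if f: "f \<in> reg" for f
  proof -
    obtain N where N: "\<And>d. d > N \<Longrightarrow> component \<beta> d f = 0"
      using component_boundedE[OF \<beta> f] by blast
    have "\<exists>M. \<forall>e>M. component \<beta> e (D (component \<beta> d f)) = 0" for d
      using component_bounded[OF \<beta> derivationD(1)[OF D component_reg[OF \<beta> f]]] by blast
    then obtain M where M: "\<And>d e. e > M d \<Longrightarrow> component \<beta> e (D (component \<beta> d f)) = 0" by metis
    have "derivation_part \<beta> D k f = 0" if "k \<notin> (\<Union>d\<le>N. {- int d..int (M d) - int d})" for k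
    proof -
      have "int_component (int d + k) (D (component \<beta> d f)) = 0" if "d \<le> N" for d
      proof -
        have "k \<notin> {- int d..int (M d) - int d}" using that \<open>k \<notin> _\<close> by blast
        then have "k < - int d \<or> k > int (M d) - int d" by auto
        then show ?thesis using M[of d "nat (int d + k)"] by auto
      qed
      then show ?thesis using derivation_part_eq[OF N] by simp
    qed
    then have "{k. derivation_part \<beta> D k f \<noteq> 0} \<subseteq> (\<Union>d\<le>N. {- int d..int (M d) - int d})" by blast
    then show ?thesis by (rule finite_subset) auto
  qed
  have "{k. \<exists>f\<in>reg. derivation_part \<beta> D k f \<noteq> 0} \<subseteq> (\<Union>v\<in>V. {k. derivation_part \<beta> D k (coord v) \<noteq> 0})"
    using derivation_eq_zero[OF derivation_derivation_part] by blast
  then show ?thesis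
    by (rule finite_subset) (auto intro: finite_V fin reg_coord)
qed

lemma nilpotent_if_homogeneous:
  assumes D': "derivation D'" and "\<And>d f. homogeneous \<beta> d f \<Longrightarrow> \<exists>n. (D' ^^ n) f = 0" "f \<in> reg"
  shows "\<exists>n. (D' ^^ n) f = 0"
proof -
  obtain N where N: "\<And>d. d > N \<Longrightarrow> component \<beta> d f = 0"
    using component_boundedE[OF \<beta> assms(3)] by blast
  have "\<forall>d. \<exists>n. (D' ^^ n) (component \<beta> d f) = 0"
    using assms(2) homogeneous_component[OF \<beta> assms(3)] by blast
  then obtain n where n: "\<And>d. (D' ^^ n d) (component \<beta> d f) = 0" by metis
  let ?n = "\<Sum>d\<le>N. n d"
  have "(D' ^^ ?n) (component \<beta> d f) = 0" if "d \<le> N" for d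
    by (rule derivation_funpow_mono[OF D' n]) (use that in \<open>auto intro: member_le_sum\<close>)
  moreover have "(D' ^^ ?n) f = (\<Sum>d\<le>N. (D' ^^ ?n) (component \<beta> d f))"
    by (subst derivation_funpow_sum[OF D', symmetric])
      (auto simp: sum_component[OF \<beta> assms(3) N] intro: component_reg[OF \<beta>] assms(3))
  ultimately show ?thesis by (metis (no_types, lifting) sum.neutral atMost_iff)
qed

end

text \<open>The extreme components of \<open>euler \<alpha>\<close> are locally nilpotent: a negative one because degrees are
  bounded below by zero, and a positive one because the iterates of \<open>euler \<alpha>\<close> on a function stay in the
  span of its finitely many \<open>\<alpha>\<close>-components, whose \<open>\<beta>\<close>-degrees are bounded. Rigidity kills both.\<close>

lemma rigid_euler_homogeneous:
  assumes rig: "rigid V X" and \<alpha>: "mult_action \<alpha>" and \<beta>: "mult_action \<beta>"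
    and f: "homogeneous \<beta> d f"
  shows "homogeneous \<beta> d (euler \<alpha> f)"
proof -
  let ?E = "euler \<alpha>"
  define P where "P = derivation_part \<beta> ?E"
  note E = derivation_euler[OF \<alpha>]
  have PD: "derivation (P k)" for k unfolding P_def by (rule derivation_derivation_part[OF \<beta> E])
  have Ph: "P k g = (if int e + k < 0 then 0 else component \<beta> (nat (int e + k)) (?E g))"
    if "homogeneous \<beta> e g" for k e g
    unfolding P_def by (rule derivation_part_homogeneous[OF \<beta> E that])
  let ?K = "{k. \<exists>f\<in>reg. P k f \<noteq> 0}"
  have finK: "finite ?K" unfolding P_def by (rule finite_derivation_parts[OF \<beta> E])
  have top: "k \<le> 0" if "k \<in> ?K" for k
  proof (rule ccontr)
    assume "\<not> k \<le> 0"
    define b where "b = nat (Max ?K)"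
    have "Max ?K \<ge> k" using finK that by simp
    then have b: "int b = Max ?K" "b > 0" using \<open>\<not> k \<le> 0\<close> by (auto simp: b_def)
    have above: "P j g = 0" if "g \<in> reg" "j > int b" for j g
      using Max_ge[OF finK, of j] that b(1) by (smt (verit) mem_Collect_eq)
    \<comment> \<open>the iterates of the top part are the top components of the iterates of \<open>?E\<close>\<close>
    have "\<exists>n. (P (int b) ^^ n) g = 0" if g: "homogeneous \<beta> e g" for e g
    proof -
      have rg: "g \<in> reg" using g by (simp add: homogeneous_def)
      have it: "(P (int b) ^^ n) g = component \<beta> (e + n * b) ((?E ^^ n) g) \<and>
          (\<forall>j > e + n * b. component \<beta> j ((?E ^^ n) g) = 0)" for n
      proof (induction n)
        case 0
        then show ?case by (simp add: component_homogeneous[OF \<beta> g])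
      next
        case (Suc n)
        define h where "h = (?E ^^ n) g"
        let ?N = "e + n * b"
        have rh: "h \<in> reg" unfolding h_def by (intro derivation_funpow E rg)
        have hN: "component \<beta> j h = 0" if "j > ?N" for j using Suc.IH that by (simp add: h_def)
        have hh: "homogeneous \<beta> j (component \<beta> j h)" for j by (rule homogeneous_component[OF \<beta> rh])
        have "?E h = (\<Sum>j\<le>?N. ?E (component \<beta> j h))"
          by (subst derivation_sum[OF E, symmetric])
            (auto simp: sum_component[OF \<beta> rh hN] intro: component_reg[OF \<beta>] rh)
        then have ci: "component \<beta> i (?E h) = (\<Sum>j\<le>?N. component \<beta> i (?E (component \<beta> j h)))" for i
          by (simp add: component_sum[OF \<beta>] derivationD(1)[OF E] component_reg[OF \<beta>] rh)
        have ce: "component \<beta> i (?E (component \<beta> j h)) = P (int i - int j) (component \<beta> j h)" for i j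
          by (simp add: Ph[OF hh])
        have "component \<beta> i (?E h) = 0" if "i > ?N + b" for i
          unfolding ci ce using that
          by (intro sum.neutral ballI above component_reg[OF \<beta>] rh) auto
        moreover have "component \<beta> (?N + b) (?E h) = P (int b) (component \<beta> ?N h)"
        proof -
          have "component \<beta> (?N + b) (?E h)
              = (\<Sum>j\<le>?N. if j = ?N then P (int b) (component \<beta> ?N h) else 0)"
            unfolding ci ce
          proof (rule sum.cong[OF refl])
            fix j assume "j \<in> {..?N}"
            then have "j = ?N \<or> int j < int ?N" by (metis atMost_iff le_neq_implies_less of_nat_less_iff)
            moreover have "int (?N + b) = int ?N + int b" by (rule of_nat_add)
            ultimately have "j = ?N \<or> int (?N + b) - int j > int b" by linarith
            then show "P (int (?N + b) - int j) (component \<beta> j h)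
                = (if j = ?N then P (int b) (component \<beta> ?N h) else 0)"
              using above[OF component_reg[OF \<beta> rh], of "int (?N + b) - int j" j] by auto
          qed
          then show ?thesis by simp
        qed
        moreover have "P (int b) ((P (int b) ^^ n) g) = P (int b) (component \<beta> ?N h)"
          using Suc.IH by (simp add: h_def)
        ultimately show ?case by (simp add: h_def algebra_simps)
      qed
      \<comment> \<open>the iterates of \<open>?E\<close> on \<open>g\<close> have bounded \<open>\<beta>\<close>-degree\<close>
      obtain M where M: "\<And>j. j > M \<Longrightarrow> component \<alpha> j g = 0" using component_boundedE[OF \<alpha> rg] by blast
      have "\<exists>L. \<forall>i>L. component \<beta> i (component \<alpha> j g) = 0" for j
        using component_bounded[OF \<beta> component_reg[OF \<alpha> rg]] by blast
      then obtain L where L: "\<And>j i. i > L j \<Longrightarrow> component \<beta> i (component \<alpha> j g) = 0" by metis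
      have rc: "(\<lambda>_. of_nat j ^ n) * component \<alpha> j g \<in> reg" for j n
        by (intro reg_smult component_reg[OF \<alpha>] rg)
      have En: "(?E ^^ n) g = (\<Sum>j\<le>M. (\<lambda>_. of_nat j ^ n) * component \<alpha> j g)" for n
      proof (induction n)
        case 0
        have "(\<lambda>_. 1) * h = h" for h :: "('v \<Rightarrow> 'k) \<Rightarrow> 'k" by (simp add: fun_eq_iff fun_app)
        then show ?case using sum_component[OF \<alpha> rg M] by simp
      next
        case (Suc n)
        have Ec: "?E (component \<alpha> j g) = (\<lambda>_. of_nat j) * component \<alpha> j g" for j
        proof -
          have "?E (component \<alpha> j g)
              = (\<Sum>d\<le>j. (\<lambda>_. of_nat d) * component \<alpha> d (component \<alpha> j g))"
            by (rule euler_sum[OF \<alpha> component_reg[OF \<alpha> rg]])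
              (simp add: component_homogeneous[OF \<alpha> homogeneous_component[OF \<alpha> rg]])
          also have "\<dots> = (\<Sum>d\<le>j. if d = j then (\<lambda>_. of_nat j) * component \<alpha> j g else 0)"
            by (intro sum.cong refl)
              (simp add: component_homogeneous[OF \<alpha> homogeneous_component[OF \<alpha> rg]])
          finally show ?thesis by simp
        qed
        have "(?E ^^ Suc n) g = ?E (\<Sum>j\<le>M. (\<lambda>_. of_nat j ^ n) * component \<alpha> j g)" using Suc.IH by simp
        also have "\<dots> = (\<Sum>j\<le>M. (\<lambda>_. of_nat j ^ n) * ((\<lambda>_. of_nat j) * component \<alpha> j g))"
          by (simp add: derivation_sum[OF E rc] derivationD(2)[OF E component_reg[OF \<alpha> rg]] Ec)
        also have "\<dots> = (\<Sum>j\<le>M. (\<lambda>_. of_nat j ^ Suc n) * component \<alpha> j g)"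
          by (intro sum.cong refl) (simp add: fun_eq_iff fun_app)
        finally show ?case .
      qed
      define n where "n = Suc (\<Sum>j\<le>M. L j)"
      have "component \<beta> (e + n * b) (component \<alpha> j g) = 0" if "j \<le> M" for j
      proof (rule L)
        have "L j \<le> (\<Sum>j\<le>M. L j)" by (rule member_le_sum) (use that in auto)
        also have "\<dots> < n" by (simp add: n_def)
        also have "n \<le> n * b" using b(2) by simp
        finally show "L j < e + n * b" by simp
      qed
      then have "component \<beta> (e + n * b) ((?E ^^ n) g) = 0"
        unfolding En by (simp add: component_sum[OF \<beta> rc] component_smult[OF \<beta> component_reg[OF \<alpha> rg]])
      then show ?thesis using it[of n] by auto
    qed
    then have "P (int b) g = 0" if "g \<in> reg" for g
      using rigid_locally_nilpotent[OF rig PD nilpotent_if_homogeneous[OF \<beta> E PD]] that by metis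
    moreover have "int b \<in> ?K" using Max_in[OF finK] that b(1) by auto
    ultimately show False by auto
  qed
  have bottom: "k \<ge> 0" if "k \<in> ?K" for k
  proof (rule ccontr)
    assume "\<not> k \<ge> 0"
    have "\<exists>n. (P k ^^ n) g = 0" if g: "homogeneous \<beta> e g" for e g
      using g
    proof (induction e arbitrary: g rule: less_induct)
      case (less e)
      have rg: "g \<in> reg" using less.prems by (simp add: homogeneous_def)
      show ?case
      proof (cases "int e + k < 0")
        case True
        then have "(P k ^^ 1) g = 0" by (simp add: Ph[OF less.prems])
        then show ?thesis by blast
      next
        case False
        then have "homogeneous \<beta> (nat (int e + k)) (P k g)"
          by (simp add: Ph[OF less.prems] homogeneous_component[OF \<beta> derivationD(1)[OF E rg]])
        moreover have "nat (int e + k) < e" using False \<open>\<not> k \<ge> 0\<close> by auto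
        ultimately obtain n where "(P k ^^ n) (P k g) = 0" using less.IH by blast
        then have "(P k ^^ Suc n) g = 0" by (simp add: funpow_swap1)
        then show ?thesis by blast
      qed
    qed
    then have "P k g = 0" if "g \<in> reg" for g
      using rigid_locally_nilpotent[OF rig PD nilpotent_if_homogeneous[OF \<beta> E PD]] that by metis
    then show False using that by auto
  qed
  have rf: "f \<in> reg" using f by (simp add: homogeneous_def)
  have zero: "component \<beta> i (?E f) = 0" if "i \<noteq> d" for i
  proof -
    have "component \<beta> i (?E f) = P (int i - int d) f" by (simp add: Ph[OF f])
    moreover have "int i - int d \<notin> ?K"
    proof
      assume "int i - int d \<in> ?K"
      from top[OF this] bottom[OF this] show False using that by linarith
    qed
    ultimately show ?thesis using rf by auto
  qed
  have "?E f = (\<Sum>i\<le>d. component \<beta> i (?E f))"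
    by (rule sum_component[OF \<beta> derivationD(1)[OF E rf], symmetric]) (use zero in auto)
  also have "\<dots> = (\<Sum>i\<le>d. if i = d then component \<beta> d (?E f) else 0)"
    by (intro sum.cong) (auto simp: zero)
  finally have "?E f = component \<beta> d (?E f)" by simp
  then show ?thesis using homogeneous_component[OF \<beta> derivationD(1)[OF E rf], of d] by simp
qed

end

section \<open>Hypersurfaces with separated variables\<close>

subsection \<open>Roots\<close>

text \<open>A multiple root \<open>a\<close> of \<open>z\<^sup>n - c\<close> would be a root of the derivative \<open>n z\<^bsup>n-1\<^esup>\<close>, so that \<open>a = 0\<close> and \<open>c = 0\<close>.\<close>

lemma card_nth_roots:
  fixes c :: "'k::{alg_closed_field, field_char_0}"
  assumes "c \<noteq> 0" "n > 0"
  shows "card {z. z ^ n = c} = n"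
proof -
  define p where "p = monom (1::'k) n - [:c:]"
  have deg: "degree p = n"
  proof -
    have "degree p = degree (monom (1::'k) n)"
      unfolding p_def diff_conv_add_uminus
      by (rule degree_add_eq_left) (use assms in \<open>auto simp: degree_monom_eq\<close>)
    then show ?thesis by (simp add: degree_monom_eq)
  qed
  then have p0: "p \<noteq> 0" using assms(2) by auto
  obtain A c' where A: "size A = n" "p = smult c' (\<Prod>x\<in>#A. [:-x, 1:])" and c': "c' \<noteq> 0"
    using alg_closed_imp_factorization[OF p0] deg p0 by (metis leading_coeff_0_iff)
  have roots: "{z. z ^ n = c} = {z. poly p z = 0}"
    by (auto simp: p_def poly_monom)
  have "poly (\<Prod>x\<in>#B. [:-x, 1:]) z = (\<Prod>x\<in>#B. z - x)" for B and z :: 'k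
    by (induction B) (auto simp: algebra_simps)
  then have "poly p z = c' * (\<Prod>x\<in>#A. z - x)" for z
    by (simp add: A(2))
  moreover have "(\<Prod>x\<in>#B. z - x) = 0 \<longleftrightarrow> z \<in># B" for B and z :: 'k
    by (induction B) auto
  ultimately have set: "{z. poly p z = 0} = set_mset A" using c' by simp
  have "count A a = 1" if a: "a \<in># A" for a
  proof (rule ccontr)
    assume "count A a \<noteq> 1"
    obtain B where B: "A = add_mset a B" using multi_member_split[OF a] by blast
    have "count A a = Suc (count B a)" by (simp only: B count_add_mset refl if_True)
    with \<open>count A a \<noteq> 1\<close> have "count B a \<noteq> 0" by simp
    then have "a \<in># B" by (simp only: count_eq_zero_iff not_not)
    from multi_member_split[OF this] obtain C where C: "B = add_mset a C" by blast
    define P where "P = (\<Prod>x\<in>#C. [:-x, 1:])"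
    have "(\<Prod>x\<in>#A. [:-x, 1:]) = [:-a, 1:] * ([:-a, 1:] * P)"
      unfolding B C P_def by simp
    then have "p = [:-a, 1:] ^ 2 * smult c' P"
      using A(2) by (simp only: power2_eq_square mult_smult_right mult.assoc)
    then obtain r where r: "p = [:-a, 1:] ^ 2 * r" by blast
    have "poly (pderiv (L ^ 2 * r)) a = 0" if "poly L a = 0" for L
      using that by (simp add: pderiv_mult power2_eq_square)
    from this[of "[:-a, 1:]"] have "poly (pderiv p) a = 0" unfolding r by simp
    moreover have "poly (pderiv p) a = of_nat n * a ^ (n - 1)"
      by (simp add: p_def pderiv_diff pderiv_monom poly_monom pderiv_pCons)
    ultimately have "a = 0" using assms(2) by simp
    moreover have "a ^ n = c" using a set roots by auto
    ultimately show False using assms by (auto simp: power_0_left)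
  qed
  then have "size A = card (set_mset A)"
    by (simp add: size_multiset_overloaded_eq)
  then show ?thesis using A(1) roots set by simp
qed

lemma two_nth_roots:
  fixes c :: "'k::{alg_closed_field, field_char_0}"
  assumes "c \<noteq> 0" "n > 1"
  shows "\<exists>y z. y ^ n = c \<and> z ^ n = c \<and> y \<noteq> z"
proof -
  have "card {z. z ^ n = c} \<noteq> 0" "card {z. z ^ n = c} \<noteq> 1" using card_nth_roots[OF assms(1), of n] assms(2) by auto
  then obtain y where y: "y ^ n = c" by (metis (mono_tags, lifting) Collect_empty_eq card.empty)
  have "{z. z ^ n = c} \<noteq> {y}" using \<open>card {z. z ^ n = c} \<noteq> 1\<close> by auto
  then obtain z where "z ^ n = c" "z \<noteq> y" using y by auto
  then show ?thesis using y by metis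
qed

lemma power_sum_telescope:
  fixes y a s :: "'k::comm_ring_1"
  shows "(y + s * a) ^ e - y ^ e = a * (s * (\<Sum>i<e. y ^ (e - Suc i) * (y + s * a) ^ i))"
  using power_diff_sumr2[of "y + s * a" e y] by (simp add: mult_ac)

lemma two_power_inject: "(2::'k::field_char_0) ^ a = 2 ^ b \<Longrightarrow> a = b"
proof -
  assume "(2::'k) ^ a = 2 ^ b"
  then have "of_nat (2 ^ a) = (of_nat (2 ^ b) :: 'k)" by simp
  then have "(2::nat) ^ a = 2 ^ b" by (simp only: of_nat_eq_iff)
  then show "a = b" by simp
qed

subsection \<open>The hypersurface\<close>

text \<open>The variables are partitioned by \<open>\<gamma>\<close> according to the monomial in which they occur, and \<open>d v\<close>
  is the exponent of \<open>v\<close> there. The last three assumptions exclude the power of a variable, the sum of two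
  squares, and a single monomial with unequal exponents.\<close>

locale separated =
  fixes V :: "'v set" and \<gamma> :: "'v \<Rightarrow> 'g" and d :: "'v \<Rightarrow> nat"
    and F :: "('v, 'k::{alg_closed_field, field_char_0}) mpoly"
  assumes finite_V': "finite V" and d_pos: "\<And>v. v \<in> V \<Longrightarrow> d v > 0"
    and F_def: "F = (\<Sum>g\<in>\<gamma> ` V. \<Prod>v\<in>{v \<in> V. \<gamma> v = g}. var v ^ d v)"
    and rigid: "rigid V (zero_set V F)"
    and not_point: "V \<noteq> {v}"
    and not_two_lines: "V = {v, w} \<Longrightarrow> \<gamma> v \<noteq> \<gamma> w \<Longrightarrow> d v \<noteq> 2 \<or> d w \<noteq> 2"
    and one_monomial: "(\<And>v w. v \<in> V \<Longrightarrow> w \<in> V \<Longrightarrow> \<gamma> v = \<gamma> w) \<Longrightarrow> v \<in> V \<Longrightarrow> w \<in> V \<Longrightarrow> d v = d w"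
begin

abbreviation C :: "'g \<Rightarrow> 'v set" where "C g \<equiv> {v \<in> V. \<gamma> v = g}"

lemma F_poly': "F \<in> poly_ring V"
  unfolding F_def by (intro poly_ring_sum poly_ring_prod poly_ring_power poly_ring_var) auto

sublocale hypersurface V F
  by unfold_locales (auto simp: finite_V' F_poly')

definition shared :: "'v \<Rightarrow> bool" where
  "shared v \<longleftrightarrow> v \<in> V \<and> (\<exists>w\<in>V. w \<noteq> v \<and> \<gamma> w = \<gamma> v)"

definition lone :: "'v \<Rightarrow> bool" where
  "lone v \<longleftrightarrow> v \<in> V \<and> (\<forall>w\<in>V. \<gamma> w = \<gamma> v \<longrightarrow> w = v)"

lemma shared_or_lone: "v \<in> V \<Longrightarrow> shared v \<or> lone v"
  by (auto simp: shared_def lone_def)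

lemma not_shared_lone: "shared v \<Longrightarrow> \<not> lone v"
  by (auto simp: shared_def lone_def)

lemma shared_V: "shared v \<Longrightarrow> v \<in> V" and lone_V: "lone v \<Longrightarrow> v \<in> V"
  by (auto simp: shared_def lone_def)

lemma lone_C: "lone v \<Longrightarrow> C (\<gamma> v) = {v}"
  by (auto simp: lone_def)

lemma finite_C: "finite (C g)" and finite_groups: "finite (\<gamma> ` V)"
  using finite_V by auto

definition mon :: "'g \<Rightarrow> ('v \<Rightarrow> 'k) \<Rightarrow> 'k" where
  "mon g x = (\<Prod>v\<in>C g. x v ^ d v)"

lemma eval_at_F: "eval_at x F = (\<Sum>g\<in>\<gamma> ` V. mon g x)"
  by (simp add: F_def eval_at_simps mon_def)

lemma mon_cong: "(\<And>v. v \<in> V \<Longrightarrow> \<gamma> v = g \<Longrightarrow> x v = y v) \<Longrightarrow> mon g x = mon g y"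
  unfolding mon_def by (intro prod.cong) auto

lemma eval_restrict: "p \<in> poly_ring V \<Longrightarrow> eval_at (restrict x V) p = eval_at x p"
  by (rule eval_at_cong) auto

lemma restrict_in_X: "restrict x V \<in> X \<longleftrightarrow> (\<Sum>g\<in>\<gamma> ` V. mon g x) = 0"
  using eval_restrict[OF F_poly] by (auto simp: zero_set_def affine_space_def eval_at_F)

lemma in_X: "x \<in> X \<Longrightarrow> (\<Sum>g\<in>\<gamma> ` V. mon g x) = 0"
  by (simp add: zero_set_def eval_at_F)

lemma restrict_X: "x \<in> X \<Longrightarrow> restrict x V = x"
  by (auto simp: zero_set_def affine_space_def)

definition others :: "'v \<Rightarrow> ('v \<Rightarrow> 'k) \<Rightarrow> 'k" where
  "others v x = (\<Sum>g\<in>\<gamma> ` V - {\<gamma> v}. mon g x)"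

definition cofactor :: "'v \<Rightarrow> ('v \<Rightarrow> 'k) \<Rightarrow> 'k" where
  "cofactor v x = (\<Prod>w\<in>C (\<gamma> v) - {v}. x w ^ d w)"

lemma mon_cofactor: "v \<in> V \<Longrightarrow> mon (\<gamma> v) x = x v ^ d v * cofactor v x"
  unfolding mon_def cofactor_def by (rule prod.remove) (auto simp: finite_V)

lemma sum_mon_split:
  "v \<in> V \<Longrightarrow> (\<Sum>g\<in>\<gamma> ` V. mon g x) = x v ^ d v * cofactor v x + others v x"
  unfolding others_def mon_cofactor[symmetric] by (rule sum.remove) (auto simp: finite_V)

lemma others_cong: "(\<And>w. w \<in> V \<Longrightarrow> \<gamma> w \<noteq> \<gamma> v \<Longrightarrow> x w = y w) \<Longrightarrow> others v x = others v y"
  unfolding others_def by (intro sum.cong mon_cong) auto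

lemma cofactor_cong: "(\<And>w. w \<in> V \<Longrightarrow> w \<noteq> v \<Longrightarrow> x w = y w) \<Longrightarrow> cofactor v x = cofactor v y"
  unfolding cofactor_def by (intro prod.cong) auto

lemma cofactor_lone: "lone v \<Longrightarrow> cofactor v x = 1"
  by (auto simp: cofactor_def lone_def intro!: prod.neutral)

lemma mon_zero:
  assumes "g \<in> \<gamma> ` V" "\<And>v. v \<in> V \<Longrightarrow> \<gamma> v = g \<Longrightarrow> x v = 0"
  shows "mon g x = 0"
proof -
  obtain v where v: "v \<in> V" "\<gamma> v = g" using assms(1) by auto
  then show ?thesis
    using finite_V assms(2)[OF v] d_pos[OF v(1)] by (auto simp: mon_def prod_zero_iff intro!: bexI[of _ v])
qed

lemma mon_one: "(\<And>v. v \<in> V \<Longrightarrow> \<gamma> v = g \<Longrightarrow> x v = 1) \<Longrightarrow> mon g x = 1"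
  unfolding mon_def by (intro prod.neutral) auto

lemma origin_in_X: "(\<lambda>v\<in>V. 0) \<in> X"
  unfolding restrict_in_X by (intro sum.neutral ballI mon_zero) auto

text \<open>On the axis of \<open>v\<close>, the monomial of \<open>v\<close> vanishes because of its other variables.\<close>

lemma axis_in_X:
  assumes "shared v"
  shows "(\<lambda>w\<in>V. if w = v then t else 0) \<in> X"
proof -
  obtain w where w: "w \<in> V" "w \<noteq> v" "\<gamma> w = \<gamma> v" using assms by (auto simp: shared_def)
  have "mon g (\<lambda>w. if w = v then t else 0) = 0" if "g \<in> \<gamma> ` V" for g
  proof (cases "g = \<gamma> v")
    case True
    then show ?thesis
      using w finite_V d_pos[OF w(1)] by (auto simp: mon_def prod_zero_iff intro!: bexI[of _ w])
  next
    case False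
    then show ?thesis by (intro mon_zero that) auto
  qed
  then show ?thesis unfolding restrict_in_X by simp
qed

lemma lone_other_group:
  assumes "lone v" obtains u where "u \<in> V" "\<gamma> u \<noteq> \<gamma> v"
proof -
  obtain u where "u \<in> V" "u \<noteq> v" using not_point[of v] lone_V[OF assms] by auto
  then show ?thesis using that assms by (auto simp: lone_def)
qed

subsection \<open>Consequences of rigidity for the exponents\<close>

text \<open>If \<open>F = x\<^sub>v + R\<close>, then \<open>X\<close> is the graph of \<open>-R\<close>, hence an affine space, which has translations.\<close>

lemma lone_exponent_ge_2:
  assumes v: "lone v" shows "d v \<ge> 2"
proof (rule ccontr)
  assume "\<not> d v \<ge> 2"
  with d_pos[OF lone_V[OF v]] have dv: "d v = 1" by simp
  obtain u where u: "u \<in> V" "\<gamma> u \<noteq> \<gamma> v" using lone_other_group[OF v] .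
  have uv: "u \<noteq> v" using u by auto
  define \<Phi> where "\<Phi> s x = (\<lambda>w\<in>V. if w = u then x u + s else if w = v then - others v (x(u := x u + s)) else x w)"
    for s and x :: "'v \<Rightarrow> 'k"
  have iff: "restrict x V \<in> X \<longleftrightarrow> x v = - others v x" for x
    using restrict_in_X[of x] sum_mon_split[OF lone_V[OF v], of x] cofactor_lone[OF v, of x] dv
    by (auto simp: eq_neg_iff_add_eq_0)
  have oth: "others v (\<Phi> s x) = others v (x(u := x u + s))" for s x
    by (rule others_cong) (auto simp: \<Phi>_def)
  have vV: "v \<in> V" by (rule lone_V[OF v])
  have "\<Phi> 1 (\<lambda>w\<in>V. 0) = (\<lambda>w\<in>V. 0)"
  proof (rule rigidD[OF rigid])
    fix x s assume x: "x \<in> X"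
    have xv: "x v = - others v x" using iff[of x] restrict_X[OF x] x by simp
    have "restrict (\<Phi> s x) V \<in> X"
      unfolding iff using uv vV by (simp add: oth) (simp add: \<Phi>_def)
    then show "\<Phi> s x \<in> X" by (simp add: \<Phi>_def)
    have "x(u := x u + 0) = x" by auto
    then show "\<Phi> 0 x = x"
      using restrict_X[OF x] xv by (auto simp: \<Phi>_def fun_eq_iff restrict_def split: if_splits)
  next
    fix x s t assume x: "x \<in> X"
    have "others v ((\<Phi> t x)(u := \<Phi> t x u + s)) = others v (x(u := x u + (s + t)))"
      by (rule others_cong) (use u in \<open>auto simp: \<Phi>_def\<close>)
    then show "\<Phi> s (\<Phi> t x) = \<Phi> (s + t) x"
      using u uv by (auto simp: \<Phi>_def fun_eq_iff restrict_def)
  next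
    fix w assume w: "w \<in> V"
    let ?V' = "insert None (Some ` V)"
    let ?y = "\<lambda>y w. if w = u then y (Some u) + y None else y (Some w)"
    have "poly_fun ?V' (\<lambda>y. ?y y z)" if "z \<in> V" for z
      using that u(1) by (cases "z = u") (auto intro!: poly_fun_add poly_fun_var)
    then have "poly_fun ?V' (\<lambda>y. others v (?y y))"
      unfolding others_def mon_def by (intro poly_fun_sum poly_fun_prod poly_fun_power) auto
    then have "poly_fun ?V' (\<lambda>y. 0 - others v (?y y))"
      by (intro poly_fun_diff poly_fun_const)
    moreover define h where "h = (if w = u then (\<lambda>y. y (Some u) + y None)
      else if w = v then (\<lambda>y. 0 - others v (?y y)) else (\<lambda>y. y (Some w)))"
    ultimately have "poly_fun ?V' h"
      using w u(1) by (auto simp: h_def intro!: poly_fun_add poly_fun_var)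
    moreover have "\<Phi> s x w = h (case_option s x)" for s x
      using w by (simp add: \<Phi>_def h_def fun_upd_def cong: if_cong)
    ultimately show "\<exists>h. poly_fun ?V' h \<and> (\<forall>s. \<forall>x\<in>X. \<Phi> s x w = h (case_option s x))"
      by blast
  qed (rule origin_in_X)
  from fun_cong[OF this, of u] show False using u(1) by (simp add: \<Phi>_def)
qed

text \<open>If \<open>F = x\<^sub>v\<^sup>2 + x\<^sub>w\<^sup>2 + R = a b + R\<close> with \<open>a, b = x\<^sub>v \<plusminus> \<i> x\<^sub>w\<close>, then \<open>a\<close> can be kept fixed, a variable \<open>u\<close> of
  \<open>R\<close> moved by multiples of \<open>a\<close>, and \<open>b\<close> adjusted, since the increment of \<open>R\<close> is divisible by \<open>a\<close>.\<close>

lemma unique_lone_square: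
  assumes v: "lone v" and w: "lone w" and "d v = 2" "d w = 2"
  shows "v = w"
proof (rule ccontr)
  assume vw: "v \<noteq> w"
  have vV: "v \<in> V" and wV: "w \<in> V" using v w by (auto simp: lone_V)
  have gvw: "\<gamma> v \<noteq> \<gamma> w" using v w vw by (auto simp: lone_def)
  obtain u where u: "u \<in> V" "u \<noteq> v" "u \<noteq> w"
    using not_two_lines[of v w] gvw assms vV wV by auto
  have gu: "\<gamma> u \<noteq> \<gamma> v" "\<gamma> u \<noteq> \<gamma> w" using u v w by (auto simp: lone_def)
  obtain i :: 'k where i: "i ^ 2 = -1" using nth_root_exists[of 2 "-1 :: 'k"] by auto
  then have ii: "i * i = -1" and i0: "i \<noteq> 0" by (auto simp: power2_eq_square)
  define rest where "rest x = (\<Sum>g\<in>\<gamma> ` V - {\<gamma> v} - {\<gamma> w} - {\<gamma> u}. mon g x)" for x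
  let ?e = "d u"
  define a where "a x = x v + i * x w" for x :: "'v \<Rightarrow> 'k"
  define Q where "Q s x = cofactor u x * (s * (\<Sum>j<?e. x u ^ (?e - Suc j) * (x u + s * a x) ^ j))" for s x
  define \<Phi> where "\<Phi> s x = (\<lambda>z\<in>V. if z = u then x u + s * a x else if z = v then x v - Q s x / 2
      else if z = w then x w + Q s x / (2 * i) else x z)" for s x
  have split: "(\<Sum>g\<in>\<gamma> ` V. mon g x) = (x v ^ 2 + x w ^ 2) + x u ^ ?e * cofactor u x + rest x" for x
  proof -
    have "(\<Sum>g\<in>\<gamma> ` V. mon g x) = mon (\<gamma> v) x + (mon (\<gamma> w) x + (mon (\<gamma> u) x + rest x))"
      unfolding rest_def using vV wV u gu gvw finite_V
      by (subst sum.remove[of _ "\<gamma> v"], auto, subst sum.remove[of _ "\<gamma> w"], auto,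
          subst sum.remove[of _ "\<gamma> u"], auto)
    then show ?thesis
      using assms vV wV u(1) by (simp add: mon_cofactor cofactor_lone)
  qed
  have ab: "x v ^ 2 + x w ^ 2 = a x * (x v - i * x w)" for x
  proof -
    have "a x * (x v - i * x w) = x v ^ 2 - (i * i) * x w ^ 2"
      by (simp add: a_def algebra_simps power2_eq_square)
    then show ?thesis by (simp add: ii)
  qed
  have restPhi: "rest (\<Phi> s x) = rest x" for s x
    unfolding rest_def by (intro sum.cong mon_cong) (auto simp: \<Phi>_def)
  have cofPhi: "cofactor u (\<Phi> s x) = cofactor u x" for s x
  proof -
    have "\<Phi> s x z = x z" if "z \<in> C (\<gamma> u) - {u}" for z using that gu by (auto simp: \<Phi>_def)
    then show ?thesis unfolding cofactor_def by (intro prod.cong) simp_all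
  qed
  have i2: "i * (Q s x / (2 * i)) = Q s x / 2" for s x using i0 by simp
  have aPhi: "a (\<Phi> s x) = a x" for s x
    using u vw vV wV by (simp add: a_def \<Phi>_def algebra_simps i2 i0)
  have bPhi: "\<Phi> s x v - i * \<Phi> s x w = (x v - i * x w) - Q s x" for s x
    using u vw vV wV by (simp add: \<Phi>_def algebra_simps i2 i0)
  have uPhi: "\<Phi> s x u = x u + s * a x" for s x using u by (simp add: \<Phi>_def)
  have aQ: "a x * Q s x = cofactor u x * ((x u + s * a x) ^ ?e - x u ^ ?e)" for s x
    unfolding Q_def power_sum_telescope by (simp add: mult_ac)
  have Qadd: "Q s (\<Phi> t x) + Q t x = Q (s + t) x" for s t x
  proof (cases "a x = 0")
    case True
    have "x u ^ (?e - Suc j) * x u ^ j = x u ^ (?e - 1)" if "j < ?e" for j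
      using that by (simp flip: power_add)
    then have "(\<Sum>j<?e. x u ^ (?e - Suc j) * x u ^ j) = of_nat ?e * x u ^ (?e - 1)" by simp
    then show ?thesis using True by (simp add: Q_def cofPhi uPhi aPhi algebra_simps)
  next
    case False
    have "a x * (Q s (\<Phi> t x) + Q t x) = a x * Q (s + t) x"
    proof -
      have "x u + t * a x + s * a x = x u + (s + t) * a x" by (simp add: algebra_simps)
      then have "a x * Q s (\<Phi> t x) = cofactor u x * ((x u + (s + t) * a x) ^ ?e - (x u + t * a x) ^ ?e)"
        using aQ[of "\<Phi> t x" s] by (simp only: aPhi cofPhi uPhi)
      then show ?thesis
        unfolding distrib_left aQ by (simp add: right_diff_distrib)
    qed
    then show ?thesis using False by simp
  qed
  define p where "p = (\<lambda>z\<in>V. if z = v then 1 else if z = w then - i else 0)"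
  have p: "p \<in> X"
    unfolding p_def restrict_in_X split
  proof -
    let ?p = "\<lambda>z. if z = v then 1 else if z = w then - i else 0"
    have "rest ?p = 0" unfolding rest_def
      by (intro sum.neutral ballI mon_zero) (use gvw in auto)
    then show "((?p v)\<^sup>2 + (?p w)\<^sup>2) + ?p u ^ ?e * cofactor u ?p + rest ?p = 0"
      using vw u d_pos[OF u(1)] i by (simp add: power_0_left)
  qed
  \<comment> \<open>at \<open>p\<close> the form \<open>a\<close> does not vanish, so that \<open>\<Phi>\<close> moves the coordinate \<open>u\<close> of \<open>p\<close>\<close>
  have "\<Phi> 1 p = p"
  proof (rule rigidD[OF rigid])
    fix x s assume x: "x \<in> X"
    have "(\<Sum>g\<in>\<gamma> ` V. mon g (\<Phi> s x)) = a x * ((x v - i * x w) - Q s x) + (x u + s * a x) ^ ?e * cofactor u x + rest x"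
      unfolding split ab restPhi cofPhi aPhi bPhi uPhi ..
    also have "\<dots> = a x * (x v - i * x w) + x u ^ ?e * cofactor u x + rest x"
      using aQ[of x s] by (simp add: algebra_simps)
    also have "\<dots> = 0" using in_X[OF x] unfolding split ab .
    finally have "restrict (\<Phi> s x) V \<in> X" by (simp only: restrict_in_X)
    then show "\<Phi> s x \<in> X" by (simp add: \<Phi>_def)
    have "Q 0 x = 0" by (simp add: Q_def)
    then have "\<Phi> 0 x = restrict x V" by (auto simp: \<Phi>_def fun_eq_iff)
    then show "\<Phi> 0 x = x" by (simp add: restrict_X[OF x])
  next
    fix x s t assume x: "x \<in> X"
    show "\<Phi> s (\<Phi> t x) = \<Phi> (s + t) x"
    proof
      fix z
      have "\<Phi> s (\<Phi> t x) z = (if z \<in> V then if z = u then x u + t * a x + s * a x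
        else if z = v then x v - Q t x / 2 - Q s (\<Phi> t x) / 2
        else if z = w then x w + Q t x / (2 * i) + Q s (\<Phi> t x) / (2 * i) else x z else undefined)"
        using u vw vV wV aPhi[of t x]
        by (subst \<Phi>_def) (auto simp: \<Phi>_def[of t])
      also have "\<dots> = \<Phi> (s + t) x z"
        using Qadd[of s t x] by (auto simp: \<Phi>_def algebra_simps simp flip: Qadd add_divide_distrib diff_divide_distrib)
      finally show "\<Phi> s (\<Phi> t x) z = \<Phi> (s + t) x z" .
    qed
  next
    fix z assume z: "z \<in> V"
    let ?V' = "insert None (Some ` V)"
    have pv: "poly_fun ?V' (\<lambda>y. y (Some z))" if "z \<in> V" for z
      by (rule poly_fun_var) (use that in auto)
    have pn: "poly_fun ?V' (\<lambda>y. y None)" by (rule poly_fun_var) auto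
    have pa: "poly_fun ?V' (\<lambda>y. a (\<lambda>z. y (Some z)))"
      unfolding a_def by (intro poly_fun_add poly_fun_mult poly_fun_const pv vV wV)
    have pc: "poly_fun ?V' (\<lambda>y. cofactor u (\<lambda>z. y (Some z)))"
      unfolding cofactor_def by (intro poly_fun_prod poly_fun_power pv) auto
    have pQ: "poly_fun ?V' (\<lambda>y. Q (y None) (\<lambda>z. y (Some z)))"
      unfolding Q_def
      by (intro poly_fun_mult poly_fun_sum poly_fun_power poly_fun_add pa pc pn pv u)
    have pm: "poly_fun ?V' (\<lambda>y. f y / c)" if "poly_fun ?V' f" for f and c :: 'k
      using poly_fun_mult[OF that poly_fun_const[of _ "inverse c"]] by (simp add: divide_inverse)
    define h where "h = (if z = u then (\<lambda>y. y (Some u) + y None * a (\<lambda>z. y (Some z)))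
       else if z = v then (\<lambda>y. y (Some v) - Q (y None) (\<lambda>z. y (Some z)) / 2)
       else if z = w then (\<lambda>y. y (Some w) + Q (y None) (\<lambda>z. y (Some z)) / (2 * i))
       else (\<lambda>y. y (Some z)))"
    have "poly_fun ?V' h"
      unfolding h_def using z
      by (auto intro!: poly_fun_add poly_fun_diff poly_fun_mult[OF pn pa] pm pQ pv u vV wV)
    moreover have "\<Phi> s x z = h (case_option s x)" for s x
      using z by (auto simp: \<Phi>_def h_def)
    ultimately show "\<exists>h. poly_fun ?V' h \<and> (\<forall>s. \<forall>x\<in>X. \<Phi> s x z = h (case_option s x))"
      by blast
  qed (rule p)
  from fun_cong[OF this, of u] have "a p = 0" using u by (simp add: \<Phi>_def)
  moreover have "a p = 2" using vV wV vw ii by (simp add: a_def p_def)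
  ultimately show False by simp
qed

subsection \<open>The torus\<close>

text \<open>One-parameter subgroups of the torus of \<open>X\<close> with positive weights: those for which \<open>F\<close> is
  homogeneous.\<close>

definition weight :: "('v \<Rightarrow> nat) \<Rightarrow> bool" where
  "weight \<mu> \<longleftrightarrow> (\<forall>v\<in>V. \<mu> v > 0) \<and>
     (\<forall>g\<in>\<gamma> ` V. \<forall>h\<in>\<gamma> ` V. (\<Sum>v\<in>C g. d v * \<mu> v) = (\<Sum>v\<in>C h. d v * \<mu> v))"

definition act :: "('v \<Rightarrow> nat) \<Rightarrow> 'k \<Rightarrow> ('v \<Rightarrow> 'k) \<Rightarrow> ('v \<Rightarrow> 'k)" where
  "act \<mu> t x = (\<lambda>v\<in>V. t ^ \<mu> v * x v)"

lemma eval_act: "p \<in> poly_ring V \<Longrightarrow> eval_at (act \<mu> t x) p = (\<Sum>e\<in>keys p. lookup p e * monom_at x e * t ^ wt \<mu> e)"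
  unfolding act_def by (simp only: eval_restrict eval_at_scale)

lemma mon_act: "mon g (act \<mu> t x) = t ^ (\<Sum>v\<in>C g. d v * \<mu> v) * mon g x"
proof -
  have "mon g (act \<mu> t x) = (\<Prod>v\<in>C g. (t ^ \<mu> v * x v) ^ d v)"
    unfolding mon_def act_def by (intro prod.cong) auto
  also have "\<dots> = (\<Prod>v\<in>C g. t ^ (d v * \<mu> v)) * mon g x"
    by (simp add: mon_def power_mult_distrib prod.distrib mult.commute flip: power_mult)
  finally show ?thesis by (simp add: power_sum)
qed

lemma weight_pos: "weight \<mu> \<Longrightarrow> v \<in> V \<Longrightarrow> \<mu> v > 0"
  unfolding weight_def by blast

lemma weight_balanced:
  "weight \<mu> \<Longrightarrow> v \<in> V \<Longrightarrow> w \<in> V \<Longrightarrow> (\<Sum>u\<in>C (\<gamma> v). d u * \<mu> u) = (\<Sum>u\<in>C (\<gamma> w). d u * \<mu> u)"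
  unfolding weight_def by blast

lemma act_mem:
  assumes "weight \<mu>" "x \<in> X" shows "act \<mu> t x \<in> X"
proof -
  have "(\<Sum>g\<in>\<gamma> ` V. mon g (act \<mu> t x)) = 0"
  proof (cases "V = {}")
    case False
    then obtain v where v: "v \<in> V" by auto
    have "(\<Sum>g\<in>\<gamma> ` V. mon g (act \<mu> t x)) = (\<Sum>g\<in>\<gamma> ` V. t ^ (\<Sum>u\<in>C (\<gamma> v). d u * \<mu> u) * mon g x)"
      unfolding mon_act using weight_balanced[OF assms(1) v] by (intro sum.cong refl) auto
    also have "\<dots> = 0" using in_X[OF assms(2)] by (simp flip: sum_distrib_left)
    finally show ?thesis .
  qed simp
  then show ?thesis
    using restrict_in_X[of "act \<mu> t x"] by (simp add: act_def)
qed

lemma mult_action_act: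
  assumes "weight \<mu>" shows "mult_action (act \<mu>)"
  unfolding mult_action_def
proof (intro conjI allI ballI)
  fix t x assume x: "x \<in> X"
  then show "act \<mu> t x \<in> X" by (rule act_mem[OF assms])
next
  fix x assume "x \<in> X"
  then show "act \<mu> 1 x = x" using restrict_X by (simp add: act_def restrict_def)
next
  fix s t x
  show "act \<mu> s (act \<mu> t x) = act \<mu> (s * t) x"
    by (auto simp: act_def power_mult_distrib)
next
  fix v assume v: "v \<in> V"
  have "zext (\<lambda>x. coeff (monom (x v) (\<mu> v)) e) = (if e = \<mu> v then coord v else 0)" for e
    by (auto simp: zext_def fun_app)
  moreover have "coord v (act \<mu> t x) = t ^ \<mu> v * x v" if "x \<in> X" for t x
    using act_mem[OF assms that, of t] v by simp (simp add: act_def)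
  ultimately show "expands (act \<mu>) (coord v)"
    unfolding expands_def using v
    by (intro exI[of _ "\<lambda>x. monom (x v) (\<mu> v)"] exI[of _ "\<mu> v"])
      (auto simp: poly_monom reg_coord reg_zero degree_monom_le mult.commute)
qed

lemma act_zero: "weight \<mu> \<Longrightarrow> act \<mu> 0 x = (\<lambda>v\<in>V. 0)"
  by (auto simp: act_def weight_pos)

lemma homogeneous_coord:
  assumes "weight \<mu>" "v \<in> V" shows "homogeneous (act \<mu>) (\<mu> v) (coord v)"
  using assms act_mem[OF assms(1)] by (auto simp: homogeneous_def reg_coord act_def)

text \<open>Only the monomials of the right weight matter for the restriction of a homogeneous function.\<close>

lemma homogeneous_filter_keys:
  assumes \<mu>: "weight \<mu>" and f: "homogeneous (act \<mu>) n f"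
    and p: "p \<in> poly_ring V" "\<And>x. x \<in> X \<Longrightarrow> f x = eval_at x p" and x: "x \<in> X"
  shows "f x = eval_at x (filter_keys (\<lambda>e. wt \<mu> e = n) p)"
proof -
  define Q where "Q = (\<Sum>e\<in>keys p. monom (lookup p e * monom_at x e) (wt \<mu> e))"
  have "poly Q t = poly (monom (f x) n) t" for t
  proof -
    have "poly Q t = eval_at (act \<mu> t x) p"
      by (simp add: Q_def poly_sum poly_monom eval_act[OF p(1)])
    also have "\<dots> = t ^ n * f x"
      using f p(2)[OF act_mem[OF \<mu> x]] x by (simp add: homogeneous_def)
    finally show ?thesis by (simp add: poly_monom mult.commute)
  qed
  then have "Q = monom (f x) n" by (rule poly_eqI_all)
  then have "f x = coeff Q n" by simp
  also have "\<dots> = (\<Sum>e\<in>keys p. if wt \<mu> e = n then lookup p e * monom_at x e else 0)"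
    by (simp add: Q_def coeff_sum)
  also have "\<dots> = eval_at x (filter_keys (\<lambda>e. wt \<mu> e = n) p)"
    by (simp only: eval_at_filter_keys sum.inter_filter[OF finite_keys])
  finally show ?thesis .
qed

text \<open>Discarding the monomials of the wrong degree for one weight does not change the restriction to \<open>X\<close>, and
  only finitely many steps of this kind can remove something.\<close>

lemma multihomogeneous_poly:
  assumes f: "f \<in> reg" and h: "\<And>\<mu>. weight \<mu> \<Longrightarrow> homogeneous (act \<mu>) (\<chi> \<mu>) f"
  shows "\<exists>p\<in>poly_ring V. (\<forall>x\<in>X. f x = eval_at x p) \<and> (\<forall>e\<in>keys p. \<forall>\<mu>. weight \<mu> \<longrightarrow> wt \<mu> e = \<chi> \<mu>)"
proof -
  have "\<exists>p'\<in>poly_ring V. (\<forall>x\<in>X. f x = eval_at x p') \<and> (\<forall>e\<in>keys p'. \<forall>\<mu>. weight \<mu> \<longrightarrow> wt \<mu> e = \<chi> \<mu>)"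
    if "p \<in> poly_ring V" "\<forall>x\<in>X. f x = eval_at x p" for p
    using that
  proof (induction "card (keys p)" arbitrary: p rule: less_induct)
    case less
    show ?case
    proof (cases "\<forall>e\<in>keys p. \<forall>\<mu>. weight \<mu> \<longrightarrow> wt \<mu> e = \<chi> \<mu>")
      case False
      then obtain e \<mu> where e: "e \<in> keys p" "weight \<mu>" "wt \<mu> e \<noteq> \<chi> \<mu>" by blast
      let ?p = "filter_keys (\<lambda>e. wt \<mu> e = \<chi> \<mu>) p"
      have "keys ?p \<subset> keys p" using e by (auto simp: keys_filter_keys)
      then have "card (keys ?p) < card (keys p)" by (rule psubset_card_mono[OF finite_keys])
      moreover have "\<forall>x\<in>X. f x = eval_at x ?p"
        using homogeneous_filter_keys[OF e(2) h[OF e(2)] less.prems(1)] less.prems(2) by blast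
      ultimately show ?thesis using less.hyps[of ?p] less.prems(1) by (simp add: filter_keys_poly_ring)
    qed (use less.prems in blast)
  qed
  then show ?thesis using reg_poly[OF f] by blast
qed

text \<open>The weight for which the variables of a monomial contribute equally to its degree: the weight of \<open>v\<close> is
  inversely proportional to \<open>card (C (\<gamma> v)) * d v\<close>, with denominators cleared.\<close>

definition base :: "'v \<Rightarrow> nat" where
  "base v = (\<Prod>u\<in>V - {v}. card (C (\<gamma> u)) * d u)"

definition deg :: nat where
  "deg = (\<Prod>u\<in>V. card (C (\<gamma> u)) * d u)"

lemma card_C_pos: "v \<in> V \<Longrightarrow> card (C (\<gamma> v)) > 0"
  using finite_C by (auto simp: card_gt_0_iff)

lemma base_deg: "v \<in> V \<Longrightarrow> card (C (\<gamma> v)) * (d v * base v) = deg"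
  unfolding deg_def base_def by (simp add: prod.remove[OF finite_V] mult_ac)

lemma base_pos: "base v > 0"
  unfolding base_def using card_C_pos d_pos by (intro prod_pos) auto

lemma base_sum: 
  assumes "v \<in> V" shows "(\<Sum>u\<in>C (\<gamma> v). d u * base u) = deg"
proof -
  have "card (C (\<gamma> v)) * (d u * base u) = deg" if "u \<in> C (\<gamma> v)" for u
    using base_deg[of u] that by simp
  then have "(\<Sum>u\<in>C (\<gamma> v). card (C (\<gamma> v)) * (d u * base u)) = (\<Sum>u\<in>C (\<gamma> v). deg)"
    by (intro sum.cong refl)
  then have "card (C (\<gamma> v)) * (\<Sum>u\<in>C (\<gamma> v). d u * base u) = card (C (\<gamma> v)) * deg"
    by (simp add: sum_distrib_left)
  then show ?thesis using card_C_pos[OF assms] by simp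
qed

lemma base_lone: "lone v \<Longrightarrow> d v * base v = deg"
  using base_sum[OF lone_V, of v] by (simp add: lone_C)

lemma weight_base: "weight base"
  unfolding weight_def using base_pos base_sum by auto

lemma wt_V: "keys e \<subseteq> V \<Longrightarrow> wt w e = (\<Sum>v\<in>V. lookup e v * w v)"
  by (rule wt_superset[OF finite_V])

text \<open>The factor of \<open>e\<close> complementary to \<open>v\<^sup>n\<close> has weight zero, and weights are positive.\<close>

lemma wt_base_full:
  assumes e: "keys e \<subseteq> V" and v: "v \<in> V" and w: "wt base e = n * base v" and ge: "lookup e v \<ge> n"
  shows "e = single v n"
proof -
  have s: "(\<Sum>u\<in>V - {v}. lookup e u * base u) + lookup e v * base v = n * base v"
    using w wt_V[OF e] by (simp add: sum.remove[OF finite_V v] add.commute)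
  have "lookup e v * base v \<ge> n * base v" using ge by simp
  then have z: "(\<Sum>u\<in>V - {v}. lookup e u * base u) = 0" and "lookup e v * base v = n * base v"
    using s by linarith+
  then have ev: "lookup e v = n" using base_pos[of v] by simp
  have "lookup e u = 0" if "u \<in> V" "u \<noteq> v" for u
    using z that finite_V base_pos[of u] by (auto simp: sum_eq_0_iff)
  then show ?thesis
    using e ev by (intro poly_mapping_eqI) (metis in_keys_iff lookup_single_eq lookup_single_not_eq subsetD)
qed

text \<open>Weights can be shifted between two variables of the same monomial, so that a variable sharing
  its monomial spans an extremal ray of the cone of degrees.\<close>

lemma shared_extremal:
  assumes v: "shared v" and e: "keys e \<subseteq> V" and eq: "\<And>\<mu>. weight \<mu> \<Longrightarrow> wt \<mu> e = n * \<mu> v"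
  shows "e = single v n"
proof -
  have vV: "v \<in> V" by (rule shared_V[OF v])
  obtain w where w: "w \<in> V" "w \<noteq> v" "\<gamma> w = \<gamma> v" using v by (auto simp: shared_def)
  \<comment> \<open>moving weight from \<open>w\<close> to \<open>v\<close> in the ratio \<open>d v : d w\<close> keeps their monomial balanced; the multiple of \<open>base\<close> keeps the weight positive\<close>
  define \<mu> where "\<mu> u = (d v + 1) * base u + (if u = v then d w else 0) - (if u = w then d v else 0)" for u
  have ge: "(if u = w then d v else 0) < (d v + 1) * base u" for u
  proof -
    have "d v < (d v + 1) * 1" by simp
    also have "\<dots> \<le> (d v + 1) * base u" using base_pos[of u] by (intro mult_left_mono) auto
    finally have "d v < (d v + 1) * base u" .
    then show ?thesis by (metis gr_zeroI less_zeroE)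
  qed
  have \<mu>: "\<mu> u + (if u = w then d v else 0) = (d v + 1) * base u + (if u = v then d w else 0)" for u
    unfolding \<mu>_def using ge[of u] by simp
  have sum\<mu>: "(\<Sum>u\<in>S. a u * \<mu> u) + (if w \<in> S then a w * d v else 0)
      = (d v + 1) * (\<Sum>u\<in>S. a u * base u) + (if v \<in> S then a v * d w else 0)" if "finite S" for S a
  proof -
    have delta: "(\<Sum>u\<in>S. a u * (if u = z then c else 0)) = (if z \<in> S then a z * c else 0)" for z c
    proof -
      have "(\<Sum>u\<in>S. a u * (if u = z then c else 0)) = (\<Sum>u\<in>S. if u = z then a z * c else 0)"
        by (intro sum.cong) auto
      also have "\<dots> = (if z \<in> S then a z * c else 0)" by (rule sum.delta[OF that])
      finally show ?thesis .
    qed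
    have "(\<Sum>u\<in>S. a u * \<mu> u) + (if w \<in> S then a w * d v else 0)
        = (\<Sum>u\<in>S. a u * (\<mu> u + (if u = w then d v else 0)))"
      by (simp only: distrib_left sum.distrib delta)
    also have "\<dots> = (\<Sum>u\<in>S. a u * ((d v + 1) * base u)) + (if v \<in> S then a v * d w else 0)"
      by (simp only: \<mu> distrib_left[of "a _"] sum.distrib delta)
    also have "(\<Sum>u\<in>S. a u * ((d v + 1) * base u)) = (d v + 1) * (\<Sum>u\<in>S. a u * base u)"
      unfolding sum_distrib_left by (intro sum.cong refl mult.left_commute)
    finally show ?thesis .
  qed
  have W: "weight \<mu>"
    unfolding weight_def
  proof (intro conjI ballI)
    fix u show "\<mu> u > 0" unfolding \<mu>_def using ge[of u] by simp
  next
    have "(\<Sum>u\<in>C g. d u * \<mu> u) = (d v + 1) * deg" if g: "g \<in> \<gamma> ` V" for g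
    proof -
      have "w \<in> C g \<longleftrightarrow> v \<in> C g" using vV w by simp
      then have "(\<Sum>u\<in>C g. d u * \<mu> u) + (if v \<in> C g then d w * d v else 0)
          = (d v + 1) * (\<Sum>u\<in>C g. d u * base u) + (if v \<in> C g then d w * d v else 0)"
        using sum\<mu>[OF finite_C, of d g] by (simp only: mult.commute[of "d v" "d w"])
      then have "(\<Sum>u\<in>C g. d u * \<mu> u) = (d v + 1) * (\<Sum>u\<in>C g. d u * base u)"
        by (simp only: add_right_cancel)
      moreover obtain z where "z \<in> V" "g = \<gamma> z" using g by blast
      ultimately show ?thesis by (simp only: base_sum)
    qed
    note eq' = this
    fix g h assume "g \<in> \<gamma> ` V" "h \<in> \<gamma> ` V"
    then show "(\<Sum>u\<in>C g. d u * \<mu> u) = (\<Sum>u\<in>C h. d u * \<mu> u)"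
      by (simp only: eq')
  qed
  have b: "wt base e = n * base v" by (rule eq[OF weight_base])
  have "wt \<mu> e + lookup e w * d v = (d v + 1) * wt base e + lookup e v * d w"
    using sum\<mu>[OF finite_V, of "lookup e"] by (simp only: wt_V[OF e] w(1) vV if_True)
  moreover have "\<mu> v = (d v + 1) * base v + d w"
    using \<mu>[of v] w(2)[symmetric] by (simp only: if_False if_True refl add_0_right)
  then have "wt \<mu> e = n * ((d v + 1) * base v) + n * d w"
    by (simp only: eq[OF W] distrib_left)
  then have "wt \<mu> e = (d v + 1) * (n * base v) + n * d w"
    by (simp only: mult.left_commute[of n])
  ultimately have "n * d w + lookup e w * d v = lookup e v * d w"
    unfolding b by linarith
  then have "n * d w \<le> lookup e v * d w" by linarith
  then have "n \<le> lookup e v" using d_pos[OF w(1)] by simp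
  then show ?thesis by (rule wt_base_full[OF e vV b])
qed

subsection \<open>Polynomials vanishing on the hypersurface\<close>

lemma update_in_X:
  assumes "v \<in> V" "lone v" "y ^ d v = - others v x"
  shows "restrict (x(v := y)) V \<in> X"
proof -
  have "others v (x(v := y)) = others v x" by (rule others_cong) (use assms in auto)
  then show ?thesis
    unfolding restrict_in_X sum_mon_split[OF assms(1)] using assms by (simp add: cofactor_lone)
qed

lemma others_one:
  assumes "lone v" obtains x where "others v x = 1"
proof -
  obtain u where u: "u \<in> V" "\<gamma> u \<noteq> \<gamma> v" using lone_other_group[OF assms] .
  let ?x = "\<lambda>w. if \<gamma> w = \<gamma> u then 1 else 0"
  have "mon g ?x = (if g = \<gamma> u then 1 else 0)" if "g \<in> \<gamma> ` V" for g
  proof (cases "g = \<gamma> u")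
    case True
    then show ?thesis by (simp add: mon_one)
  next
    case False
    then have "mon g ?x = 0" by (intro mon_zero that) auto
    then show ?thesis using False by simp
  qed
  then have "others v ?x = (\<Sum>g\<in>\<gamma> ` V - {\<gamma> v}. if g = \<gamma> u then 1 else 0)"
    unfolding others_def by (intro sum.cong) auto
  also have "\<dots> = 1" using u finite_groups by simp
  finally show ?thesis using that by blast
qed

text \<open>The variables are linearly independent modulo the square of the maximal ideal at the origin. The axis of a
  shared variable lies in \<open>X\<close>, which detects its coefficient. For a lone variable \<open>v\<close>, discard the monomials whose
  weight is not that of \<open>v\<close>; then \<open>v\<close> occurs only linearly, and two points of \<open>X\<close> that differ only in the
  coordinate \<open>v\<close> detect its coefficient. Such points exist because the exponent of \<open>v\<close> is at least two.\<close>

lemma vanishing_linear_part: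
  assumes p: "p \<in> poly_ring V" and z: "\<And>x. x \<in> X \<Longrightarrow> eval_at x p = 0" and v: "v \<in> V"
  shows "lookup p (single v 1) = 0"
proof (cases "shared v")
  case True
  let ?c = "\<lambda>w. if w = v then [:0, 1:] else (0 :: 'k poly)"
  have "poly (mpoly_hom (\<lambda>a. [:a:]) ?c p) t = poly 0 t" for t
  proof -
    have "poly (mpoly_hom (\<lambda>a. [:a:]) ?c p) t = eval_at (\<lambda>w. if w = v then t else 0) p"
      by (simp add: poly_mpoly_hom if_distrib[of "\<lambda>q. poly q t"] cong: if_cong)
    also have "\<dots> = 0" using z[OF axis_in_X[OF True, of t]] by (simp add: eval_restrict[OF p])
    finally show ?thesis by simp
  qed
  then have "mpoly_hom (\<lambda>a. [:a:]) ?c p = 0" by (rule poly_eqI_all)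
  then have "(\<Sum>w\<in>V. lookup p (single w 1) * coeff (?c w) 1) = 0"
    using coeff_1_curve[OF finite_V p, of ?c] by simp
  moreover have "(\<Sum>w\<in>V. lookup p (single w 1) * coeff (?c w) 1) = (\<Sum>w\<in>V. if w = v then lookup p (single v 1) else 0)"
    by (intro sum.cong) auto
  ultimately show ?thesis using v finite_V by simp
next
  case False
  then have lv: "lone v" using shared_or_lone v by blast
  define q where "q = filter_keys (\<lambda>e. wt base e = base v) p"
  have q: "q \<in> poly_ring V" unfolding q_def by (rule filter_keys_poly_ring[OF p])
  have hz: "homogeneous (act base) (base v) (\<lambda>x. 0)"
    using reg_zero by (simp add: homogeneous_def zero_fun_def)
  have qz: "eval_at x q = 0" if "x \<in> X" for x
    unfolding q_def using homogeneous_filter_keys[OF weight_base hz p _ that] z by simp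
  obtain x where x: "others v x = 1" using others_one[OF lv] .
  have "\<exists>y y'. y ^ d v = (-1 :: 'k) \<and> y' ^ d v = -1 \<and> y \<noteq> y'"
    by (rule two_nth_roots) (use lone_exponent_ge_2[OF lv] in auto)
  then obtain y y' :: 'k where y: "y ^ d v = -1" "y' ^ d v = -1" "y \<noteq> y'" by blast
  have e0: "lookup e v = 0" if e: "e \<in> keys q" "e \<noteq> single v 1" for e
  proof (rule ccontr)
    assume "lookup e v \<noteq> 0"
    have "e \<in> keys p" "wt base e = 1 * base v" using e by (auto simp: q_def keys_filter_keys)
    moreover have "keys e \<subseteq> V" using p \<open>e \<in> keys p\<close> by (auto simp: poly_ring_def)
    ultimately show False using wt_base_full[of e v 1] v e \<open>lookup e v \<noteq> 0\<close> by simp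
  qed
  let ?a = "lookup q (single v 1)"
  have "eval_at (x(v := y)) q - eval_at (x(v := y')) q
      = (\<Sum>e\<in>keys q. if e = single v 1 then ?a * (y - y') else 0)"
    unfolding eval_at_monoms sum_subtractf[symmetric]
  proof (rule sum.cong[OF refl])
    fix e assume e: "e \<in> keys q"
    show "lookup q e * monom_at (x(v := y)) e - lookup q e * monom_at (x(v := y')) e
        = (if e = single v 1 then ?a * (y - y') else 0)"
    proof (cases "e = single v 1")
      case True
      then show ?thesis by (simp add: monom_at_single algebra_simps)
    next
      case False
      then have "v \<notin> keys e" using e0[OF e] by (simp add: in_keys_iff)
      then have "monom_at (x(v := y)) e = monom_at (x(v := y')) e"
        unfolding monom_at_def by (intro prod.cong) auto
      then show ?thesis using False by simp
    qed
  qed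
  also have "\<dots> = ?a * (y - y')"
    by (cases "single v 1 \<in> keys q") (simp_all add: in_keys_iff)
  finally have "?a * (y - y') = 0"
    using qz[OF update_in_X[OF v lv]] y x by (simp add: eval_restrict[OF q])
  then have "?a = 0" using y(3) by simp
  then show ?thesis by (simp add: q_def lookup_filter_keys)
qed

lemma coord_nonzero:
  assumes "v \<in> V" shows "coord v \<noteq> 0"
proof
  assume "coord v = 0"
  then have "eval_at x (var v) = 0" if "x \<in> X" for x
    using that by (metis eval_at_var zext_apply zero_fun_apply)
  then have "lookup (var v :: ('v, 'k) mpoly) (single v 1) = 0"
    by (rule vanishing_linear_part[OF poly_ring_var[OF assms] _ assms])
  then show False by (simp add: var_def)
qed

lemma coords_independent:
  assumes "u \<in> V" "v \<in> V" "\<And>x. x \<in> X \<Longrightarrow> x u = c * x v"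
  shows "u = v"
proof (rule ccontr)
  assume "u \<noteq> v"
  have "lookup (var u - const c * var v :: ('v, 'k) mpoly) (single u 1) = 0"
    by (rule vanishing_linear_part) (use assms in \<open>auto simp: eval_at_simps intro!: poly_ring_diff poly_ring_mult\<close>)
  then show False
    using \<open>u \<noteq> v\<close> by (simp add: lookup_minus var_def const_def mult_single lookup_single when_def split: if_splits)
qed

end

lemma var_power: "var v ^ n = (single (single v n) 1 :: ('v, 'k::comm_ring_1) mpoly)"
  by (induction n) (simp_all add: var_def mult_single flip: single_add)

lemma pderiv_sum: "pderiv (sum f A) = (\<Sum>i\<in>A. pderiv (f i))"
  by (induction A rule: infinite_finite_induct) (auto simp: pderiv_add)

lemma lookup_outside:
  assumes "p \<in> poly_ring A" "v \<notin> A" "lookup e v \<noteq> 0"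
  shows "lookup p e = 0"
proof (rule ccontr)
  assume "lookup p e \<noteq> 0"
  then have "e \<in> keys p" by (simp add: in_keys_iff)
  then have "keys e \<subseteq> A" using assms(1) by (auto simp: poly_ring_def)
  then show False using assms(2,3) by (metis in_keys_iff subsetD)
qed

lemma (in hypersurface) homogeneousD: "homogeneous \<alpha> n f \<Longrightarrow> x \<in> X \<Longrightarrow> f (\<alpha> t x) = t ^ n * f x"
  by (simp add: homogeneous_def)

context separated
begin

definition others_poly :: "'v \<Rightarrow> ('v, 'k) mpoly" where
  "others_poly v = (\<Sum>g\<in>\<gamma> ` V - {\<gamma> v}. \<Prod>w\<in>C g. var w ^ d w)"

lemma F_lone: "lone v \<Longrightarrow> F = var v ^ d v + others_poly v"
  unfolding F_def others_poly_def
  by (subst sum.remove[of _ "\<gamma> v"]) (auto simp: finite_V lone_V lone_C)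

lemma others_poly_ring: "others_poly v \<in> poly_ring (V - {v})"
  unfolding others_poly_def
  by (intro poly_ring_sum poly_ring_prod poly_ring_power poly_ring_var) auto

lemma eval_others_poly: "eval_at x (others_poly v) = others v x"
  by (simp add: others_poly_def others_def eval_at_simps mon_def)

lemma poly_ring_mono: "p \<in> poly_ring A \<Longrightarrow> A \<subseteq> B \<Longrightarrow> p \<in> poly_ring B"
  by (auto simp: poly_ring_def)

lemma lookup_others_poly: "lookup e v \<noteq> 0 \<Longrightarrow> lookup (others_poly v) e = 0"
  by (rule lookup_outside[OF others_poly_ring]) auto

lemma graded_mon: "g \<in> \<gamma> ` V \<Longrightarrow> (\<Prod>w\<in>C g. var w ^ d w) \<in> graded V base deg"
proof -
  assume "g \<in> \<gamma> ` V"
  then have "(\<Sum>w\<in>C g. d w * base w) = deg" using base_sum by auto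
  moreover have "(\<Prod>w\<in>C g. var w ^ d w) \<in> graded V base (\<Sum>w\<in>C g. d w * base w)"
    by (intro graded_prod graded_power graded_var) auto
  ultimately show ?thesis by simp
qed

lemma F_graded: "F \<in> graded V base deg"
  unfolding F_def by (intro graded_sum graded_mon)

text \<open>After subtracting a multiple of \<open>F\<close>, a polynomial of the degree of \<open>F\<close> has degree less than \<open>d v\<close>
  in \<open>v\<close>; if it vanishes on \<open>X\<close>, it has \<open>d v\<close> roots for general values of the other variables.\<close>

lemma vanishing_multiple_of_F:
  assumes v: "lone v" and p: "p \<in> graded V base deg" and z: "\<And>x. x \<in> X \<Longrightarrow> eval_at x p = 0"
  shows "\<exists>c. p = const c * F"
proof -
  have vV: "v \<in> V" by (rule lone_V[OF v])
  let ?q = "d v"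
  define c where "c = lookup p (single v ?q)"
  define p' where "p' = p - const c * F"
  have p': "p' \<in> graded V base deg"
    unfolding p'_def by (intro graded_diff p graded_smult F_graded)
  have p'V: "p' \<in> poly_ring V" using gradedD(1)[OF p'] .
  have "lookup (const c * F) (single v ?q) = c * lookup F (single v ?q)"
    using lookup_single_mult[of 0 c F "single v ?q"] by (simp add: const_def)
  also have "lookup F (single v ?q) = 1"
    using d_pos[OF vV] lookup_others_poly[of "single v ?q" v]
    by (simp add: F_lone[OF v] lookup_add var_power)
  finally have top: "lookup p' (single v ?q) = 0"
    by (simp add: p'_def lookup_minus c_def)
  have deg_v: "lookup e v \<le> ?q - 1" if e: "e \<in> keys p'" for e
  proof (rule ccontr)
    assume "\<not> lookup e v \<le> ?q - 1"
    moreover have "wt base e = ?q * base v" using gradedD(2)[OF p' e] base_lone[OF v] by simp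
    moreover have "keys e \<subseteq> V" using p'V e by (auto simp: poly_ring_def)
    ultimately have "e = single v ?q" using wt_base_full[of e v ?q] vV by simp
    then show False using top e by (simp add: in_keys_iff)
  qed
  have "eval_at x p' * eval_at x (others_poly v) = 0" for x
  proof (cases "others v x = 0")
    case False
    define Q where "Q = (\<Sum>e\<in>keys p'. monom (lookup p' e * (\<Prod>w\<in>keys e - {v}. x w ^ lookup e w)) (lookup e v))"
    have Q: "poly Q s = eval_at (x(v := s)) p'" for s
    proof -
      have "monom_at (x(v := s)) e = (\<Prod>w\<in>keys e - {v}. x w ^ lookup e w) * s ^ lookup e v" for e
      proof -
        have "monom_at (x(v := s)) e = (\<Prod>w\<in>insert v (keys e). (x(v := s)) w ^ lookup e w)"
          by (rule monom_at_superset) auto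
        also have "\<dots> = s ^ lookup e v * (\<Prod>w\<in>keys e - {v}. (x(v := s)) w ^ lookup e w)"
          by (subst prod.insert_remove) auto
        also have "(\<Prod>w\<in>keys e - {v}. (x(v := s)) w ^ lookup e w) = (\<Prod>w\<in>keys e - {v}. x w ^ lookup e w)"
          by (intro prod.cong) auto
        finally show ?thesis by (simp only: mult.commute)
      qed
      then show ?thesis by (simp add: Q_def poly_sum poly_monom eval_at_monoms mult.assoc)
    qed
    have "degree Q \<le> ?q - 1"
      unfolding Q_def
    proof (rule degree_sum_le)
      fix e assume "e \<in> keys p'"
      then show "degree (monom (lookup p' e * (\<Prod>w\<in>keys e - {v}. x w ^ lookup e w)) (lookup e v)) \<le> ?q - 1"
        using deg_v degree_monom_le order_trans by blast
    qed simp
    then have degQ: "degree Q < ?q" using d_pos[OF vV] by simp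
    have "Q = 0"
    proof (rule ccontr)
      assume "Q \<noteq> 0"
      have "{s. s ^ ?q = - others v x} \<subseteq> {s. poly Q s = 0}"
      proof clarify
        fix s assume "s ^ ?q = - others v x"
        then have "eval_at (restrict (x(v := s)) V) p' = 0"
          using update_in_X[OF vV v] z eval_F by (simp add: p'_def eval_at_simps)
        then show "poly Q s = 0" by (simp add: Q eval_restrict[OF p'V])
      qed
      then have "card {s. s ^ ?q = - others v x} \<le> card {s. poly Q s = 0}"
        by (rule card_mono[OF poly_roots_finite[OF \<open>Q \<noteq> 0\<close>]])
      also have "\<dots> \<le> degree Q" by (rule card_poly_roots_bound[OF \<open>Q \<noteq> 0\<close>])
      finally show False using degQ card_nth_roots[of "- others v x" ?q] False d_pos[OF vV] by simp
    qed
    then have "eval_at (x(v := x v)) p' = 0" using Q[of "x v"] by simp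
    then show ?thesis by simp
  qed (simp add: eval_others_poly)
  moreover obtain x where "others v x = 1" using others_one[OF v] .
  then have "others_poly v \<noteq> 0" using eval_others_poly[of x v] by (auto simp: eval_at_simps)
  ultimately have "p' = 0"
    using eval_at_mult_eq_zero[OF finite_V p'V poly_ring_mono[OF others_poly_ring]] by blast
  then show ?thesis unfolding p'_def by (intro exI[of _ c]) simp
qed

subsection \<open>Multiplicative actions are diagonal\<close>

context
  fixes \<alpha> assumes \<alpha>: "mult_action \<alpha>"
begin

text \<open>Rigidity enters here: the Euler derivation of \<open>\<alpha>\<close> preserves the gradings of all diagonal actions.\<close>

lemma euler_coord_poly:
  assumes "v \<in> V"
  shows "\<exists>p\<in>poly_ring V. (\<forall>x\<in>X. euler \<alpha> (coord v) x = eval_at x p) \<and> (\<forall>e\<in>keys p. \<forall>\<mu>. weight \<mu> \<longrightarrow> wt \<mu> e = \<mu> v)"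
  by (rule multihomogeneous_poly[OF euler_reg[OF \<alpha> reg_coord[OF assms]]])
    (rule rigid_euler_homogeneous[OF rigid \<alpha> mult_action_act homogeneous_coord[OF _ assms]])

lemma poly_single_eigen:
  assumes "v \<in> V" "\<forall>x\<in>X. euler \<alpha> (coord v) x = eval_at x p" "keys p \<subseteq> {single v 1}"
  shows "\<exists>c. euler \<alpha> (coord v) = (\<lambda>_. c) * coord v"
proof (intro exI reg_eqI)
  let ?c = "lookup p (single v 1)"
  show "euler \<alpha> (coord v) \<in> reg" "(\<lambda>_. ?c) * coord v \<in> reg"
    by (intro euler_reg[OF \<alpha>] reg_smult reg_coord assms(1))+
  fix x assume x: "x \<in> X"
  have "eval_at x p = mpoly_hom (\<lambda>c. c) x p" by (simp add: eval_at_def)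
  also have "\<dots> = (\<Sum>e\<in>{single v 1}. lookup p e * monom_at x e)"
    by (rule mpoly_hom_superset) (use assms(3) in auto)
  finally show "euler \<alpha> (coord v) x = ((\<lambda>_. ?c) * coord v) x"
    using assms(2) x by (simp add: monom_at_single fun_app)
qed

lemma euler_shared:
  assumes "shared v" shows "\<exists>c. euler \<alpha> (coord v) = (\<lambda>_. c) * coord v"
proof -
  have vV: "v \<in> V" by (rule shared_V[OF assms])
  obtain p where p: "p \<in> poly_ring V" "\<forall>x\<in>X. euler \<alpha> (coord v) x = eval_at x p"
    "\<forall>e\<in>keys p. \<forall>\<mu>. weight \<mu> \<longrightarrow> wt \<mu> e = \<mu> v"
    using euler_coord_poly[OF vV] by blast
  have "e = single v 1" if "e \<in> keys p" for e
    by (rule shared_extremal[OF assms]) (use p that in \<open>auto simp: poly_ring_def\<close>)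
  then show ?thesis using poly_single_eigen[OF vV p(2)] by blast
qed

text \<open>Differentiating \<open>F = 0\<close> along the action gives a relation between the partial derivatives of \<open>F\<close>
  modulo \<open>F\<close>. For degree reasons an off-diagonal term of it would need two variables occurring as squares.\<close>

lemma euler_lone:
  assumes u: "lone u" shows "\<exists>c. euler \<alpha> (coord u) = (\<lambda>_. c) * coord u"
proof -
  have uV: "u \<in> V" by (rule lone_V[OF u])
  have "\<forall>w\<in>V. \<exists>p. p \<in> poly_ring V \<and> (\<forall>x\<in>X. euler \<alpha> (coord w) x = eval_at x p) \<and> (\<forall>e\<in>keys p. \<forall>\<mu>. weight \<mu> \<longrightarrow> wt \<mu> e = \<mu> w)"
    using euler_coord_poly by blast
  from bchoice[OF this] obtain P where P: "\<And>w. w \<in> V \<Longrightarrow> P w \<in> poly_ring V"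
    "\<And>w x. w \<in> V \<Longrightarrow> x \<in> X \<Longrightarrow> euler \<alpha> (coord w) x = eval_at x (P w)"
    "\<And>w e \<mu>. w \<in> V \<Longrightarrow> e \<in> keys (P w) \<Longrightarrow> weight \<mu> \<Longrightarrow> wt \<mu> e = \<mu> w"
    by blast
  have "\<forall>v. \<exists>n. shared v \<longrightarrow> homogeneous \<alpha> n (coord v)"
    using euler_eigen[OF \<alpha> reg_coord coord_nonzero] euler_shared shared_V by blast
  then obtain n where n: "\<And>v. shared v \<Longrightarrow> homogeneous \<alpha> (n v) (coord v)" by metis
  define L where "L = {w. lone w}"
  have L: "finite L" "L \<subseteq> V" "u \<in> L" using finite_V u by (auto simp: L_def lone_V intro: finite_subset[of _ V])
  define S where "S = \<gamma> ` V - \<gamma> ` L"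
  have inj: "inj_on \<gamma> L" by (auto simp: inj_on_def L_def lone_def)
  have S_shared: "shared w" if "g \<in> S" "w \<in> C g" for g w
  proof -
    have w: "w \<in> V" "\<gamma> w = g" "g \<notin> \<gamma> ` L" using that by (auto simp: S_def)
    then have "w \<notin> L" by blast
    then show ?thesis using shared_or_lone[OF w(1)] by (simp add: L_def)
  qed
  have split: "(\<Sum>g\<in>\<gamma> ` V. h g) = (\<Sum>g\<in>S. h g) + (\<Sum>w\<in>L. h (\<gamma> w))" for h :: "'g \<Rightarrow> 'c::comm_monoid_add"
  proof -
    have "\<gamma> ` L \<subseteq> \<gamma> ` V" using L by auto
    then have "(\<Sum>g\<in>\<gamma> ` V. h g) = (\<Sum>g\<in>S. h g) + (\<Sum>g\<in>\<gamma> ` L. h g)"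
      unfolding S_def by (rule sum.subset_diff) (rule finite_groups)
    then show ?thesis by (simp add: sum.reindex[OF inj])
  qed
  define N where "N g = (\<Sum>w\<in>C g. d w * n w)" for g
  \<comment> \<open>the derivative of \<open>F\<close> along \<open>\<alpha>\<close>; the monomials of shared variables are already known to be homogeneous for \<open>\<alpha>\<close>\<close>
  define G where "G = (\<Sum>g\<in>S. const (of_nat (N g)) * (\<Prod>w\<in>C g. var w ^ d w))
    + (\<Sum>w\<in>L. single (single w (d w - 1)) (of_nat (d w)) * P w)"
  have tangent: "eval_at x G = 0" if x: "x \<in> X" for x
  proof -
    define T where "T w = orbit_poly \<alpha> (coord w) x" for w
    have T: "poly (T w) t = \<alpha> t x w" if "w \<in> V" for t w
      using poly_orbit_poly[OF \<alpha> reg_coord[OF that] x] mult_actionD(1)[OF \<alpha> x] by (simp add: T_def)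
    have T1: "poly (T w) 1 = x w" if "w \<in> V" for w
      using T[OF that, of 1] mult_actionD(2)[OF \<alpha> x] by simp
    have dT: "poly (pderiv (T w)) 1 = eval_at x (P w)" if "w \<in> V" for w
      using P(2)[OF that x] x by (simp add: euler_def T_def)
    have "poly ((\<Sum>g\<in>S. monom (mon g x) (N g)) + (\<Sum>w\<in>L. T w ^ d w)) t = poly 0 t" for t
    proof -
      have "0 = (\<Sum>g\<in>\<gamma> ` V. mon g (\<alpha> t x))" using in_X[OF mult_actionD(1)[OF \<alpha> x]] by simp
      also have "\<dots> = (\<Sum>g\<in>S. mon g (\<alpha> t x)) + (\<Sum>w\<in>L. mon (\<gamma> w) (\<alpha> t x))" by (rule split)
      also have "(\<Sum>g\<in>S. mon g (\<alpha> t x)) = (\<Sum>g\<in>S. t ^ N g * mon g x)"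
      proof (rule sum.cong[OF refl])
        fix g assume g: "g \<in> S"
        have "\<alpha> t x w = t ^ n w * x w" if "w \<in> C g" for w
          using homogeneousD[OF n[OF S_shared[OF g that]] x, of t] mult_actionD(1)[OF \<alpha> x, of t] x
          by simp
        then have "mon g (\<alpha> t x) = (\<Prod>w\<in>C g. (t ^ n w * x w) ^ d w)"
          unfolding mon_def by (intro prod.cong) auto
        also have "\<dots> = (\<Prod>w\<in>C g. t ^ (d w * n w)) * mon g x"
          by (simp add: mon_def power_mult_distrib prod.distrib mult.commute flip: power_mult)
        finally show "mon g (\<alpha> t x) = t ^ N g * mon g x" by (simp add: power_sum N_def)
      qed
      also have "(\<Sum>w\<in>L. mon (\<gamma> w) (\<alpha> t x)) = (\<Sum>w\<in>L. poly (T w) t ^ d w)"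
        using L(2) by (intro sum.cong refl) (auto simp: mon_def lone_C L_def T lone_V)
      finally show ?thesis by (simp add: poly_sum poly_monom mult.commute)
    qed
    then have "(\<Sum>g\<in>S. monom (mon g x) (N g)) + (\<Sum>w\<in>L. T w ^ d w) = 0" by (rule poly_eqI_all)
    then have "poly (pderiv ((\<Sum>g\<in>S. monom (mon g x) (N g)) + (\<Sum>w\<in>L. T w ^ d w))) 1 = 0"
      by simp
    then have "(\<Sum>g\<in>S. of_nat (N g) * mon g x)
        + (\<Sum>w\<in>L. of_nat (d w) * poly (T w) 1 ^ (d w - 1) * poly (pderiv (T w)) 1) = 0"
      by (simp add: pderiv_add pderiv_sum pderiv_monom pderiv_power poly_sum poly_monom mult.assoc)
    moreover have "(\<Sum>w\<in>L. of_nat (d w) * poly (T w) 1 ^ (d w - 1) * poly (pderiv (T w)) 1)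
        = (\<Sum>w\<in>L. of_nat (d w) * x w ^ (d w - 1) * eval_at x (P w))"
      using L(2) by (intro sum.cong refl) (auto simp: T1 dT)
    moreover have "eval_at x (single (single w m) c) = c * x w ^ m" for w m c
      using mpoly_hom_single[of "\<lambda>c. c" x "single w m" c] by (simp add: eval_at_def monom_at_single)
    ultimately show ?thesis
      by (simp add: G_def eval_at_simps mon_def)
  qed
  have "G \<in> graded V base deg"
    unfolding G_def
  proof (intro graded_add graded_sum)
    fix g assume "g \<in> S"
    then show "const (of_nat (N g)) * (\<Prod>w\<in>C g. var w ^ d w) \<in> graded V base deg"
      by (intro graded_smult graded_mon) (auto simp: S_def)
  next
    fix w assume "w \<in> L"
    then have w: "lone w" "w \<in> V" by (auto simp: L_def lone_V)
    have "single (single w (d w - 1)) (of_nat (d w)) \<in> graded V base ((d w - 1) * base w)"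
      using w by (auto simp: graded_def poly_ring_def)
    moreover have "P w \<in> graded V base (base w)"
      using P(1)[OF w(2)] P(3)[OF w(2) _ weight_base] by (auto simp: graded_def)
    ultimately have "single (single w (d w - 1)) (of_nat (d w)) * P w \<in> graded V base ((d w - 1) * base w + base w)"
      by (rule graded_mult)
    moreover have "(d w - 1) * base w + base w = deg"
      using base_lone[OF w(1)] d_pos[OF w(2)] by (cases "d w") auto
    ultimately show "single (single w (d w - 1)) (of_nat (d w)) * P w \<in> graded V base deg" by simp
  qed
  from vanishing_multiple_of_F[OF u this tangent] obtain c where G_F: "G = const c * F" by blast
  \<comment> \<open>a term \<open>e\<close> of \<open>P u\<close> contributes \<open>x\<^sub>u\<^bsup>d u - 1\<^esup> e\<close> to the multiple \<open>G\<close> of \<open>F\<close>; unless \<open>e = x\<^sub>u\<close>, it has to cancel against a term of some \<open>x\<^sub>w\<^bsup>d w - 1\<^esup> P w\<close>\<close>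
  have "e = single u 1" if e: "e \<in> keys (P u)" for e
  proof (rule ccontr)
    assume ne: "e \<noteq> single u 1"
    let ?e = "single u (d u - 1) + e"
    have du: "d u \<ge> 2" by (rule lone_exponent_ge_2[OF u])
    have eu: "lookup ?e u \<noteq> 0" using du by (simp add: lookup_add)
    have "single u (d u) = single u (d u - 1) + single u 1"
      using du by (simp flip: single_add)
    then have "?e \<noteq> single u (d u)" using ne by simp
    then have "lookup F ?e = 0"
      using eu lookup_others_poly[OF eu] by (simp add: F_lone[OF u] lookup_add var_power lookup_single)
    then have "lookup G ?e = 0"
      using lookup_single_mult[of 0 c F ?e] by (simp add: G_F const_def)
    moreover have "lookup (const a * (\<Prod>w\<in>C g. var w ^ d w)) ?e = 0" if g: "g \<in> S" for g and a :: 'k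
    proof -
      have "\<gamma> u \<in> \<gamma> ` L" using L(3) by blast
      then have "u \<notin> C g" using g by (auto simp: S_def)
      then have "const a * (\<Prod>w\<in>C g. var w ^ d w) \<in> poly_ring (V - {u})"
        by (intro poly_ring_mult poly_ring_const poly_ring_prod poly_ring_power poly_ring_var) auto
      then show ?thesis by (rule lookup_outside[OF _ _ eu]) auto
    qed
    ultimately have sum: "(\<Sum>w\<in>L. lookup (single (single w (d w - 1)) (of_nat (d w)) * P w) ?e) = 0"
      unfolding G_def lookup_add[of "sum _ _"] lookup_sum by simp
    have ne0: "lookup (single (single u (d u - 1)) (of_nat (d u)) * P u) ?e \<noteq> 0"
      unfolding lookup_single_mult using du e by (simp add: in_keys_iff)
    have "\<exists>w\<in>L - {u}. lookup (single (single w (d w - 1)) (of_nat (d w)) * P w) ?e \<noteq> 0"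
    proof (rule ccontr)
      assume "\<not> ?thesis"
      then have "(\<Sum>w\<in>L - {u}. lookup (single (single w (d w - 1)) (of_nat (d w)) * P w) ?e) = 0"
        by (intro sum.neutral) blast
      then show False using sum ne0 by (simp only: sum.remove[OF L(1,3)] add_0_right)
    qed
    then obtain w where w: "w \<in> L" "w \<noteq> u" "?e \<in> keys (single (single w (d w - 1)) (of_nat (d w)) * P w)"
      by (auto simp: in_keys_iff)
    obtain e' where "?e = single w (d w - 1) + e'" using keys_single_mult[OF w(3)] by blast
    from arg_cong[OF this, of "\<lambda>e. lookup e w"] have ew: "lookup e w \<ge> d w - 1"
      using w(2) by (simp add: lookup_add lookup_single)
    have lw: "lone w" and dw: "d w \<ge> 2" using w(1) lone_exponent_ge_2 by (auto simp: L_def)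
    have "(d w - 1) * base w \<le> lookup e w * base w" using ew by simp
    also have "\<dots> \<le> wt base e" by (rule wt_ge)
    also have "\<dots> = base u" by (rule P(3)[OF uV e weight_base])
    finally have le: "(d w - 1) * base w \<le> base u" .
    obtain k where k: "d w = k + 2" using dw by (metis add.commute le_Suc_ex)
    have L_eq: "d u * base u = (k + 2) * base w" using base_lone[OF u] base_lone[OF lw] k by simp
    have "2 * base u \<le> d u * base u" using du by (intro mult_right_mono) auto
    moreover have le': "(k + 1) * base w \<le> base u" using le k by simp
    moreover have "2 * ((k + 1) * base w) = k * base w + (k + 2) * base w" by (simp add: algebra_simps)
    ultimately have "k * base w = 0" using L_eq by linarith
    then have k0: "k = 0" using base_pos[of w] by simp
    then have "d u * base u \<le> 2 * base u" using L_eq le' by simp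
    then have "d u \<le> 2" using base_pos[of u] by simp
    then have "d u = 2" "d w = 2" using du k k0 by simp_all
    then show False using unique_lone_square[OF u lw] w(2) by simp
  qed
  then show ?thesis using poly_single_eigen[OF uV] P(2)[OF uV] by blast
qed

lemma coord_homogeneous:
  assumes "v \<in> V" shows "\<exists>n. homogeneous \<alpha> n (coord v)"
  using shared_or_lone[OF assms] euler_shared euler_lone
    euler_eigen[OF \<alpha> reg_coord[OF assms] coord_nonzero[OF assms]] by blast

end

subsection \<open>Automorphisms normalize the torus\<close>

text \<open>The inverse on \<open>X\<close> is carried along, so that statements about \<open>\<phi>\<close> can be applied to it by symmetry.\<close>

definition automorphism :: "(('v \<Rightarrow> 'k) \<Rightarrow> ('v \<Rightarrow> 'k)) \<Rightarrow> (('v \<Rightarrow> 'k) \<Rightarrow> ('v \<Rightarrow> 'k)) \<Rightarrow> bool" where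
  "automorphism \<phi> \<psi> \<longleftrightarrow> (\<forall>x\<in>X. \<phi> x \<in> X \<and> \<psi> x \<in> X \<and> \<psi> (\<phi> x) = x \<and> \<phi> (\<psi> x) = x) \<and>
     (\<forall>v\<in>V. zext (\<lambda>x. \<phi> x v) \<in> reg \<and> zext (\<lambda>x. \<psi> x v) \<in> reg)"

lemma automorphism_sym: "automorphism \<phi> \<psi> \<Longrightarrow> automorphism \<psi> \<phi>"
  by (auto simp: automorphism_def)

lemma automorphismD:
  assumes "automorphism \<phi> \<psi>"
  shows "x \<in> X \<Longrightarrow> \<phi> x \<in> X" "x \<in> X \<Longrightarrow> \<psi> x \<in> X" "x \<in> X \<Longrightarrow> \<psi> (\<phi> x) = x" "x \<in> X \<Longrightarrow> \<phi> (\<psi> x) = x"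
    "v \<in> V \<Longrightarrow> zext (\<lambda>x. \<phi> x v) \<in> reg" "v \<in> V \<Longrightarrow> zext (\<lambda>x. \<psi> x v) \<in> reg"
  using assms by (auto simp: automorphism_def)

lemma reg_pullback:
  assumes a: "automorphism \<phi> \<psi>" and f: "f \<in> reg"
  shows "zext (\<lambda>x. f (\<phi> x)) \<in> reg"
  using f
proof (induction f rule: reg_induct)
  case (const c)
  have "zext (\<lambda>x. zext (\<lambda>_. c) (\<phi> x)) = zext (\<lambda>_. c)"
    by (intro zext_cong) (simp add: automorphismD[OF a])
  then show ?case by (simp add: reg_const)
next
  case (coord v)
  have "zext (\<lambda>x. coord v (\<phi> x)) = zext (\<lambda>x. \<phi> x v)"
    by (intro zext_cong) (simp add: automorphismD[OF a])
  then show ?case by (simp add: automorphismD[OF a] coord)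
next
  case (add f g)
  have "zext (\<lambda>x. (f + g) (\<phi> x)) = zext (\<lambda>x. f (\<phi> x)) + zext (\<lambda>x. g (\<phi> x))"
    by (subst zext_add[symmetric]) (rule zext_cong, rule plus_fun_apply)
  then show ?case using reg_add add by metis
next
  case (mult f g)
  have "zext (\<lambda>x. (f * g) (\<phi> x)) = zext (\<lambda>x. f (\<phi> x)) * zext (\<lambda>x. g (\<phi> x))"
    by (subst zext_mult[symmetric]) (rule zext_cong, rule times_fun_apply)
  then show ?case using reg_mult mult by metis
qed

lemma mult_action_conjugate:
  assumes a: "automorphism \<phi> \<psi>" and \<alpha>: "mult_action \<alpha>"
  shows "mult_action (\<lambda>t x. \<phi> (\<alpha> t (\<psi> x)))"
  unfolding mult_action_def
proof (intro conjI allI ballI)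
  fix v assume v: "v \<in> V"
  let ?f = "zext (\<lambda>x. \<phi> x v)"
  obtain P N where P: "\<forall>x\<in>X. \<forall>t. poly (P x) t = ?f (\<alpha> t x)"
    "\<forall>d. zext (\<lambda>x. coeff (P x) d) \<in> reg" "\<forall>x\<in>X. degree (P x) \<le> N"
    using expands_reg[OF \<alpha> automorphismD(5)[OF a v]] unfolding expands_def by blast
  have "zext (\<lambda>x. coeff (P (\<psi> x)) d) \<in> reg" for d
  proof -
    have "zext (\<lambda>x. zext (\<lambda>x. coeff (P x) d) (\<psi> x)) = zext (\<lambda>x. coeff (P (\<psi> x)) d)"
      by (intro zext_cong) (simp add: automorphismD[OF a])
    then show ?thesis using reg_pullback[OF automorphism_sym[OF a]] P(2) by metis
  qed
  then show "expands (\<lambda>t x. \<phi> (\<alpha> t (\<psi> x))) (coord v)"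
    unfolding expands_def
    by (intro exI[of _ "\<lambda>x. P (\<psi> x)"] exI[of _ N])
      (use P in \<open>auto simp: automorphismD[OF a] mult_actionD[OF \<alpha>]\<close>)
qed (simp_all add: automorphismD[OF a] mult_actionD[OF \<alpha>])

definition transports where
  "transports \<phi> \<mu> \<nu> \<longleftrightarrow> (\<forall>t. \<forall>x\<in>X. \<phi> (act \<mu> t x) = act \<nu> t (\<phi> x))"

text \<open>At a point of \<open>X\<close> where just two monomials do not vanish, they have opposite values; moving the point by
  \<open>t = 2\<close> keeps it in \<open>X\<close> only if both monomials have the same degree.\<close>

lemma weight_if_preserves:
  assumes pos: "\<And>v. v \<in> V \<Longrightarrow> \<nu> v > 0" and X: "\<And>t x. x \<in> X \<Longrightarrow> act \<nu> t x \<in> X"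
  shows "weight \<nu>"
  unfolding weight_def
proof (intro conjI ballI)
  fix g h assume g: "g \<in> \<gamma> ` V" and h: "h \<in> \<gamma> ` V"
  let ?s = "\<lambda>g. \<Sum>v\<in>C g. d v * \<nu> v"
  show "?s g = ?s h"
  proof (cases "g = h")
    case False
    obtain w where w: "w \<in> V" "\<gamma> w = h" using h by auto
    obtain z :: 'k where z: "z ^ d w = -1" using nth_root_exists[of "d w" "-1 :: 'k"] d_pos[OF w(1)] by blast
    define x where "x = (\<lambda>v. if \<gamma> v = g then 1 else if v = w then z else if \<gamma> v = h then 1 else (0 :: 'k))"
    have mg: "mon g x = 1" by (rule mon_one) (simp add: x_def)
    have "mon h x = x w ^ d w * cofactor w x" using mon_cofactor[OF w(1), of x] w(2) by simp
    moreover have "cofactor w x = 1"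
      unfolding cofactor_def by (intro prod.neutral) (use w False in \<open>auto simp: x_def\<close>)
    ultimately have mh: "mon h x = -1" using w(2) False z by (simp add: x_def)
    have m0: "mon g' x = 0" if "g' \<in> \<gamma> ` V - {g} - {h}" for g'
      by (rule mon_zero) (use that w in \<open>auto simp: x_def\<close>)
    have sum: "(\<Sum>g'\<in>\<gamma> ` V. f g' * mon g' x) = f g - f h" for f
    proof -
      have "(\<Sum>g'\<in>\<gamma> ` V. f g' * mon g' x) = f g * mon g x + (f h * mon h x + (\<Sum>g'\<in>\<gamma> ` V - {g} - {h}. f g' * mon g' x))"
        using g h False finite_groups
        by (subst sum.remove[of _ g], auto, subst sum.remove[of _ h], auto)
      then show ?thesis using mg mh m0 by simp
    qed
    have xX: "restrict x V \<in> X" unfolding restrict_in_X using sum[of "\<lambda>_. 1"] by simp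
    have "(\<Sum>g'\<in>\<gamma> ` V. mon g' (act \<nu> 2 (restrict x V))) = 0" by (rule in_X[OF X[OF xX]])
    moreover have "act \<nu> 2 (restrict x V) = act \<nu> 2 x" by (auto simp: act_def)
    ultimately have "(2::'k) ^ ?s g - 2 ^ ?s h = 0"
      using sum[of "\<lambda>g. 2 ^ ?s g"] by (simp add: mon_act)
    then show ?thesis by (intro two_power_inject[where ?'k = 'k]) simp
  qed simp
qed (rule pos)

text \<open>Conjugating a diagonal action by \<open>\<phi>\<close> gives an action of the multiplicative monoid, which is diagonal again. Its
  weights are positive, since it contracts \<open>X\<close> to a point as \<open>t\<close> becomes zero and no coordinate is constant on \<open>X\<close>.\<close>

lemma automorphism_transports:
  assumes a: "automorphism \<phi> \<psi>" and \<mu>: "weight \<mu>"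
  shows "\<exists>\<nu>. weight \<nu> \<and> transports \<phi> \<mu> \<nu>"
proof -
  define \<alpha> where "\<alpha> t x = \<phi> (act \<mu> t (\<psi> x))" for t x
  have \<alpha>: "mult_action \<alpha>"
    using mult_action_conjugate[OF a mult_action_act[OF \<mu>]] unfolding \<alpha>_def[abs_def] .
  have "\<forall>v\<in>V. \<exists>n. homogeneous \<alpha> n (coord v)" using coord_homogeneous[OF \<alpha>] by blast
  from bchoice[OF this] obtain \<nu> where \<nu>: "\<And>v. v \<in> V \<Longrightarrow> homogeneous \<alpha> (\<nu> v) (coord v)" by blast
  have eq: "\<alpha> t x = act \<nu> t x" if x: "x \<in> X" for t x
  proof -
    have m: "\<alpha> t x \<in> X" by (rule mult_actionD(1)[OF \<alpha> x])
    have in_V: "\<alpha> t x v = t ^ \<nu> v * x v" if "v \<in> V" for v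
    proof -
      have "coord v (\<alpha> t x) = t ^ \<nu> v * coord v x"
        by (rule homogeneousD[OF \<nu>[OF that] x])
      then show ?thesis by (simp only: zext_apply[OF m] zext_apply[OF x])
    qed
    have "\<alpha> t x \<in> V \<rightarrow>\<^sub>E UNIV" using m unfolding zero_set_def affine_space_def by blast
    then have out_V: "\<alpha> t x v = undefined" if "v \<notin> V" for v using that by (rule PiE_arb)
    show ?thesis
    proof (rule ext)
      fix v show "\<alpha> t x v = act \<nu> t x v"
      proof (cases "v \<in> V")
        case True
        then show ?thesis by (simp only: act_def restrict_apply if_True in_V)
      next
        case False
        from out_V[OF False] show ?thesis using False by (simp only: act_def restrict_apply if_False)
      qed
    qed
  qed
  have pos: "\<nu> v > 0" if v: "v \<in> V" for v
  proof (rule ccontr)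
    assume "\<not> \<nu> v > 0"
    let ?o = "\<lambda>v\<in>V. 0 :: 'k"
    have c: "x v = \<phi> ?o v" if x: "x \<in> X" for x
    proof -
      have "\<phi> ?o = act \<nu> 0 x" using eq[OF x, of 0] by (simp only: \<alpha>_def act_zero[OF \<mu>])
      then have "\<phi> ?o v = act \<nu> 0 x v" by (rule fun_cong)
      also have "\<dots> = x v" using \<open>\<not> \<nu> v > 0\<close> v by (simp add: act_def)
      finally show ?thesis by (rule sym)
    qed
    have "\<phi> ?o v = ?o v" by (rule c[OF origin_in_X, symmetric])
    then have "x v = 0" if "x \<in> X" for x
      using c[OF that] v by simp
    then have "coord v = 0" by (auto simp: zext_def zero_fun_def)
    then show False using coord_nonzero[OF v] by simp
  qed
  have "weight \<nu>"
  proof (rule weight_if_preserves[OF pos])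
    fix t x assume x: "x \<in> X"
    show "act \<nu> t x \<in> X" using mult_actionD(1)[OF \<alpha> x, of t] by (simp only: eq[OF x])
  qed
  moreover have "transports \<phi> \<mu> \<nu>"
    unfolding transports_def
  proof (intro allI ballI)
    fix t x assume x: "x \<in> X"
    show "\<phi> (act \<mu> t x) = act \<nu> t (\<phi> x)"
      using eq[OF automorphismD(1)[OF a x], of t] automorphismD(3)[OF a x] by (simp only: \<alpha>_def)
  qed
  ultimately show ?thesis by blast
qed

end

section \<open>Automorphisms are monomial\<close>

text \<open>As a polynomial in \<open>s\<close>, the mixed second difference of \<open>s\<^sup>q\<close> has leading term \<open>q (q - 1) a b s\<^bsup>q-2\<^esup>\<close>.\<close>

lemma mixed_difference_power:
  fixes a b :: "'k::field_char_0"
  assumes q: "q \<ge> 3" and eq: "\<And>s. (s + a + b) ^ q - (s + a) ^ q - (s + b) ^ q + s ^ q = k"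
  shows "a * b = 0"
proof -
  define Q where "Q = [:a + b, 1:] ^ q - [:a, 1:] ^ q - [:b, 1:] ^ q + [:0, 1:] ^ q"
  have "poly Q s = poly [:k:] s" for s
    using eq[of s] by (simp add: Q_def algebra_simps)
  then have "Q = [:k:]" by (rule poly_eqI_all)
  then have "coeff Q (q - 2) = 0" using q by (simp add: coeff_pCons split: nat.split)
  moreover have "coeff ([:c, 1:] ^ q) (q - 2) = of_nat (q choose (q - 2)) * c ^ 2" for c :: 'k
    using coeff_linear_poly_power[of "q - 2" q c 1] q by simp
  ultimately have "of_nat (q choose (q - 2)) * (2 * (a * b)) = 0"
    by (simp add: Q_def algebra_simps power2_eq_square)
  moreover have "(of_nat (q choose (q - 2)) :: 'k) \<noteq> 0" using q by simp
  ultimately show ?thesis by simp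
qed

text \<open>The coefficient of \<open>s\<^bsup>q-1\<^esup>\<close> is \<open>q m\<^bsup>q-1\<^esup> n\<close> on the left and zero on the right.\<close>

lemma affine_power_eq:
  fixes m n :: "'k::field_char_0"
  assumes q: "q \<ge> 2" and m: "m \<noteq> 0" and eq: "\<And>s. (m * s + n) ^ q = c * s ^ q + k"
  shows "n = 0"
proof -
  have "poly ([:n, m:] ^ q) s = poly (monom c q + [:k:]) s" for s
    using eq[of s] by (simp add: poly_monom algebra_simps)
  then have "[:n, m:] ^ q = monom c q + [:k:]" by (rule poly_eqI_all)
  moreover obtain r where "q = Suc (Suc r)" using q by (metis add_2_eq_Suc le_Suc_ex)
  ultimately have "coeff ([:n, m:] ^ q) (q - 1) = 0"
    by (simp add: coeff_pCons)
  then have "of_nat (q choose (q - 1)) * m ^ (q - 1) * n = 0"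
    using coeff_linear_poly_power[of "q - 1" q n m] q by simp
  moreover have "q choose (q - 1) \<noteq> 0" using zero_less_binomial[of "q - 1" q] by simp
  ultimately show ?thesis using m by simp
qed

context separated
begin

subsection \<open>Linear parts\<close>

text \<open>The map \<open>\<theta>\<close> of weights describes the conjugation of diagonal actions by \<open>\<phi>\<close>, and \<open>p v\<close> is a multihomogeneous
  polynomial that represents the coordinate \<open>v\<close> of \<open>\<phi>\<close>. The coefficients of \<open>p v\<close> at \<open>single u 1\<close> form the
  Jacobian matrix of \<open>\<phi>\<close> at the origin.\<close>

definition lift where
  "lift \<phi> \<theta> p \<longleftrightarrow> (\<forall>\<mu>. weight \<mu> \<longrightarrow> weight (\<theta> \<mu>) \<and> transports \<phi> \<mu> (\<theta> \<mu>)) \<and>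
     (\<forall>v\<in>V. p v \<in> poly_ring V \<and> (\<forall>x\<in>X. \<phi> x v = eval_at x (p v)) \<and>
        (\<forall>e\<in>keys (p v). \<forall>\<mu>. weight \<mu> \<longrightarrow> wt \<mu> e = \<theta> \<mu> v))"

lemma liftD:
  assumes "lift \<phi> \<theta> p"
  shows "weight \<mu> \<Longrightarrow> weight (\<theta> \<mu>)" "weight \<mu> \<Longrightarrow> transports \<phi> \<mu> (\<theta> \<mu>)"
    "v \<in> V \<Longrightarrow> p v \<in> poly_ring V" "v \<in> V \<Longrightarrow> x \<in> X \<Longrightarrow> \<phi> x v = eval_at x (p v)"
    "v \<in> V \<Longrightarrow> e \<in> keys (p v) \<Longrightarrow> weight \<mu> \<Longrightarrow> wt \<mu> e = \<theta> \<mu> v"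
  using assms unfolding lift_def by blast+

lemma lift_exists:
  assumes a: "automorphism \<phi> \<psi>" shows "\<exists>\<theta> p. lift \<phi> \<theta> p"
proof -
  have "\<forall>\<mu>. \<exists>\<nu>. weight \<mu> \<longrightarrow> weight \<nu> \<and> transports \<phi> \<mu> \<nu>"
    using automorphism_transports[OF a] by blast
  from choice[OF this] obtain \<theta> where \<theta>: "\<And>\<mu>. weight \<mu> \<Longrightarrow> weight (\<theta> \<mu>)" "\<And>\<mu>. weight \<mu> \<Longrightarrow> transports \<phi> \<mu> (\<theta> \<mu>)"
    by blast
  have "\<forall>v\<in>V. \<exists>p. p \<in> poly_ring V \<and> (\<forall>x\<in>X. \<phi> x v = eval_at x p) \<and> (\<forall>e\<in>keys p. \<forall>\<mu>. weight \<mu> \<longrightarrow> wt \<mu> e = \<theta> \<mu> v)"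
  proof
    fix v assume v: "v \<in> V"
    let ?f = "zext (\<lambda>x. \<phi> x v)"
    have f: "?f \<in> reg" by (rule automorphismD(5)[OF a v])
    have "homogeneous (act \<mu>) (\<theta> \<mu> v) ?f" if \<mu>: "weight \<mu>" for \<mu>
      unfolding homogeneous_def
    proof (intro conjI allI ballI f)
      fix t x assume x: "x \<in> X"
      have "\<phi> (act \<mu> t x) = act (\<theta> \<mu>) t (\<phi> x)" using \<theta>(2)[OF \<mu>] x unfolding transports_def by blast
      then have "\<phi> (act \<mu> t x) v = t ^ \<theta> \<mu> v * \<phi> x v" using v by (simp add: act_def)
      then show "?f (act \<mu> t x) = t ^ \<theta> \<mu> v * ?f x"
        by (simp only: zext_apply[OF x] zext_apply[OF act_mem[OF \<mu> x]])
    qed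
    from multihomogeneous_poly[OF f this] obtain p where p: "p \<in> poly_ring V" "\<forall>x\<in>X. ?f x = eval_at x p"
      "\<forall>e\<in>keys p. \<forall>\<mu>. weight \<mu> \<longrightarrow> wt \<mu> e = \<theta> \<mu> v" by blast
    have "\<forall>x\<in>X. \<phi> x v = eval_at x p" using p(2) by simp
    then show "\<exists>p. p \<in> poly_ring V \<and> (\<forall>x\<in>X. \<phi> x v = eval_at x p) \<and> (\<forall>e\<in>keys p. \<forall>\<mu>. weight \<mu> \<longrightarrow> wt \<mu> e = \<theta> \<mu> v)"
      using p by blast
  qed
  from bchoice[OF this] obtain p where "\<forall>v\<in>V. p v \<in> poly_ring V \<and> (\<forall>x\<in>X. \<phi> x v = eval_at x (p v)) \<and>
      (\<forall>e\<in>keys (p v). \<forall>\<mu>. weight \<mu> \<longrightarrow> wt \<mu> e = \<theta> \<mu> v)" by blast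
  then have "lift \<phi> \<theta> p" using \<theta> unfolding lift_def by blast
  then show ?thesis by blast
qed

text \<open>The weights \<open>\<theta> \<mu>\<close> are positive, so that automorphisms fix the origin.\<close>

lemma lift_zero_notin_keys:
  assumes l: "lift \<phi> \<theta> p" and v: "v \<in> V" shows "0 \<notin> keys (p v)"
proof
  assume "0 \<in> keys (p v)"
  then have "wt base 0 = \<theta> base v" by (rule liftD(5)[OF l v _ weight_base])
  then show False using weight_pos[OF liftD(1)[OF l weight_base] v] by simp
qed

lemma lift_eval_zero:
  assumes l: "lift \<phi> \<theta> p" and v: "v \<in> V" shows "eval_at (\<lambda>_. 0) (p v) = 0"
  unfolding eval_at_monoms
proof (rule sum.neutral, rule ballI)
  fix e assume "e \<in> keys (p v)"
  then have "e \<noteq> 0" using lift_zero_notin_keys[OF l v] by metis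
  then obtain w where w: "w \<in> keys e" by (metis ex_in_conv poly_mapping_eqI in_keys_iff lookup_zero)
  then have "(0::'k) ^ lookup e w = 0" by (simp add: in_keys_iff power_0_left)
  then have "monom_at (\<lambda>_. 0::'k) e = 0"
    unfolding monom_at_def using w by (metis (mono_tags, lifting) finite_keys prod_zero)
  then show "lookup (p v) e * monom_at (\<lambda>_. 0) e = 0" by simp
qed

lemma lift_weights_inverse:
  assumes a: "automorphism \<phi> \<psi>" and l: "lift \<phi> \<theta> p" and l': "lift \<psi> \<theta>' p'"
    and \<mu>: "weight \<mu>" and v: "v \<in> V"
  shows "\<theta>' (\<theta> \<mu>) v = \<mu> v"
proof -
  obtain x where x: "x \<in> X" "x v \<noteq> 0"
    using coord_nonzero[OF v] unfolding zext_def zero_fun_def by (metis (mono_tags, lifting))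
  have "\<psi> (\<phi> (act \<mu> 2 x)) = act (\<theta>' (\<theta> \<mu>)) 2 (\<psi> (\<phi> x))"
    using liftD(2)[OF l \<mu>] liftD(2)[OF l' liftD(1)[OF l \<mu>]] x(1) automorphismD(1)[OF a x(1)]
    unfolding transports_def by simp
  then have "act \<mu> 2 x = act (\<theta>' (\<theta> \<mu>)) 2 x"
    by (simp only: automorphismD(3)[OF a x(1)] automorphismD(3)[OF a act_mem[OF \<mu> x(1)]])
  from fun_cong[OF this, of v] have "(2::'k) ^ \<mu> v = 2 ^ \<theta>' (\<theta> \<mu>) v"
    using v x(2) by (simp add: act_def)
  then show ?thesis using two_power_inject by metis
qed

lemma lift_linear_weight:
  assumes l: "lift \<phi> \<theta> p" and v: "v \<in> V" and u: "lookup (p v) (single u 1) \<noteq> 0" and \<mu>: "weight \<mu>"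
  shows "\<theta> \<mu> v = \<mu> u"
proof -
  have "single u 1 \<in> keys (p v)" using u by (simp add: in_keys_iff)
  from liftD(5)[OF l v this \<mu>] show ?thesis by simp
qed

text \<open>The chain rule at the origin. The linear part of a polynomial is determined by its restriction to \<open>X\<close>, so the
  Jacobian matrix of \<open>\<phi> \<circ> \<psi>\<close>, computed from polynomials, is that of the identity.\<close>

lemma lift_linear_inverse:
  assumes a: "automorphism \<phi> \<psi>" and l: "lift \<phi> \<theta> p" and l': "lift \<psi> \<theta>' p'"
    and v: "v \<in> V" and b: "b \<in> V"
  shows "(\<Sum>w\<in>V. lookup (p v) (single w 1) * lookup (p' w) (single b 1)) = (if v = b then 1 else 0)"
proof -
  define s where "s = mpoly_hom const p' (p v)"
  define c where "c = (\<lambda>w. if w = b then [:0, 1:] else (0 :: 'k poly))"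
  let ?h = "mpoly_hom (\<lambda>a. [:a:]) c"
  have c_linear: "coeff (?h q) 1 = lookup q (single b 1)" if q: "q \<in> poly_ring V" for q
  proof -
    have "coeff (?h q) 1 = (\<Sum>w\<in>V. lookup q (single w 1) * coeff (c w) 1)"
      by (rule coeff_1_curve[OF finite_V q]) (simp add: c_def)
    also have "\<dots> = (\<Sum>w\<in>V. if w = b then lookup q (single b 1) else 0)"
      by (intro sum.cong) (auto simp: c_def)
    also have "\<dots> = lookup q (single b 1)" using b finite_V by simp
    finally show ?thesis .
  qed
  have p'V: "p' w \<in> poly_ring V" if "w \<in> V" for w by (rule liftD(3)[OF l' that])
  have pV: "p v \<in> poly_ring V" by (rule liftD(3)[OF l v])
  have sV: "s \<in> poly_ring V"
    unfolding s_def by (rule poly_ring_subst[OF pV p'V])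
  have "?h s = mpoly_hom (\<lambda>a. ?h (const a)) (\<lambda>w. ?h (p' w)) (p v)"
    unfolding s_def by (rule ring_map_mpoly_hom_comp[OF ring_map_const ring_map_mpoly_hom[OF ring_map_pCons]])
  also have "\<dots> = mpoly_hom (\<lambda>a. [:a:]) (\<lambda>w. ?h (p' w)) (p v)"
    by (simp only: mpoly_hom_const[OF ring_map_pCons])
  finally have hs: "?h s = mpoly_hom (\<lambda>a. [:a:]) (\<lambda>w. ?h (p' w)) (p v)" .
  have "coeff (?h (p' w)) 0 = 0" if "w \<in> V" for w
  proof -
    have "coeff (?h (p' w)) 0 = eval_at (\<lambda>z. poly (c z) 0) (p' w)"
      using poly_mpoly_hom[of c "p' w" 0] by (simp add: poly_0_coeff_0)
    also have "(\<lambda>z. poly (c z) 0) = (\<lambda>_. 0)" by (auto simp: c_def)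
    finally show ?thesis using lift_eval_zero[OF l' that] by simp
  qed
  then have "coeff (?h s) 1 = (\<Sum>w\<in>V. lookup (p v) (single w 1) * coeff (?h (p' w)) 1)"
    unfolding hs by (rule coeff_1_curve[OF finite_V pV])
  also have "\<dots> = (\<Sum>w\<in>V. lookup (p v) (single w 1) * lookup (p' w) (single b 1))"
    by (intro sum.cong refl) (simp only: c_linear p'V)
  finally have lin: "lookup s (single b 1) = (\<Sum>w\<in>V. lookup (p v) (single w 1) * lookup (p' w) (single b 1))"
    by (simp only: c_linear[OF sV])
  have "lookup (var v - s) (single b 1) = 0"
  proof (rule vanishing_linear_part[OF _ _ b])
    show "var v - s \<in> poly_ring V" by (intro poly_ring_diff poly_ring_var v sV)
    fix x assume x: "x \<in> X"
    have "eval_at x s = eval_at (\<lambda>w. eval_at x (p' w)) (p v)"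
      unfolding s_def by (rule eval_at_subst)
    also have "\<dots> = eval_at (\<psi> x) (p v)"
      by (rule eval_at_cong[OF _ pV]) (simp add: liftD(4)[OF l' _ x])
    also have "\<dots> = \<phi> (\<psi> x) v" by (rule liftD(4)[OF l v automorphismD(2)[OF a x], symmetric])
    also have "\<dots> = x v" by (simp only: automorphismD(4)[OF a x])
    finally show "eval_at x (var v - s) = 0" by (simp add: eval_at_simps)
  qed
  then show ?thesis
    unfolding lookup_minus lin var_def by (auto simp: lookup_single when_def)
qed

lemma lift_linear_nonzero:
  assumes a: "automorphism \<phi> \<psi>" and l: "lift \<phi> \<theta> p" and v: "v \<in> V"
  shows "\<exists>u\<in>V. lookup (p v) (single u 1) \<noteq> 0"
proof (rule ccontr)
  assume n: "\<not> ?thesis"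
  obtain \<theta>' p' where l': "lift \<psi> \<theta>' p'" using lift_exists[OF automorphism_sym[OF a]] by blast
  have "(\<Sum>w\<in>V. lookup (p v) (single w 1) * lookup (p' w) (single v 1)) = 0"
    by (rule sum.neutral) (use n in auto)
  then show False using lift_linear_inverse[OF a l l' v v] by simp
qed

text \<open>All monomials of \<open>p v\<close> have the degree of \<open>u\<close>, which is extremal.\<close>

lemma lift_to_shared:
  assumes l: "lift \<phi> \<theta> p" and v: "v \<in> V" and u: "shared u" "lookup (p v) (single u 1) \<noteq> 0"
  shows "eval_at x (p v) = lookup (p v) (single u 1) * x u"
proof -
  have "e = single u 1" if e: "e \<in> keys (p v)" for e
  proof (rule shared_extremal[OF u(1)])
    show "keys e \<subseteq> V" using liftD(3)[OF l v] e by (auto simp: poly_ring_def)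
    fix \<mu> assume \<mu>: "weight \<mu>"
    show "wt \<mu> e = 1 * \<mu> u"
      using liftD(5)[OF l v e \<mu>] lift_linear_weight[OF l v u(2) \<mu>] by simp
  qed
  then have "keys (p v) \<subseteq> {single u 1}" by blast
  then have "eval_at x (p v) = (\<Sum>e\<in>{single u 1}. lookup (p v) e * monom_at x e)"
    unfolding eval_at_def by (intro mpoly_hom_superset) auto
  then show ?thesis by (simp add: monom_at_single)
qed

lemma automorphism_coord_inject:
  assumes a: "automorphism \<phi> \<psi>" and v: "v \<in> V" and w: "w \<in> V"
    and c: "\<And>x. x \<in> X \<Longrightarrow> \<phi> x v = c * x u" and c': "\<And>x. x \<in> X \<Longrightarrow> \<phi> x w = c' * x u" "c' \<noteq> 0"
  shows "v = w"
proof (rule coords_independent[OF v w])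
  fix x assume x: "x \<in> X"
  have "x v = c * \<psi> x u" "x w = c' * \<psi> x u"
    using c[OF automorphismD(2)[OF a x]] c'(1)[OF automorphismD(2)[OF a x]]
    by (simp_all only: automorphismD(4)[OF a x])
  then show "x v = c / c' * x w" using c'(2) by simp
qed

text \<open>If \<open>v\<close> corresponded to a lone \<open>u\<close>, then the degree \<open>d u\<close> times that of \<open>v\<close> would be the degree of the monomial \<open>e\<close>
  obtained by applying \<open>\<psi>\<close> to the monomial of \<open>v\<close>. By extremality \<open>e\<close> is a power of \<open>v\<close>, so that \<open>\<psi>\<close> maps both \<open>v\<close> and
  another variable of its monomial to multiples of \<open>v\<close>, contrary to bijectivity.\<close>

lemma lift_shared_to_shared:
  assumes a: "automorphism \<phi> \<psi>" and l: "lift \<phi> \<theta> p"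
    and v: "shared v" and u: "u \<in> V" "lookup (p v) (single u 1) \<noteq> 0"
  shows "shared u"
proof (rule ccontr)
  assume "\<not> shared u"
  then have lu: "lone u" using shared_or_lone u(1) by blast
  note a' = automorphism_sym[OF a]
  obtain \<theta>' p' where l': "lift \<psi> \<theta>' p'" using lift_exists[OF a'] by blast
  have vV: "v \<in> V" by (rule shared_V[OF v])
  have "\<forall>w\<in>V. \<exists>z. z \<in> V \<and> lookup (p' w) (single z 1) \<noteq> 0"
    using lift_linear_nonzero[OF a' l'] by blast
  from bchoice[OF this] obtain \<tau> where \<tau>: "\<And>w. w \<in> V \<Longrightarrow> \<tau> w \<in> V"
    "\<And>w. w \<in> V \<Longrightarrow> lookup (p' w) (single (\<tau> w) 1) \<noteq> 0" by blast
  define e where "e = (\<Sum>w\<in>C (\<gamma> v). single (\<tau> w) (d w))"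
  have wt_e: "wt \<mu> e = d u * \<mu> v" if \<mu>: "weight \<mu>" for \<mu>
  proof -
    have "\<mu> v = \<theta> (\<theta>' \<mu>) v" by (rule lift_weights_inverse[OF a' l' l \<mu> vV, symmetric])
    also have "\<dots> = \<theta>' \<mu> u" by (rule lift_linear_weight[OF l vV u(2) liftD(1)[OF l' \<mu>]])
    finally have "d u * \<mu> v = (\<Sum>w\<in>C (\<gamma> u). d w * \<theta>' \<mu> w)"
      unfolding lone_C[OF lu] by simp
    also have "\<dots> = (\<Sum>w\<in>C (\<gamma> v). d w * \<theta>' \<mu> w)"
      by (rule weight_balanced[OF liftD(1)[OF l' \<mu>] u(1) vV])
    also have "\<dots> = (\<Sum>w\<in>C (\<gamma> v). d w * \<mu> (\<tau> w))"
      by (intro sum.cong refl) (use lift_linear_weight[OF l' _ \<tau>(2) \<mu>] in auto)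
    also have "\<dots> = wt \<mu> e" unfolding e_def wt_sum wt_single ..
    finally show ?thesis by simp
  qed
  have lookup_e: "lookup e z = (\<Sum>w\<in>C (\<gamma> v). lookup (single (\<tau> w) (d w)) z)" for z
    unfolding e_def by (rule lookup_sum)
  have "keys e \<subseteq> V"
  proof
    fix z assume z: "z \<in> keys e"
    show "z \<in> V"
    proof (rule ccontr)
      assume "z \<notin> V"
      then have "lookup e z = 0"
        unfolding lookup_e using \<tau>(1) by (intro sum.neutral) (auto simp: lookup_single when_def)
      then show False using z by (simp add: in_keys_iff)
    qed
  qed
  then have e: "e = single v (d u)" using shared_extremal[OF v _ wt_e] by blast
  have \<tau>v: "\<tau> w = v" if w: "w \<in> C (\<gamma> v)" for w
  proof (rule ccontr)
    assume "\<tau> w \<noteq> v"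
    have "lookup (single (\<tau> w) (d w)) (\<tau> w) \<le> lookup e (\<tau> w)"
      unfolding lookup_e by (rule member_le_sum[OF w]) (use finite_C in auto)
    moreover have "d w > 0" using w d_pos by blast
    ultimately have "lookup e (\<tau> w) \<noteq> 0" by simp
    then show False using e \<open>\<tau> w \<noteq> v\<close> by (simp add: lookup_single)
  qed
  obtain w where w: "w \<in> V" "w \<noteq> v" "\<gamma> w = \<gamma> v" using v by (auto simp: shared_def)
  have "\<tau> v = v" "\<tau> w = v" using \<tau>v vV w by auto
  then have nz: "lookup (p' v) (single v 1) \<noteq> 0" "lookup (p' w) (single v 1) \<noteq> 0"
    using \<tau>(2)[OF vV] \<tau>(2)[OF w(1)] by simp_all
  have "v = w"
  proof (rule automorphism_coord_inject[OF a' vV w(1)])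
    show "\<psi> x v = lookup (p' v) (single v 1) * x v" if "x \<in> X" for x
      using liftD(4)[OF l' vV that] lift_to_shared[OF l' vV v nz(1)] by simp
    show "\<psi> x w = lookup (p' w) (single v 1) * x v" if "x \<in> X" for x
      using liftD(4)[OF l' w(1) that] lift_to_shared[OF l' w(1) v nz(2)] by simp
  qed (rule nz(2))
  then show False using w(2) by simp
qed

text \<open>By the previous lemma \<open>\<phi>\<close> permutes the finite set of shared variables up to factors, so none of them is left
  for \<open>v\<close>.\<close>

lemma lift_lone_to_lone:
  assumes a: "automorphism \<phi> \<psi>" and l: "lift \<phi> \<theta> p"
    and v: "lone v" and u: "u \<in> V" "lookup (p v) (single u 1) \<noteq> 0"
  shows "lone u"
proof (rule ccontr)
  assume "\<not> lone u"
  then have su: "shared u" using shared_or_lone u(1) by blast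
  define S where "S = {w. shared w}"
  have SV: "S \<subseteq> V" unfolding S_def using shared_V by blast
  then have S: "finite S" "\<And>w. w \<in> S \<Longrightarrow> w \<in> V" using finite_subset[OF SV finite_V] by blast+
  have "\<forall>w\<in>S. \<exists>z. z \<in> S \<and> lookup (p w) (single z 1) \<noteq> 0"
  proof
    fix w assume w: "w \<in> S"
    obtain z where z: "z \<in> V" "lookup (p w) (single z 1) \<noteq> 0"
      using lift_linear_nonzero[OF a l S(2)[OF w]] by blast
    have "shared w" using w by (simp only: S_def mem_Collect_eq)
    from lift_shared_to_shared[OF a l this z] have "z \<in> S" by (simp only: S_def mem_Collect_eq)
    then show "\<exists>z. z \<in> S \<and> lookup (p w) (single z 1) \<noteq> 0" using z(2) by blast
  qed
  from bchoice[OF this] obtain \<sigma> where \<sigma>: "\<And>w. w \<in> S \<Longrightarrow> \<sigma> w \<in> S"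
    "\<And>w. w \<in> S \<Longrightarrow> lookup (p w) (single (\<sigma> w) 1) \<noteq> 0" by blast
  have \<phi>\<sigma>: "\<phi> x w = lookup (p w) (single (\<sigma> w) 1) * x (\<sigma> w)" if "w \<in> S" "x \<in> X" for w x
  proof -
    have "shared (\<sigma> w)" using \<sigma>(1)[OF that(1)] by (simp only: S_def mem_Collect_eq)
    from lift_to_shared[OF l S(2)[OF that(1)] this \<sigma>(2)[OF that(1)]]
    show ?thesis unfolding liftD(4)[OF l S(2)[OF that(1)] that(2)] .
  qed
  have "inj_on \<sigma> S"
  proof (rule inj_onI)
    fix w w' assume w: "w \<in> S" "w' \<in> S" "\<sigma> w = \<sigma> w'"
    show "w = w'"
    proof (rule automorphism_coord_inject[OF a S(2)[OF w(1)] S(2)[OF w(2)]])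
      show "\<phi> x w = lookup (p w) (single (\<sigma> w) 1) * x (\<sigma> w)" if "x \<in> X" for x
        by (rule \<phi>\<sigma>[OF w(1) that])
      show "\<phi> x w' = lookup (p w') (single (\<sigma> w') 1) * x (\<sigma> w)" if "x \<in> X" for x
        unfolding w(3) by (rule \<phi>\<sigma>[OF w(2) that])
    qed (rule \<sigma>(2)[OF w(2)])
  qed
  moreover have "\<sigma> ` S \<subseteq> S" using \<sigma>(1) by blast
  ultimately have "\<sigma> ` S = S" by (intro endo_inj_surj S(1))
  moreover have "u \<in> S" using su by (simp only: S_def mem_Collect_eq)
  ultimately have "u \<in> \<sigma> ` S" by (simp only:)
  then obtain w where w: "w \<in> S" "\<sigma> w = u" by (rule imageE) (rule that, simp_all only:)
  have "w = v"
  proof (rule automorphism_coord_inject[OF a S(2)[OF w(1)] lone_V[OF v]])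
    show "\<phi> x w = lookup (p w) (single (\<sigma> w) 1) * x u" if "x \<in> X" for x
      using \<phi>\<sigma>[OF w(1) that] unfolding w(2) .
    show "\<phi> x v = lookup (p v) (single u 1) * x u" if "x \<in> X" for x
      unfolding liftD(4)[OF l lone_V[OF v] that] by (rule lift_to_shared[OF l lone_V[OF v] su u(2)])
  qed (rule u(2))
  then have "shared v" using w(1) by (simp only: S_def mem_Collect_eq)
  then show False using v not_shared_lone by blast
qed

text \<open>The degree of \<open>F\<close> for \<open>\<mu>\<close> is at most its degree for \<open>\<theta> \<mu>\<close>: a lone variable \<open>z\<close> of maximal exponent corresponds to
  a lone variable \<open>u\<close>, whose exponent is not larger. The same inequality for the inverse gives equality.\<close>

lemma lift_lone_weight_le:
  assumes a: "automorphism \<phi> \<psi>" and l: "lift \<phi> \<theta> p" and \<mu>: "weight \<mu>" and v: "lone v"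
  shows "\<mu> v \<le> \<theta> \<mu> v"
proof -
  have "{w. lone w} \<subseteq> V" using lone_V by blast
  then have fin: "finite {w. lone w}" by (rule finite_subset[OF _ finite_V])
  define m where "m = Max (d ` {w. lone w})"
  have "m \<in> d ` {w. lone w}" unfolding m_def using fin v by (intro Max_in) auto
  then obtain z where z: "lone z" "d z = m" by auto
  have max: "d w \<le> d z" if "lone w" for w
    unfolding z(2) m_def using fin that by (intro Max_ge) auto
  have zV: "z \<in> V" and vV: "v \<in> V" by (auto simp: z lone_V v)
  obtain u where u: "u \<in> V" "lookup (p z) (single u 1) \<noteq> 0" using lift_linear_nonzero[OF a l zV] by blast
  have lu: "lone u" by (rule lift_lone_to_lone[OF a l z(1) u])
  have bal: "d w * \<nu> w = d w' * \<nu> w'" if "weight \<nu>" "lone w" "lone w'" for \<nu> w w'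
    using weight_balanced[OF that(1) lone_V[OF that(2)] lone_V[OF that(3)]]
    unfolding lone_C[OF that(2)] lone_C[OF that(3)] by simp
  have "d v * \<mu> v = d u * \<mu> u" by (rule bal[OF \<mu> v lu])
  also have "\<dots> \<le> d z * \<mu> u" using max[OF lu] by simp
  also have "\<mu> u = \<theta> \<mu> z" by (rule lift_linear_weight[OF l zV u(2) \<mu>, symmetric])
  also have "d z * \<theta> \<mu> z = d v * \<theta> \<mu> v" by (rule bal[OF liftD(1)[OF l \<mu>] z(1) v])
  finally show ?thesis using d_pos[OF vV] by simp
qed

lemma lift_lone_weight:
  assumes a: "automorphism \<phi> \<psi>" and l: "lift \<phi> \<theta> p" and \<mu>: "weight \<mu>" and v: "lone v"
  shows "\<theta> \<mu> v = \<mu> v"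
proof -
  note a' = automorphism_sym[OF a]
  obtain \<theta>' p' where l': "lift \<psi> \<theta>' p'" using lift_exists[OF a'] by blast
  have "\<mu> v \<le> \<theta> \<mu> v" by (rule lift_lone_weight_le[OF a l \<mu> v])
  moreover have "\<theta> \<mu> v \<le> \<theta>' (\<theta> \<mu>) v" by (rule lift_lone_weight_le[OF a' l' liftD(1)[OF l \<mu>] v])
  moreover have "\<theta>' (\<theta> \<mu>) v = \<mu> v" by (rule lift_weights_inverse[OF a l l' \<mu> lone_V[OF v]])
  ultimately show ?thesis by simp
qed

lemma lone_exponent_eq_iff:
  assumes "lone v" "lone w"
  shows "d v = d w \<longleftrightarrow> base v = base w" "d v < d w \<longleftrightarrow> base w < base v"
proof -
  have eq: "d v * base v = d w * base w" using base_lone[OF assms(1)] base_lone[OF assms(2)] by simp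
  have pos: "d v > 0" "d w > 0" "base v > 0" "base w > 0"
    using d_pos[OF lone_V[OF assms(1)]] d_pos[OF lone_V[OF assms(2)]] base_pos by auto
  have lt: "base b < base a" if "d a < d b" "d a * base a = d b * base b" "base b > 0" for a b
  proof (rule ccontr)
    assume "\<not> base b < base a"
    then have "d a * base a \<le> d a * base b" by simp
    also have "\<dots> < d b * base b" using that by simp
    finally show False using that(2) by simp
  qed
  have lt': "d w < d v" if "base v < base w"
  proof (rule ccontr)
    assume "\<not> d w < d v"
    then have "d v * base v \<le> d w * base v" by simp
    also have "\<dots> < d w * base w" using that pos by simp
    finally show False using eq by simp
  qed
  show "d v < d w \<longleftrightarrow> base w < base v"
  proof
    show "base w < base v" if "d v < d w" using lt[OF that eq pos(4)] .
    show "d v < d w" if b: "base w < base v"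
    proof (rule ccontr)
      assume "\<not> d v < d w"
      then have "d w * base w \<le> d v * base w" by simp
      also have "\<dots> < d v * base v" using b pos by simp
      finally show False using eq by simp
    qed
  qed
  show "d v = d w \<longleftrightarrow> base v = base w"
    using eq pos by (metis mult_cancel1 mult_cancel2 not_gr_zero)
qed

subsection \<open>Variables forming a monomial of their own\<close>

context
  fixes \<phi> \<psi> \<theta> p
  assumes a: "automorphism \<phi> \<psi>" and l: "lift \<phi> \<theta> p"
begin

abbreviation M where "M v u \<equiv> lookup (p v) (single u 1)"

abbreviation P :: "('v \<Rightarrow> 'k) \<Rightarrow> 'v \<Rightarrow> 'k" where "P x v \<equiv> eval_at x (p v)"

lemma lone_linear:
  assumes v: "lone v" and u: "u \<in> V" "M v u \<noteq> 0"
  shows "lone u" "d u = d v"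
proof -
  show lu: "lone u" by (rule lift_lone_to_lone[OF a l v u])
  have "base u = \<theta> base v" by (rule lift_linear_weight[OF l lone_V[OF v] u(2) weight_base, symmetric])
  also have "\<dots> = base v" by (rule lift_lone_weight[OF a l weight_base v])
  finally show "d u = d v" using lone_exponent_eq_iff(1)[OF lu v] by simp
qed

text \<open>A lone variable of smaller exponent than \<open>v\<close> has a larger weight than the whole monomial \<open>e\<close>, and one of the same
  exponent has the same weight.\<close>

lemma lone_keys:
  assumes v: "lone v" and e: "e \<in> keys (p v)" and w: "lone w"
  shows "d w < d v \<Longrightarrow> lookup e w = 0" "d w = d v \<Longrightarrow> lookup e w = 0 \<or> e = single w 1"
proof -
  have we: "wt base e = base v"
    using liftD(5)[OF l lone_V[OF v] e weight_base] lift_lone_weight[OF a l weight_base v] by simp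
  have eV: "keys e \<subseteq> V" using liftD(3)[OF l lone_V[OF v]] e by (auto simp: poly_ring_def)
  have ge: "lookup e w * base w \<le> base v" using wt_ge[of e w base] we by simp
  show "lookup e w = 0" if "d w < d v"
  proof (rule ccontr)
    assume "lookup e w \<noteq> 0"
    then have "1 * base w \<le> lookup e w * base w" by (intro mult_le_mono1) simp
    from this ge have "1 * base w \<le> base v" by (rule order_trans)
    then show False using that lone_exponent_eq_iff(2)[OF w v] by simp
  qed
  show "lookup e w = 0 \<or> e = single w 1" if "d w = d v"
  proof (cases "lookup e w = 0")
    case False
    have "base w = base v" using that lone_exponent_eq_iff(1)[OF w v] by simp
    then have "e = single w 1"
      using wt_base_full[OF eV lone_V[OF w], of 1] we False by simp
    then show ?thesis ..
  qed simp
qed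

text \<open>Since \<open>F \<circ> \<phi>\<close> vanishes on \<open>X\<close> and has the degree of \<open>F\<close>, it is a multiple of \<open>F\<close>.\<close>

lemma lift_F:
  assumes v: "lone v"
  shows "\<exists>c. \<forall>x. (\<Sum>g\<in>\<gamma> ` V. mon g (P x)) = c * (\<Sum>g\<in>\<gamma> ` V. mon g x)"
proof -
  define G where "G = mpoly_hom const p F"
  note rm = ring_map_mpoly_hom[OF ring_map_const, of p]
  have G: "G = (\<Sum>g\<in>\<gamma> ` V. \<Prod>w\<in>C g. p w ^ d w)"
    unfolding G_def F_def
    by (simp only: ring_map_sum[OF rm] ring_map_prod[OF rm] ring_map_power[OF rm] mpoly_hom_var[OF ring_map_const])
  have eval_G: "eval_at x G = (\<Sum>g\<in>\<gamma> ` V. mon g (P x))" for x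
    unfolding G_def eval_at_subst eval_at_F ..
  have "G \<in> graded V base deg"
    unfolding G
  proof (rule graded_sum)
    fix g assume g: "g \<in> \<gamma> ` V"
    then obtain z where z: "z \<in> V" "g = \<gamma> z" by blast
    have "(\<Sum>w\<in>C g. d w * \<theta> base w) = (\<Sum>w\<in>C (\<gamma> v). d w * \<theta> base w)"
      unfolding z(2) by (rule weight_balanced[OF liftD(1)[OF l weight_base] z(1) lone_V[OF v]])
    also have "\<dots> = d v * \<theta> base v" unfolding lone_C[OF v] by simp
    also have "\<dots> = deg" using lift_lone_weight[OF a l weight_base v] base_lone[OF v] by simp
    finally have s: "(\<Sum>w\<in>C g. d w * \<theta> base w) = deg" .
    have "p w \<in> graded V base (\<theta> base w)" if "w \<in> V" for w
      using liftD(3)[OF l that] liftD(5)[OF l that _ weight_base] by (auto simp: graded_def)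
    then have "(\<Prod>w\<in>C g. p w ^ d w) \<in> graded V base (\<Sum>w\<in>C g. d w * \<theta> base w)"
      by (intro graded_prod graded_power) auto
    then show "(\<Prod>w\<in>C g. p w ^ d w) \<in> graded V base deg" unfolding s .
  qed
  moreover have "eval_at x G = 0" if x: "x \<in> X" for x
  proof -
    have "eval_at x G = eval_at (\<phi> x) F"
      unfolding G_def eval_at_subst
      by (rule eval_at_cong[OF _ F_poly]) (simp add: liftD(4)[OF l _ x])
    then show ?thesis using eval_F[OF automorphismD(1)[OF a x]] by simp
  qed
  ultimately obtain c where "G = const c * F" using vanishing_multiple_of_F[OF v] by blast
  then have "eval_at x G = c * eval_at x F" for x by (simp add: eval_at_simps)
  then show ?thesis unfolding eval_G eval_at_F by blast
qed

text \<open>By induction on the exponent \<open>q\<close>. On the span of the variables of exponent \<open>q\<close> the identity above says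
  that an invertible linear substitution preserves a multiple of \<open>\<Sum> x\<^sub>a\<^sup>q\<close>; mixed second differences show
  that it is monomial if \<open>q \<ge> 3\<close>. The remaining terms then have to vanish because there is no term of
  degree \<open>q - 1\<close> on the right-hand side.\<close>

lemma lone_monomial:
  assumes "lone v"
  shows "\<exists>u. lone u \<and> d u = d v \<and> M v u \<noteq> 0 \<and> (\<forall>x. P x v = M v u * x u)"
  using assms
proof (induction "d v" arbitrary: v rule: less_induct)
  case less
  note v = less.prems
  define q where "q = d v"
  have q2: "q \<ge> 2" unfolding q_def by (rule lone_exponent_ge_2[OF v])
  define Cl where "Cl = {a. lone a \<and> d a = q}"
  have Cl_V: "a \<in> V" if "a \<in> Cl" for a using that by (auto simp: Cl_def lone_V)
  have fin: "finite Cl" using finite_V Cl_V by (meson finite_subset subsetI)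
  have vCl: "v \<in> Cl" using v by (simp add: Cl_def q_def)
  obtain \<theta>' p' where l': "lift \<psi> \<theta>' p'" using lift_exists[OF automorphism_sym[OF a]] by blast
  obtain c where c: "\<And>x. (\<Sum>g\<in>\<gamma> ` V. mon g (P x)) = c * (\<Sum>g\<in>\<gamma> ` V. mon g x)"
    using lift_F[OF v] by blast
  have M_Cl: "u \<in> Cl" if "w \<in> Cl" "u \<in> V" "M w u \<noteq> 0" for w u
    using that lone_linear[of w u] by (auto simp: Cl_def)
  have inverse: "(\<Sum>u\<in>Cl. M w u * lookup (p' u) (single b 1)) = (if w = b then 1 else 0)"
    if w: "w \<in> Cl" and b: "b \<in> V" for w b
  proof -
    have "(\<Sum>u\<in>V. M w u * lookup (p' u) (single b 1)) = (\<Sum>u\<in>Cl. M w u * lookup (p' u) (single b 1))"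
      using M_Cl[OF w] Cl_V by (intro sum.mono_neutral_right finite_V) auto
    then show ?thesis using lift_linear_inverse[OF a l l' Cl_V[OF w] b] by simp
  qed
  have row: "\<exists>u\<in>Cl. M w u \<noteq> 0" if w: "w \<in> Cl" for w
    using lift_linear_nonzero[OF a l Cl_V[OF w]] M_Cl[OF w] by blast

  \<comment> \<open>the dependence on the variables of exponent \<open>q\<close> is linear in this class and trivial outside of it\<close>
  have agree: "P x w - P y w = (\<Sum>a\<in>Cl. M w a * (x a - y a))"
    if w: "w \<in> Cl" and xy: "\<And>z. z \<notin> Cl \<Longrightarrow> x z = y z" for x y w
  proof -
    have lw: "lone w" "d w = q" using w by (auto simp: Cl_def)
    have key: "lookup (p w) e * (monom_at x e - monom_at y e)
        = (\<Sum>a\<in>Cl. if e = single a 1 then M w a * (x a - y a) else 0)" if e: "e \<in> keys (p w)" for e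
    proof (cases "\<exists>a\<in>Cl. e = single a 1")
      case True
      then obtain a where aC: "a \<in> Cl" "e = single a 1" by blast
      have "(\<Sum>b\<in>Cl. if e = single b 1 then M w b * (x b - y b) else 0)
          = (\<Sum>b\<in>Cl. if b = a then M w a * (x a - y a) else 0)"
        by (intro sum.cong refl) (auto simp: aC(2))
      then show ?thesis using aC fin by (simp add: monom_at_single)
    next
      case False
      have "monom_at x e = monom_at y e"
        unfolding monom_at_def
      proof (rule prod.cong[OF refl])
        fix z assume z: "z \<in> keys e"
        have "z \<notin> Cl"
        proof
          assume "z \<in> Cl"
          then have "lone z" "d z = d w" using lw by (auto simp: Cl_def)
          then have "lookup e z = 0 \<or> e = single z 1" using lone_keys(2)[OF lw(1) e] by blast
          then show False using z False \<open>z \<in> Cl\<close> by (auto simp: in_keys_iff)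
        qed
        then show "x z ^ lookup e z = y z ^ lookup e z" using xy by simp
      qed
      moreover have "(\<Sum>a\<in>Cl. if e = single a 1 then M w a * (x a - y a) else 0) = 0"
        by (rule sum.neutral) (use False in auto)
      ultimately show ?thesis by simp
    qed
    have "P x w - P y w = (\<Sum>e\<in>keys (p w). lookup (p w) e * (monom_at x e - monom_at y e))"
      by (simp add: eval_at_monoms sum_subtractf right_diff_distrib)
    also have "\<dots> = (\<Sum>e\<in>keys (p w). \<Sum>a\<in>Cl. if e = single a 1 then M w a * (x a - y a) else 0)"
      by (intro sum.cong refl key)
    also have "\<dots> = (\<Sum>a\<in>Cl. \<Sum>e\<in>keys (p w). if e = single a 1 then M w a * (x a - y a) else 0)"
      by (rule sum.swap)
    also have "\<dots> = (\<Sum>a\<in>Cl. M w a * (x a - y a))"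
    proof (rule sum.cong[OF refl])
      fix a
      have "(\<Sum>e\<in>keys (p w). if e = single a 1 then M w a * (x a - y a) else 0)
          = (if single a 1 \<in> keys (p w) then M w a * (x a - y a) else 0)"
        by (rule sum.delta) simp
      also have "\<dots> = M w a * (x a - y a)" by (simp add: in_keys_iff)
      finally show "(\<Sum>e\<in>keys (p w). if e = single a 1 then M w a * (x a - y a) else 0) = M w a * (x a - y a)" .
    qed
    finally show ?thesis .
  qed
  have off: "P x w = P y w" if w: "w \<in> V" "w \<notin> Cl" and xy: "\<And>z. z \<notin> Cl \<Longrightarrow> x z = y z" for x y w
  proof (cases "shared w")
    case True
    obtain u where u: "u \<in> V" "M w u \<noteq> 0" using lift_linear_nonzero[OF a l w(1)] by blast
    have su: "shared u" by (rule lift_shared_to_shared[OF a l True u])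
    then have "u \<notin> Cl" using not_shared_lone by (auto simp: Cl_def)
    then show ?thesis using xy by (simp add: lift_to_shared[OF l w(1) su u(2)])
  next
    case False
    then have lw: "lone w" using shared_or_lone w(1) by blast
    show ?thesis
    proof (cases "d w < q")
      case True
      then obtain u where "lone u" "d u = d w" "\<And>x. P x w = M w u * x u"
        using less.hyps[OF _ lw] by (auto simp: q_def)
      moreover from this have "u \<notin> Cl" using True by (auto simp: Cl_def)
      ultimately show ?thesis using xy by simp
    next
      case False
      then have dw: "q < d w" using w lw by (auto simp: Cl_def)
      have "monom_at x e = monom_at y e" if e: "e \<in> keys (p w)" for e
        unfolding monom_at_def
      proof (rule prod.cong[OF refl])
        fix z assume z: "z \<in> keys e"
        have "z \<notin> Cl"
        proof
          assume "z \<in> Cl"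
          then have "lone z" "d z < d w" using dw by (auto simp: Cl_def)
          then have "lookup e z = 0" using lone_keys(1)[OF lw e] by blast
          then show False using z by (simp add: in_keys_iff)
        qed
        then show "x z ^ lookup e z = y z ^ lookup e z" using xy by simp
      qed
      then show ?thesis by (simp add: eval_at_monoms)
    qed
  qed
  have inj: "inj_on \<gamma> Cl" by (auto simp: inj_on_def Cl_def lone_def)
  define rest where "rest x = (\<Sum>g\<in>\<gamma> ` V - \<gamma> ` Cl. mon g x)" for x
  have split: "(\<Sum>g\<in>\<gamma> ` V. mon g x) = (\<Sum>a\<in>Cl. x a ^ q) + rest x" for x
  proof -
    have "(\<Sum>g\<in>\<gamma> ` V. mon g x) = rest x + (\<Sum>g\<in>\<gamma> ` Cl. mon g x)"
      unfolding rest_def by (rule sum.subset_diff) (use Cl_V finite_groups in auto)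
    also have "(\<Sum>g\<in>\<gamma> ` Cl. mon g x) = (\<Sum>a\<in>Cl. mon (\<gamma> a) x)"
      using sum.reindex[OF inj, of "\<lambda>g. mon g x"] by simp
    also have "\<dots> = (\<Sum>a\<in>Cl. x a ^ q)"
      by (intro sum.cong refl) (auto simp: Cl_def mon_cofactor lone_V cofactor_lone)
    finally show ?thesis by (simp add: add.commute)
  qed
  have rest_cong: "rest x = rest y" if "\<And>z. z \<in> V \<Longrightarrow> z \<notin> Cl \<Longrightarrow> x z = y z" for x y
    unfolding rest_def using that by (intro sum.cong refl mon_cong) auto
  have H: "(\<Sum>w\<in>Cl. P x w ^ q) - c * (\<Sum>a\<in>Cl. x a ^ q) = (\<Sum>w\<in>Cl. P y w ^ q) - c * (\<Sum>a\<in>Cl. y a ^ q)"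
    if xy: "\<And>z. z \<notin> Cl \<Longrightarrow> x z = y z" for x y
  proof -
    have "rest (P x) = rest (P y)" by (rule rest_cong) (rule off[OF _ _ xy])
    moreover have "rest x = rest y" by (rule rest_cong) (rule xy)
    moreover have "(\<Sum>a\<in>Cl. P z a ^ q) + rest (P z) = c * (\<Sum>a\<in>Cl. z a ^ q) + c * rest z" for z
      using c[of z] by (simp only: split distrib_left)
    from this[of x] this[of y] have "(\<Sum>w\<in>Cl. P x w ^ q) - c * (\<Sum>a\<in>Cl. x a ^ q) = c * rest x - rest (P x)"
      "(\<Sum>w\<in>Cl. P y w ^ q) - c * (\<Sum>a\<in>Cl. y a ^ q) = c * rest y - rest (P y)"
      by (simp_all add: algebra_simps)
    ultimately show ?thesis by simp
  qed

  \<comment> \<open>the linear part is monomial\<close>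
  have unique: "b = b'" if w: "w \<in> Cl" and b: "b \<in> Cl" "b' \<in> Cl" and nz: "M w b \<noteq> 0" "M w b' \<noteq> 0" for w b b'
  proof (rule ccontr)
    assume bb: "b \<noteq> b'"
    have "q \<noteq> 2" using unique_lone_square[of b b'] bb b by (auto simp: Cl_def)
    then have q3: "q \<ge> 3" using q2 by simp
    have lin: "(\<Sum>z\<in>Cl. (\<Sum>a\<in>Cl. M z a * y a) ^ q) = c * (\<Sum>a\<in>Cl. y a ^ q)" for y
    proof -
      define y0 where "y0 z = (if z \<in> Cl then y z else 0)" for z
      have zero: "P (\<lambda>_. 0) z = 0" if "z \<in> Cl" for z by (rule lift_eval_zero[OF l Cl_V[OF that]])
      have Py: "P y0 z = (\<Sum>a\<in>Cl. M z a * y a)" if z: "z \<in> Cl" for z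
      proof -
        have "P y0 z - P (\<lambda>_. 0) z = (\<Sum>a\<in>Cl. M z a * (y0 a - 0))"
          by (rule agree[OF z]) (simp add: y0_def)
        also have "\<dots> = (\<Sum>a\<in>Cl. M z a * y a)" by (intro sum.cong) (auto simp: y0_def)
        finally show ?thesis using zero[OF z] by simp
      qed
      have "(\<Sum>z\<in>Cl. P y0 z ^ q) - c * (\<Sum>a\<in>Cl. y0 a ^ q)
          = (\<Sum>z\<in>Cl. P (\<lambda>_. 0) z ^ q) - c * (\<Sum>a\<in>Cl. 0 ^ q)"
        by (rule H) (simp add: y0_def)
      also have "\<dots> = 0" using zero q2 by (simp add: power_0_left)
      finally have "(\<Sum>z\<in>Cl. P y0 z ^ q) = c * (\<Sum>a\<in>Cl. y0 a ^ q)" by simp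
      moreover have "(\<Sum>z\<in>Cl. P y0 z ^ q) = (\<Sum>z\<in>Cl. (\<Sum>a\<in>Cl. M z a * y a) ^ q)"
        by (intro sum.cong refl) (simp only: Py)
      moreover have "(\<Sum>a\<in>Cl. y0 a ^ q) = (\<Sum>a\<in>Cl. y a ^ q)" by (intro sum.cong) (auto simp: y0_def)
      ultimately show ?thesis by simp
    qed
    define \<delta> where "\<delta> z u = (if u = z then 1 else 0 :: 'k)" for z u :: 'v
    define y where "y s \<alpha> \<beta> a = s * lookup (p' a) (single w 1) + \<alpha> * \<delta> b a + \<beta> * \<delta> b' a" for s \<alpha> \<beta> a
    have My: "(\<Sum>a\<in>Cl. M z a * y s \<alpha> \<beta> a) = s * \<delta> w z + \<alpha> * M z b + \<beta> * M z b'" if z: "z \<in> Cl" for z s \<alpha> \<beta>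
    proof -
      have del: "(\<Sum>a\<in>Cl. M z a * \<delta> u a) = M z u" if "u \<in> Cl" for u
      proof -
        have "(\<Sum>a\<in>Cl. M z a * \<delta> u a) = (\<Sum>a\<in>Cl. if a = u then M z u else 0)"
          by (intro sum.cong) (auto simp: \<delta>_def)
        then show ?thesis using that fin by simp
      qed
      have "(\<Sum>a\<in>Cl. M z a * y s \<alpha> \<beta> a) = s * (\<Sum>a\<in>Cl. M z a * lookup (p' a) (single w 1))
          + \<alpha> * (\<Sum>a\<in>Cl. M z a * \<delta> b a) + \<beta> * (\<Sum>a\<in>Cl. M z a * \<delta> b' a)"
        by (simp add: y_def sum.distrib sum_distrib_left distrib_left mult.left_commute)
      then show ?thesis using inverse[OF z Cl_V[OF w]] del b by (simp add: \<delta>_def)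
    qed
    define N where "N z s \<alpha> \<beta> = (s * \<delta> w z + \<alpha> * M z b + \<beta> * M z b') ^ q" for z and s \<alpha> \<beta> :: 'k
    have N: "(\<Sum>z\<in>Cl. N z s \<alpha> \<beta>) = c * (\<Sum>a\<in>Cl. y s \<alpha> \<beta> a ^ q)" for s \<alpha> \<beta>
    proof -
      have "(\<Sum>z\<in>Cl. N z s \<alpha> \<beta>) = (\<Sum>z\<in>Cl. (\<Sum>a\<in>Cl. M z a * y s \<alpha> \<beta> a) ^ q)"
        by (intro sum.cong refl) (simp only: N_def My)
      then show ?thesis using lin by simp
    qed
    define D where "D z s = N z s 1 1 - N z s 1 0 - N z s 0 1 + N z s 0 0" for z s
    have "(\<Sum>z\<in>Cl. D z s) = 0" for s
    proof -
      have "(\<Sum>z\<in>Cl. D z s) = c * (\<Sum>a\<in>Cl. y s 1 1 a ^ q - y s 1 0 a ^ q - y s 0 1 a ^ q + y s 0 0 a ^ q)"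
        by (simp add: D_def sum.distrib sum_subtractf N algebra_simps)
      also have "(\<Sum>a\<in>Cl. y s 1 1 a ^ q - y s 1 0 a ^ q - y s 0 1 a ^ q + y s 0 0 a ^ q) = 0"
        by (rule sum.neutral) (use bb in \<open>auto simp: y_def \<delta>_def\<close>)
      finally show ?thesis by simp
    qed
    then have Dw: "D w s = - (\<Sum>z\<in>Cl - {w}. D z s)" for s
      using sum.remove[OF fin w, of "\<lambda>z. D z s"] by (simp add: eq_neg_iff_add_eq_0)
    have "(\<Sum>z\<in>Cl - {w}. D z s) = (\<Sum>z\<in>Cl - {w}. D z 0)" for s
      by (intro sum.cong refl) (auto simp: D_def N_def \<delta>_def)
    then have D0: "D w s = - (\<Sum>z\<in>Cl - {w}. D z 0)" for s using Dw by simp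
    have Dexp: "D w s = (s + M w b + M w b') ^ q - (s + M w b) ^ q - (s + M w b') ^ q + s ^ q" for s
      by (simp add: D_def N_def \<delta>_def)
    have "M w b * M w b' = 0"
      by (rule mixed_difference_power[OF q3, where k = "- (\<Sum>z\<in>Cl - {w}. D z 0)"])
        (simp only: Dexp[symmetric] D0)
    then show False using nz by simp
  qed

  \<comment> \<open>there are no further terms\<close>
  obtain u where u: "u \<in> Cl" "M v u \<noteq> 0" using row[OF vCl] by blast
  have others0: "M w u = 0" if w: "w \<in> Cl" "w \<noteq> v" for w
  proof (rule ccontr)
    assume nz: "M w u \<noteq> 0"
    have only: "(\<Sum>a\<in>Cl. M z a * f a) = M z u * f u" if "z \<in> Cl" "M z u \<noteq> 0" for z f
    proof -
      have "(\<Sum>a\<in>Cl. M z a * f a) = (\<Sum>a\<in>Cl. if a = u then M z u * f u else 0)"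
        using unique[OF that(1) _ u(1) _ that(2)] by (intro sum.cong refl) auto
      then show ?thesis using fin u(1) by simp
    qed
    have "M v u * lookup (p' u) (single w 1) = 0"
      using inverse[OF vCl Cl_V[OF w(1)]] only[OF vCl u(2)] w(2) by simp
    moreover have "M w u * lookup (p' u) (single w 1) = 1"
      using inverse[OF w(1) Cl_V[OF w(1)]] only[OF w(1) nz] by simp
    ultimately show False using u(2) by simp
  qed
  have "P x v = M v u * x u" for x
  proof -
    define n where "n = P x v - M v u * x u"
    define k where "k = (P x v ^ q - c * x u ^ q)"
    have "(M v u * s + n) ^ q = c * s ^ q + k" for s
    proof -
      let ?y = "x(u := s)"
      have diff: "P ?y w - P x w = M w u * (s - x u)" if w: "w \<in> Cl" for w
      proof -
        have "P ?y w - P x w = (\<Sum>a\<in>Cl. M w a * (?y a - x a))"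
          by (rule agree[OF w]) (use u(1) in auto)
        also have "\<dots> = (\<Sum>a\<in>Cl. if a = u then M w u * (s - x u) else 0)"
          by (intro sum.cong) auto
        finally show ?thesis using fin u(1) by simp
      qed
      have Pv: "P ?y v = M v u * s + n"
        using diff[OF vCl] by (simp add: n_def algebra_simps)
      have "(\<Sum>w\<in>Cl. P ?y w ^ q) - c * (\<Sum>a\<in>Cl. ?y a ^ q) = (\<Sum>w\<in>Cl. P x w ^ q) - c * (\<Sum>a\<in>Cl. x a ^ q)"
        by (rule H) (use u(1) in auto)
      moreover have "(\<Sum>w\<in>Cl. P ?y w ^ q) = P ?y v ^ q + (\<Sum>w\<in>Cl - {v}. P x w ^ q)"
      proof -
        have "P ?y w = P x w" if "w \<in> Cl - {v}" for w using diff[of w] others0[of w] that by simp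
        then show ?thesis by (simp add: sum.remove[OF fin vCl])
      qed
      moreover have "(\<Sum>w\<in>Cl. P x w ^ q) = P x v ^ q + (\<Sum>w\<in>Cl - {v}. P x w ^ q)"
        by (rule sum.remove[OF fin vCl])
      moreover have "(\<Sum>a\<in>Cl. ?y a ^ q) = s ^ q + (\<Sum>a\<in>Cl - {u}. x a ^ q)"
        by (simp add: sum.remove[OF fin u(1)])
      moreover have "(\<Sum>a\<in>Cl. x a ^ q) = x u ^ q + (\<Sum>a\<in>Cl - {u}. x a ^ q)"
        by (rule sum.remove[OF fin u(1)])
      ultimately have "P ?y v ^ q - c * s ^ q = k" by (simp add: k_def algebra_simps)
      then show ?thesis unfolding Pv by (simp add: algebra_simps)
    qed
    then have "n = 0" by (rule affine_power_eq[OF q2 u(2)])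
    then show ?thesis by (simp add: n_def)
  qed
  then show ?case using u by (auto simp: Cl_def q_def)
qed

end

theorem automorphism_monomial:
  assumes a: "automorphism \<phi> \<psi>"
  obtains \<sigma> m where "bij_betw \<sigma> V V" "\<And>v. v \<in> V \<Longrightarrow> m v \<noteq> (0::'k)"
    "\<And>x v. x \<in> X \<Longrightarrow> v \<in> V \<Longrightarrow> \<phi> x v = m v * x (\<sigma> v)"
proof -
  obtain \<theta> p where l: "lift \<phi> \<theta> p" using lift_exists[OF a] by blast
  have "\<exists>u. u \<in> V \<and> lookup (p v) (single u 1) \<noteq> 0 \<and> (\<forall>x. eval_at x (p v) = lookup (p v) (single u 1) * x u)"
    if v: "v \<in> V" for v
  proof (cases "shared v")
    case True
    obtain u where u: "u \<in> V" "lookup (p v) (single u 1) \<noteq> 0" using lift_linear_nonzero[OF a l v] by blast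
    then show ?thesis using lift_to_shared[OF l v lift_shared_to_shared[OF a l True u] u(2)] by blast
  next
    case False
    then show ?thesis using lone_monomial[OF a l] shared_or_lone[OF v] lone_V by blast
  qed
  then have "\<forall>v\<in>V. \<exists>u. u \<in> V \<and> lookup (p v) (single u 1) \<noteq> 0 \<and> (\<forall>x. eval_at x (p v) = lookup (p v) (single u 1) * x u)"
    by blast
  from bchoice[OF this] obtain \<sigma> where \<sigma>: "\<And>v. v \<in> V \<Longrightarrow> \<sigma> v \<in> V"
    "\<And>v. v \<in> V \<Longrightarrow> lookup (p v) (single (\<sigma> v) 1) \<noteq> 0"
    "\<And>v x. v \<in> V \<Longrightarrow> eval_at x (p v) = lookup (p v) (single (\<sigma> v) 1) * x (\<sigma> v)" by blast
  define m where "m v = lookup (p v) (single (\<sigma> v) 1)" for v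
  have eq: "\<phi> x v = m v * x (\<sigma> v)" if "x \<in> X" "v \<in> V" for x v
    unfolding m_def liftD(4)[OF l that(2,1)] by (rule \<sigma>(3)[OF that(2)])
  have m: "m v \<noteq> 0" if "v \<in> V" for v unfolding m_def by (rule \<sigma>(2)[OF that])
  have "inj_on \<sigma> V"
  proof (rule inj_onI)
    fix v w assume vw: "v \<in> V" "w \<in> V" "\<sigma> v = \<sigma> w"
    show "v = w"
    proof (rule automorphism_coord_inject[OF a vw(1,2)])
      show "\<phi> x v = m v * x (\<sigma> v)" if "x \<in> X" for x by (rule eq[OF that vw(1)])
      show "\<phi> x w = m w * x (\<sigma> v)" if "x \<in> X" for x unfolding vw(3) by (rule eq[OF that vw(2)])
    qed (rule m[OF vw(2)])
  qed
  moreover have "\<sigma> ` V \<subseteq> V" using \<sigma>(1) by blast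
  ultimately have "bij_betw \<sigma> V V"
    unfolding bij_betw_def using endo_inj_surj[OF finite_V] by blast
  then show ?thesis using that m eq by blast
qed

end

text \<open>Plain \<open>inv\<close> is the inverse in a group.\<close>

abbreviation inv' :: "('a \<Rightarrow> 'b) \<Rightarrow> 'b \<Rightarrow> 'a" where "inv' \<equiv> inv_into UNIV"

context separated
begin

subsection \<open>Monomial automorphisms preserve the partition and the exponents\<close>

lemma torus_point:
  assumes "u \<in> V" "w \<in> V" "\<gamma> u \<noteq> \<gamma> w"
  obtains x where "x \<in> X" "\<And>v. v \<in> V \<Longrightarrow> x v \<noteq> (0::'k)"
proof -
  let ?r = "card (\<gamma> ` V - {\<gamma> u})"
  have "\<gamma> w \<in> \<gamma> ` V - {\<gamma> u}" using assms by auto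
  then have r: "?r > 0" using finite_groups by (metis card_gt_0_iff emptyE finite_Diff)
  obtain z :: 'k where z: "z ^ d u = - of_nat ?r"
    using nth_root_exists[of "d u" "- of_nat ?r :: 'k"] d_pos[OF assms(1)] by blast
  have z0: "z \<noteq> 0" using z r d_pos[OF assms(1)] by (auto simp: power_0_left)
  define x where "x = (\<lambda>v. if v = u then z else 1)"
  have "cofactor u x = 1" unfolding cofactor_def by (rule prod.neutral) (auto simp: x_def)
  moreover have "others u x = of_nat ?r"
  proof -
    have "mon g x = 1" if "g \<in> \<gamma> ` V - {\<gamma> u}" for g
      by (rule mon_one) (use that in \<open>auto simp: x_def\<close>)
    then have "others u x = (\<Sum>g\<in>\<gamma> ` V - {\<gamma> u}. 1)"
      unfolding others_def by (intro sum.cong refl)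
    then show ?thesis by simp
  qed
  ultimately have "(\<Sum>g\<in>\<gamma> ` V. mon g x) = 0"
    unfolding sum_mon_split[OF assms(1)] using z by (simp add: x_def)
  then have "restrict x V \<in> X" by (simp only: restrict_in_X)
  moreover have "restrict x V v \<noteq> 0" if "v \<in> V" for v using that z0 by (simp add: x_def)
  ultimately show ?thesis by (rule that)
qed

context
  fixes \<sigma> m
  assumes \<sigma>: "bij_betw \<sigma> V V" and m: "\<And>v. v \<in> V \<Longrightarrow> m v \<noteq> (0::'k)"
    and mem: "\<And>x. x \<in> X \<Longrightarrow> (\<Sum>g\<in>\<gamma> ` V. mon g (\<lambda>v. m v * x (\<sigma> v))) = 0"
begin

lemma \<sigma>_V: "v \<in> V \<Longrightarrow> \<sigma> v \<in> V"
  using \<sigma> by (auto simp: bij_betw_def)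

lemma \<sigma>_inj: "v \<in> V \<Longrightarrow> w \<in> V \<Longrightarrow> \<sigma> v = \<sigma> w \<Longrightarrow> v = w"
  using \<sigma> by (auto simp: bij_betw_def inj_on_def)

lemma mem_restrict: "restrict y V \<in> X \<Longrightarrow> (\<Sum>g\<in>\<gamma> ` V. mon g (\<lambda>v. m v * y (\<sigma> v))) = 0"
proof -
  assume "restrict y V \<in> X"
  from mem[OF this] have "(\<Sum>g\<in>\<gamma> ` V. mon g (\<lambda>v. m v * restrict y V (\<sigma> v))) = 0" .
  moreover have "mon g (\<lambda>v. m v * restrict y V (\<sigma> v)) = mon g (\<lambda>v. m v * y (\<sigma> v))" for g
    by (rule mon_cong) (simp add: \<sigma>_V)
  ultimately show ?thesis by simp
qed

text \<open>Multiplying the coordinate \<open>\<sigma> v\<close> of a point of \<open>X\<close> by a root of unity of order \<open>d (\<sigma> v)\<close> gives a point of \<open>X\<close>. On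
  the image of the point, this changes only the coordinate \<open>v\<close>, by the same root of unity, which therefore is one
  of order \<open>d v\<close>.\<close>

lemma exponent_le:
  assumes two: "u \<in> V" "w \<in> V" "\<gamma> u \<noteq> \<gamma> w" and v: "v \<in> V"
  shows "d (\<sigma> v) \<le> d v"
proof -
  obtain x where x: "x \<in> X" "\<And>v. v \<in> V \<Longrightarrow> x v \<noteq> (0::'k)" using torus_point[OF two] by blast
  let ?u = "\<sigma> v"
  have uV: "?u \<in> V" by (rule \<sigma>_V[OF v])
  define T where "T y = (\<lambda>w. m w * y (\<sigma> w))" for y :: "'v \<Rightarrow> 'k"
  have T: "T (x(?u := s)) w = T x w" if "w \<in> V" "w \<noteq> v" for w s
    using \<sigma>_inj[OF that(1) v] that by (auto simp: T_def)
  have sum_T: "(m v * s) ^ d v * cofactor v (T x) + others v (T x) = 0"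
    if s: "s ^ d ?u = x ?u ^ d ?u" for s
  proof -
    let ?y = "x(?u := s)"
    have "cofactor ?u ?y = cofactor ?u x" by (rule cofactor_cong) auto
    moreover have "others ?u ?y = others ?u x" by (rule others_cong) auto
    ultimately have "(\<Sum>g\<in>\<gamma> ` V. mon g ?y) = (\<Sum>g\<in>\<gamma> ` V. mon g x)"
      unfolding sum_mon_split[OF uV] using s by simp
    then have "restrict ?y V \<in> X" using in_X[OF x(1)] by (simp only: restrict_in_X)
    from mem_restrict[OF this] have "(\<Sum>g\<in>\<gamma> ` V. mon g (T ?y)) = 0" by (simp only: T_def)
    then have "T ?y v ^ d v * cofactor v (T ?y) + others v (T ?y) = 0" by (simp only: sum_mon_split[OF v])
    moreover have "cofactor v (T ?y) = cofactor v (T x)" by (rule cofactor_cong) (rule T)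
    moreover have "others v (T ?y) = others v (T x)" by (rule others_cong) (use T in metis)
    moreover have "T ?y v = m v * s" by (simp add: T_def)
    ultimately show ?thesis by simp
  qed
  have cof: "cofactor v (T x) \<noteq> 0"
    unfolding cofactor_def using finite_V m x(2) \<sigma>_V by (auto simp: prod_zero_iff T_def)
  have sub: "{z::'k. z ^ d ?u = 1} \<subseteq> {z. z ^ d v = 1}"
  proof clarify
    fix z :: 'k assume z: "z ^ d ?u = 1"
    have "(m v * (z * x ?u)) ^ d v * cofactor v (T x) = (m v * x ?u) ^ d v * cofactor v (T x)"
      using sum_T[of "z * x ?u"] sum_T[of "x ?u"] z
      by (simp add: power_mult_distrib eq_neg_iff_add_eq_0[symmetric])
    then show "z ^ d v = 1"
      using cof m[OF v] x(2)[OF uV] by (simp add: power_mult_distrib)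
  qed
  have c: "card {z::'k. z ^ d v = 1} = d v" by (rule card_nth_roots) (use d_pos[OF v] in auto)
  then have "finite {z::'k. z ^ d v = 1}" using d_pos[OF v] card_ge_0_finite by metis
  from card_mono[OF this sub] show ?thesis
    using c card_nth_roots[of "1::'k" "d ?u"] d_pos[OF uV] by simp
qed

text \<open>If \<open>\<sigma> v\<close> and \<open>\<sigma> w\<close> occur in the same monomial, they can be multiplied by \<open>t\<^bsup>d (\<sigma> w)\<^esup>\<close> and \<open>t\<^bsup>- d (\<sigma> v)\<^esup>\<close> without
  leaving \<open>X\<close>. If \<open>v\<close> and \<open>w\<close> were in different monomials, these would be multiplied by a positive and by a negative
  power of \<open>t\<close>, and the sum of all monomials could not remain zero.\<close>

lemma partition_reflected:
  assumes v: "v \<in> V" and w: "w \<in> V" and same: "\<gamma> (\<sigma> v) = \<gamma> (\<sigma> w)"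
  shows "\<gamma> v = \<gamma> w"
proof (rule ccontr)
  assume ne: "\<gamma> v \<noteq> \<gamma> w"
  obtain x where x: "x \<in> X" "\<And>v. v \<in> V \<Longrightarrow> x v \<noteq> (0::'k)" using torus_point[OF v w ne] by blast
  let ?a = "\<sigma> v" and ?b = "\<sigma> w"
  have aV: "?a \<in> V" and bV: "?b \<in> V" by (rule \<sigma>_V[OF v], rule \<sigma>_V[OF w])
  have ab: "?a \<noteq> ?b" using \<sigma>_inj[OF v w] ne by auto
  define T where "T y = (\<lambda>w. m w * y (\<sigma> w))" for y :: "'v \<Rightarrow> 'k"
  define y where "y t = x(?a := t ^ d ?b * x ?a, ?b := x ?b / t ^ d ?a)" for t
  define A where "A = mon (\<gamma> v) (T x)"
  define B where "B = mon (\<gamma> w) (T x)"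
  define R where "R = (\<Sum>g\<in>\<gamma> ` V - {\<gamma> v} - {\<gamma> w}. mon g (T x))"
  have split: "(\<Sum>g\<in>\<gamma> ` V. f g) = f (\<gamma> v) + (f (\<gamma> w) + (\<Sum>g\<in>\<gamma> ` V - {\<gamma> v} - {\<gamma> w}. f g))" for f :: "'g \<Rightarrow> 'k"
    using v w ne finite_groups by (subst sum.remove[of _ "\<gamma> v"], auto, subst sum.remove[of _ "\<gamma> w"], auto)
  have B0: "B \<noteq> 0"
    unfolding B_def mon_def using finite_V m x(2) \<sigma>_V by (auto simp: prod_zero_iff T_def)
  have eq: "t ^ (d ?b * d v) * A + (B / t ^ (d ?a * d w) + R) = 0" if t: "t \<noteq> 0" for t
  proof -
    have two: "mon (\<gamma> ?a) z = z ?a ^ d ?a * (z ?b ^ d ?b * (\<Prod>u\<in>C (\<gamma> ?a) - {?a} - {?b}. z u ^ d u))" for z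
    proof -
      have "mon (\<gamma> ?a) z = z ?a ^ d ?a * (\<Prod>u\<in>C (\<gamma> ?a) - {?a}. z u ^ d u)"
        unfolding mon_def by (rule prod.remove) (use aV finite_C in auto)
      also have "(\<Prod>u\<in>C (\<gamma> ?a) - {?a}. z u ^ d u) = z ?b ^ d ?b * (\<Prod>u\<in>C (\<gamma> ?a) - {?a} - {?b}. z u ^ d u)"
        by (rule prod.remove) (use bV ab same finite_C in auto)
      finally show ?thesis .
    qed
    have "mon (\<gamma> ?a) (y t) = (t ^ d ?b * x ?a) ^ d ?a * ((x ?b / t ^ d ?a) ^ d ?b * (\<Prod>u\<in>C (\<gamma> ?a) - {?a} - {?b}. x u ^ d u))"
    proof -
      have "(\<Prod>u\<in>C (\<gamma> ?a) - {?a} - {?b}. y t u ^ d u) = (\<Prod>u\<in>C (\<gamma> ?a) - {?a} - {?b}. x u ^ d u)"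
        by (intro prod.cong) (auto simp: y_def)
      then show ?thesis unfolding two using ab by (simp add: y_def)
    qed
    also have "\<dots> = mon (\<gamma> ?a) x"
      unfolding two using t by (simp add: power_mult_distrib power_divide mult.commute flip: power_mult)
    finally have "mon (\<gamma> ?a) (y t) = mon (\<gamma> ?a) x" .
    moreover have "mon g (y t) = mon g x" if "g \<noteq> \<gamma> ?a" for g
      by (rule mon_cong) (use that same in \<open>auto simp: y_def\<close>)
    ultimately have "mon g (y t) = mon g x" for g by (cases "g = \<gamma> ?a") auto
    then have "restrict (y t) V \<in> X" using in_X[OF x(1)] by (simp only: restrict_in_X)
    from mem_restrict[OF this] have "(\<Sum>g\<in>\<gamma> ` V. mon g (T (y t))) = 0" by (simp only: T_def)
    then have s: "mon (\<gamma> v) (T (y t)) + (mon (\<gamma> w) (T (y t)) + (\<Sum>g\<in>\<gamma> ` V - {\<gamma> v} - {\<gamma> w}. mon g (T (y t)))) = 0"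
      by (simp only: split)
    have Ty: "T (y t) z = T x z" if "z \<in> V" "z \<noteq> v" "z \<noteq> w" for z
      using \<sigma>_inj[OF that(1) v] \<sigma>_inj[OF that(1) w] that(2,3) by (auto simp: T_def y_def)
    have Tv: "T (y t) v = t ^ d ?b * T x v" using ab by (simp add: T_def y_def)
    have Tw: "T (y t) w = T x w / t ^ d ?a" by (simp add: T_def y_def)
    have "T (y t) z = T x z" if "z \<in> C (\<gamma> v) - {v}" for z
      by (rule Ty) (use that ne in auto)
    then have "cofactor v (T (y t)) = cofactor v (T x)"
      unfolding cofactor_def by (intro prod.cong refl) simp
    then have mv: "mon (\<gamma> v) (T (y t)) = t ^ (d ?b * d v) * A"
      by (simp add: A_def mon_cofactor[OF v] Tv power_mult_distrib power_mult)
    have "T (y t) z = T x z" if "z \<in> C (\<gamma> w) - {w}" for z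
      by (rule Ty) (use that ne in auto)
    then have "cofactor w (T (y t)) = cofactor w (T x)"
      unfolding cofactor_def by (intro prod.cong refl) simp
    then have mw: "mon (\<gamma> w) (T (y t)) = B / t ^ (d ?a * d w)"
      by (simp add: B_def mon_cofactor[OF w] Tw power_divide power_mult)
    have mR: "(\<Sum>g\<in>\<gamma> ` V - {\<gamma> v} - {\<gamma> w}. mon g (T (y t))) = R"
      unfolding R_def
    proof (rule sum.cong[OF refl])
      fix g assume "g \<in> \<gamma> ` V - {\<gamma> v} - {\<gamma> w}"
      then show "mon g (T (y t)) = mon g (T x)" by (intro mon_cong Ty) auto
    qed
    show ?thesis using s unfolding mv mw mR .
  qed
  let ?n = "d ?b * d v" and ?k = "d ?a * d w"
  have k: "?k > 0" using d_pos[OF aV] d_pos[OF w] by simp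
  \<comment> \<open>the identity \<open>eq\<close> multiplied by \<open>t ^ ?k\<close>; the factor \<open>t\<close> added below makes it hold at \<open>t = 0\<close> as well\<close>
  define Q where "Q = monom A (?n + ?k) + ([:B:] + monom R ?k)"
  have "poly (pCons 0 Q) t = poly 0 t" for t
  proof (cases "t = 0")
    case False
    have "poly Q t = t ^ ?k * (t ^ ?n * A + (B / t ^ ?k + R))"
      using False by (simp add: Q_def poly_monom power_add algebra_simps)
    then show ?thesis using eq[OF False] by simp
  qed simp
  then have "pCons 0 Q = 0" by (rule poly_eqI_all)
  then have "coeff Q 0 = 0" by simp
  then have "B = 0" using k by (simp add: Q_def)
  then show False using B0 by simp
qed

text \<open>The exponents have the same sum before and after permuting, so the inequalities are equalities. The
  inequality needs two monomials; a single monomial has equal exponents by assumption.\<close>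

lemma exponent_eq:
  assumes v: "v \<in> V" shows "d (\<sigma> v) = d v"
proof (cases "\<exists>u\<in>V. \<exists>w\<in>V. \<gamma> u \<noteq> \<gamma> w")
  case True
  then obtain u w where two: "u \<in> V" "w \<in> V" "\<gamma> u \<noteq> \<gamma> w" by blast
  have "(\<Sum>v\<in>V. d (\<sigma> v)) = (\<Sum>v\<in>V. d v)" by (rule sum.reindex_bij_betw[OF \<sigma>])
  then show ?thesis
    by (rule sum_mono_inv) (use exponent_le[OF two] v finite_V in auto)
next
  case False
  then show ?thesis using one_monomial[of "\<sigma> v" v] \<sigma>_V[OF v] v by blast
qed

text \<open>Since \<open>\<sigma>\<close> reflects the partition, its inverse induces a surjection of the finite set of monomials onto itself,
  which is injective.\<close>

lemma partition_preserved:
  assumes v: "v \<in> V" and w: "w \<in> V" and same: "\<gamma> v = \<gamma> w"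
  shows "\<gamma> (\<sigma> v) = \<gamma> (\<sigma> w)"
proof -
  define \<pi> where "\<pi> h = \<gamma> (inv_into V \<sigma> (inv_into V \<gamma> h))" for h
  have inv\<sigma>: "inv_into V \<sigma> u \<in> V" "\<sigma> (inv_into V \<sigma> u) = u" if "u \<in> V" for u
    using that \<sigma> inv_into_into[of u \<sigma> V] f_inv_into_f[of u \<sigma> V] by (auto simp: bij_betw_def)
  have \<pi>: "\<pi> (\<gamma> (\<sigma> u)) = \<gamma> u" if u: "u \<in> V" for u
  proof -
    have "\<gamma> (\<sigma> u) \<in> \<gamma> ` V" using \<sigma>_V[OF u] by blast
    then have z: "inv_into V \<gamma> (\<gamma> (\<sigma> u)) \<in> V" "\<gamma> (inv_into V \<gamma> (\<gamma> (\<sigma> u))) = \<gamma> (\<sigma> u)"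
      by (rule inv_into_into, rule f_inv_into_f)
    show ?thesis
      unfolding \<pi>_def by (rule partition_reflected[OF inv\<sigma>(1)[OF z(1)] u]) (simp only: inv\<sigma>(2)[OF z(1)] z(2))
  qed
  have "\<gamma> ` V \<subseteq> \<pi> ` \<gamma> ` V"
  proof
    fix g assume "g \<in> \<gamma> ` V"
    then obtain u where u: "u \<in> V" "g = \<gamma> u" by blast
    then have "g = \<pi> (\<gamma> (\<sigma> u))" using \<pi> by simp
    then show "g \<in> \<pi> ` \<gamma> ` V" using \<sigma>_V[OF u(1)] by blast
  qed
  then have "inj_on \<pi> (\<gamma> ` V)" by (rule finite_surj_inj[OF finite_groups])
  moreover have "\<pi> (\<gamma> (\<sigma> v)) = \<pi> (\<gamma> (\<sigma> w))" using \<pi>[OF v] \<pi>[OF w] same by simp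
  ultimately show ?thesis using \<sigma>_V[OF v] \<sigma>_V[OF w] by (meson imageI inj_onD)
qed

lemma sum_mon_permute: "(\<Sum>g\<in>\<gamma> ` V. mon g (\<lambda>v. x (\<sigma> v))) = (\<Sum>g\<in>\<gamma> ` V. mon g x)"
proof -
  define f where "f g = \<gamma> (\<sigma> (inv_into V \<gamma> g))" for g
  have f: "f (\<gamma> v) = \<gamma> (\<sigma> v)" if v: "v \<in> V" for v
  proof -
    have z: "inv_into V \<gamma> (\<gamma> v) \<in> V" "\<gamma> (inv_into V \<gamma> (\<gamma> v)) = \<gamma> v"
      using v by (auto intro: inv_into_into f_inv_into_f)
    show ?thesis unfolding f_def by (rule partition_preserved[OF z(1) v z(2)])
  qed
  have inj: "inj_on f (\<gamma> ` V)"
  proof (rule inj_onI)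
    fix g h assume "g \<in> \<gamma> ` V" "h \<in> \<gamma> ` V" "f g = f h"
    then obtain v w where "v \<in> V" "w \<in> V" "g = \<gamma> v" "h = \<gamma> w" "\<gamma> (\<sigma> v) = \<gamma> (\<sigma> w)"
      using f by auto
    then show "g = h" using partition_reflected by blast
  qed
  have "f ` \<gamma> ` V \<subseteq> \<gamma> ` V" using f \<sigma>_V by auto
  then have surj: "f ` \<gamma> ` V = \<gamma> ` V" by (rule endo_inj_surj[OF finite_groups _ inj])
  have "mon (\<gamma> v) (\<lambda>w. x (\<sigma> w)) = mon (f (\<gamma> v)) x" if v: "v \<in> V" for v
  proof -
    have img: "\<sigma> ` C (\<gamma> v) = C (\<gamma> (\<sigma> v))"
    proof
      show "\<sigma> ` C (\<gamma> v) \<subseteq> C (\<gamma> (\<sigma> v))"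
        using \<sigma>_V partition_preserved[OF _ v] by blast
      show "C (\<gamma> (\<sigma> v)) \<subseteq> \<sigma> ` C (\<gamma> v)"
      proof
        fix u assume u: "u \<in> C (\<gamma> (\<sigma> v))"
        then have "u \<in> \<sigma> ` V" using \<sigma> by (simp add: bij_betw_def)
        then obtain w where w: "w \<in> V" "u = \<sigma> w" by blast
        then have "\<gamma> w = \<gamma> v" using partition_reflected[OF w(1) v] u by simp
        then show "u \<in> \<sigma> ` C (\<gamma> v)" using w by blast
      qed
    qed
    have "inj_on \<sigma> (C (\<gamma> v))" by (rule inj_onI) (auto intro: \<sigma>_inj)
    then have "mon (\<gamma> (\<sigma> v)) x = (\<Prod>w\<in>C (\<gamma> v). x (\<sigma> w) ^ d (\<sigma> w))"
      unfolding mon_def img[symmetric] by (rule prod.reindex_cong) (rule refl)+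
    also have "\<dots> = mon (\<gamma> v) (\<lambda>w. x (\<sigma> w))"
      unfolding mon_def by (intro prod.cong refl) (auto simp: exponent_eq)
    finally show ?thesis using f[OF v] by simp
  qed
  then have "(\<Sum>g\<in>\<gamma> ` V. mon g (\<lambda>v. x (\<sigma> v))) = (\<Sum>g\<in>\<gamma> ` V. mon (f g) x)"
    by (intro sum.cong refl) auto
  also have "\<dots> = (\<Sum>g\<in>f ` \<gamma> ` V. mon g x)"
    by (subst sum.reindex[OF inj]) simp
  finally show ?thesis unfolding surj .
qed

end

subsection \<open>The isomorphism\<close>

abbreviation PF where "PF \<equiv> perm_group V F"
abbreviation H where "H \<equiv> diag_group V F"
abbreviation G where "G \<equiv> semidirect PF H (permute_coords V)"

lemma perm_carrier: "\<tau> \<in> carrier PF \<longleftrightarrow> \<tau> permutes V \<and> (\<forall>x. eval_at (\<lambda>v. x (\<tau> v)) F = eval_at x F)"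
proof -
  have "rename_vars \<tau> F = F \<longleftrightarrow> (\<forall>x. eval_at (\<lambda>v. x (\<tau> v)) F = eval_at x F)" if \<tau>: "\<tau> permutes V"
  proof
    show "\<forall>x. eval_at (\<lambda>v. x (\<tau> v)) F = eval_at x F" if "rename_vars \<tau> F = F"
      using that eval_at_rename_vars by metis
    have r: "rename_vars \<tau> F \<in> poly_ring V"
      unfolding rename_vars_def by (rule poly_ring_subst[OF F_poly]) (use permutes_in_image[OF \<tau>] in auto)
    show "rename_vars \<tau> F = F" if "\<forall>x. eval_at (\<lambda>v. x (\<tau> v)) F = eval_at x F"
      by (rule eval_at_inject[OF finite_V r F_poly]) (simp only: eval_at_rename_vars that)
  qed
  then show ?thesis unfolding perm_group_def by auto
qed

lemma in_X_iff: "x \<in> X \<longleftrightarrow> x \<in> affine_space V \<and> eval_at x F = 0"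
  by (simp add: zero_set_def)

lemma restrict_affine: "restrict x V \<in> affine_space V"
  by (simp add: affine_space_def)

lemma affine_eqI: "x \<in> affine_space V \<Longrightarrow> y \<in> affine_space V \<Longrightarrow> (\<And>v. v \<in> V \<Longrightarrow> x v = y v) \<Longrightarrow> x = y"
  unfolding affine_space_def by (rule PiE_ext)

lemma rescale_affine: "rescale V t x \<in> affine_space V"
  by (simp add: rescale_def restrict_affine)

lemma rescale_apply: "v \<in> V \<Longrightarrow> rescale V t x v = t v * x v"
  by (simp add: rescale_def)

definition pull :: "('v \<Rightarrow> 'v) \<Rightarrow> ('v \<Rightarrow> 'k) \<Rightarrow> ('v \<Rightarrow> 'k)" where
  "pull \<tau> x = (\<lambda>v\<in>V. x (\<tau> v))"

lemma pull_in_X: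
  assumes \<tau>: "\<tau> \<in> carrier PF" and x: "x \<in> affine_space V"
  shows "pull \<tau> x \<in> X \<longleftrightarrow> x \<in> X"
proof -
  have "eval_at (pull \<tau> x) F = eval_at x F"
    unfolding pull_def eval_restrict[OF F_poly] using \<tau> by (simp add: perm_carrier)
  then show ?thesis using x by (simp add: in_X_iff pull_def restrict_affine)
qed

lemma perm_inverse:
  assumes \<tau>: "\<tau> \<in> carrier PF" shows "inv' \<tau> \<in> carrier PF"
proof -
  have p: "\<tau> permutes V" and e: "\<And>x. eval_at (\<lambda>v. x (\<tau> v)) F = eval_at x F"
    using \<tau> by (auto simp: perm_carrier)
  have "eval_at (\<lambda>v. x (inv' \<tau> v)) F = eval_at x F" for x
    using e[of "\<lambda>v. x (inv' \<tau> v)"] by (simp add: permutes_inverses[OF p])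
  then show ?thesis using permutes_inv[OF p] by (simp add: perm_carrier)
qed

lemma diag_carrier:
  "t \<in> carrier H \<longleftrightarrow> t \<in> V \<rightarrow>\<^sub>E (UNIV - {0}) \<and> (\<forall>x\<in>affine_space V. rescale V t x \<in> X \<longleftrightarrow> x \<in> X)"
proof -
  have "rescale V t ` X = X \<longleftrightarrow> (\<forall>x\<in>affine_space V. rescale V t x \<in> X \<longleftrightarrow> x \<in> X)"
    if t: "t \<in> V \<rightarrow>\<^sub>E (UNIV - {0})"
  proof -
    have t0: "t v \<noteq> 0" if "v \<in> V" for v using t that by auto
    have inj: "x = y" if "x \<in> affine_space V" "y \<in> affine_space V" "rescale V t x = rescale V t y" for x y
    proof (rule affine_eqI[OF that(1,2)])
      fix v assume v: "v \<in> V"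
      from fun_cong[OF that(3), of v] show "x v = y v" using t0[OF v] v by (simp add: rescale_def)
    qed
    have surj: "\<exists>x\<in>affine_space V. y = rescale V t x" if "y \<in> affine_space V" for y
    proof (rule bexI)
      show "(\<lambda>v\<in>V. y v / t v) \<in> affine_space V" by (rule restrict_affine)
      show "y = rescale V t (\<lambda>v\<in>V. y v / t v)"
        by (rule affine_eqI[OF that]) (simp_all add: rescale_def restrict_affine t0)
    qed
    have XA: "x \<in> X \<Longrightarrow> x \<in> affine_space V" for x by (simp add: in_X_iff)
    show ?thesis
    proof (rule iffI, rule ballI)
      fix x :: "'v \<Rightarrow> 'k" assume im: "rescale V t ` X = X" and x: "x \<in> affine_space V"
      show "rescale V t x \<in> X \<longleftrightarrow> x \<in> X"
      proof
        assume "rescale V t x \<in> X"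
        then have "rescale V t x \<in> rescale V t ` X" by (simp only: im)
        then obtain y where y: "y \<in> X" "rescale V t x = rescale V t y" by blast
        from inj[OF x XA[OF y(1)] y(2)] y(1) show "x \<in> X" by simp
      next
        assume "x \<in> X"
        then show "rescale V t x \<in> X" using im by blast
      qed
    next
      assume iff: "\<forall>x\<in>affine_space V. rescale V t x \<in> X \<longleftrightarrow> x \<in> X"
      show "rescale V t ` X = X"
      proof
        show "rescale V t ` X \<subseteq> X" using iff XA by blast
        show "X \<subseteq> rescale V t ` X"
        proof
          fix y assume y: "y \<in> X"
          obtain x where x: "x \<in> affine_space V" "y = rescale V t x" using surj[OF XA[OF y]] by blast
          then have "x \<in> X" using iff y by blast
          then show "y \<in> rescale V t ` X" using x(2) by blast
        qed
      qed
    qed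
  qed
  then show ?thesis unfolding diag_group_def by auto
qed

lemma rescale_in_X: "t \<in> carrier H \<Longrightarrow> x \<in> affine_space V \<Longrightarrow> rescale V t x \<in> X \<longleftrightarrow> x \<in> X"
  unfolding diag_carrier by blast

lemma pull_affine: "pull \<tau> x \<in> affine_space V"
  unfolding pull_def by (rule restrict_affine)

lemma inv_into_perm: "\<tau> permutes V \<Longrightarrow> v \<in> V \<Longrightarrow> inv_into V \<tau> v = inv' \<tau> v"
  by (rule inv_into_f_eq) (auto simp: permutes_inj_on permutes_inverses permutes_in_image[OF permutes_inv])

text \<open>Pulling back along permutations is contravariant, hence the inverse.\<close>

definition realize :: "('v \<Rightarrow> 'v) \<times> ('v \<Rightarrow> 'k) \<Rightarrow> ('v \<Rightarrow> 'k) \<Rightarrow> ('v \<Rightarrow> 'k)" where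
  "realize = (\<lambda>(\<tau>, t). \<lambda>x\<in>X. rescale V t (pull (inv' \<tau>) x))"

lemma carrier_G: "carrier G = carrier PF \<times> carrier H"
  by (simp add: semidirect_def)

lemma G_closed:
  assumes "\<tau> \<in> carrier PF" "t \<in> carrier H" "\<tau>' \<in> carrier PF" "t' \<in> carrier H"
  shows "\<tau> \<circ> \<tau>' \<in> carrier PF" "rescale V t (permute_coords V \<tau> t') \<in> carrier H"
proof -
  have p: "\<tau> permutes V" "\<tau>' permutes V" using assms by (auto simp: perm_carrier)
  have "eval_at (\<lambda>v. x ((\<tau> \<circ> \<tau>') v)) F = eval_at x F" for x
  proof -
    have "eval_at (\<lambda>v. x (\<tau> (\<tau>' v))) F = eval_at (\<lambda>v. x (\<tau> v)) F"
      using assms(3)[unfolded perm_carrier, THEN conjunct2, THEN spec, of "\<lambda>v. x (\<tau> v)"] .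
    then show ?thesis using assms(1) by (simp add: perm_carrier)
  qed
  then show "\<tau> \<circ> \<tau>' \<in> carrier PF" using permutes_compose[OF p(2,1)] by (simp add: perm_carrier)
  let ?s = "rescale V t (permute_coords V \<tau> t')"
  have invV: "inv' \<tau> v \<in> V" if "v \<in> V" for v using that permutes_in_image[OF permutes_inv[OF p(1)]] by simp
  have t: "t v \<noteq> 0" "t' v \<noteq> 0" if "v \<in> V" for v using assms(2,4) that by (auto simp: diag_carrier)
  have s: "?s v = t v * t' (inv' \<tau> v)" if "v \<in> V" for v
    using that by (simp add: rescale_def permute_coords_def inv_into_perm[OF p(1)])
  have "rescale V ?s x \<in> X \<longleftrightarrow> x \<in> X" if x: "x \<in> affine_space V" for x
  proof -
    have eq: "rescale V ?s x = rescale V t (pull (inv' \<tau>) (rescale V t' (pull \<tau> x)))"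
      by (rule affine_eqI)
        (simp_all add: rescale_affine rescale_apply pull_def permute_coords_def inv_into_perm[OF p(1)] invV permutes_inverses[OF p(1)] permutes_in_image[OF p(1)]
          mult.assoc)
    have "rescale V ?s x \<in> X \<longleftrightarrow> pull (inv' \<tau>) (rescale V t' (pull \<tau> x)) \<in> X"
      unfolding eq by (rule rescale_in_X[OF assms(2) pull_affine])
    also have "\<dots> \<longleftrightarrow> rescale V t' (pull \<tau> x) \<in> X"
      by (rule pull_in_X[OF perm_inverse[OF assms(1)] rescale_affine])
    also have "\<dots> \<longleftrightarrow> pull \<tau> x \<in> X"
      by (rule rescale_in_X[OF assms(4) pull_affine])
    also have "\<dots> \<longleftrightarrow> x \<in> X" by (rule pull_in_X[OF assms(1) x])
    finally show ?thesis .
  qed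
  moreover have "?s \<in> V \<rightarrow>\<^sub>E (UNIV - {0})"
  proof (rule PiE_I)
    fix v assume v: "v \<in> V"
    show "?s v \<in> UNIV - {0}" unfolding s[OF v] using t(1)[OF v] t(2)[OF invV[OF v]] by simp
  qed (simp add: rescale_def)
  ultimately show "?s \<in> carrier H" by (simp add: diag_carrier)
qed

lemma realize_apply:
  "x \<in> X \<Longrightarrow> v \<in> V \<Longrightarrow> realize (\<tau>, t) x v = t v * x (inv' \<tau> v)"
  by (simp add: realize_def rescale_def pull_def)

lemma realize_Aut:
  assumes \<tau>: "\<tau> \<in> carrier PF" and t: "t \<in> carrier H"
  shows "realize (\<tau>, t) \<in> carrier (Aut V X)"
proof -
  let ?f = "realize (\<tau>, t)"
  let ?g = "\<lambda>y. \<lambda>v\<in>V. y (\<tau> v) / t (\<tau> v)"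
  have p: "\<tau> permutes V" using \<tau> by (simp add: perm_carrier)
  have \<tau>V: "\<tau> v \<in> V" "inv' \<tau> v \<in> V" if "v \<in> V" for v
    using that permutes_in_image[OF p] permutes_in_image[OF permutes_inv[OF p]] by auto
  have t0: "t v \<noteq> 0" if "v \<in> V" for v using t that by (auto simp: diag_carrier)
  have f: "rescale V t (pull (inv' \<tau>) x) \<in> X \<longleftrightarrow> x \<in> X" if "x \<in> affine_space V" for x
    unfolding rescale_in_X[OF t pull_affine] by (rule pull_in_X[OF perm_inverse[OF \<tau>] that])
  have fX: "?f x \<in> X" if "x \<in> X" for x
    using f[of x] that by (simp add: realize_def in_X_iff)
  have fg: "rescale V t (pull (inv' \<tau>) (?g y)) = y" if "y \<in> X" for y
    by (rule affine_eqI) (use that in \<open>simp_all add: in_X_iff rescale_def pull_def restrict_affine \<tau>V t0 permutes_inverses[OF p]\<close>)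
  have gX: "?g y \<in> X" if y: "y \<in> X" for y
    using f[of "?g y"] y unfolding fg[OF y] by (simp add: restrict_affine)
  have gf: "?g (?f x) = x" if x: "x \<in> X" for x
    by (rule X_ext[OF gX[OF fX[OF x]] x]) (simp add: realize_apply[OF x] \<tau>V t0 permutes_inverses[OF p])
  have fg': "?f (?g y) = y" if y: "y \<in> X" for y
    using fg[OF y] gX[OF y] by (simp add: realize_def)
  have bij: "bij_betw ?f X X"
    by (rule bij_betw_byWitness[where f' = ?g]) (use gf fg' fX gX in blast)+
  have inv: "inv_into X ?f y = ?g y" if y: "y \<in> X" for y
    by (rule inv_into_f_eq[of ?f X "?g y" y, OF bij_betw_imp_inj_on[OF bij] gX[OF y] fg'[OF y]])
  have "?f \<in> Bij X" using bij by (simp add: Bij_def realize_def)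
  moreover have "regular_on V X ?f"
    unfolding regular_on_def
    by (rule exI[of _ "\<lambda>v. const (t v) * var (inv' \<tau> v)"])
      (auto simp: realize_apply eval_at_simps \<tau>V intro!: poly_ring_mult)
  moreover have "regular_on V X (inv_into X ?f)"
    unfolding regular_on_def
    by (rule exI[of _ "\<lambda>v. const (1 / t (\<tau> v)) * var (\<tau> v)"])
      (auto simp: inv eval_at_simps \<tau>V intro!: poly_ring_mult)
  ultimately show ?thesis by (simp add: Aut_def)
qed

lemma realize_mult:
  assumes "a \<in> carrier G" "b \<in> carrier G"
  shows "realize (a \<otimes>\<^bsub>G\<^esub> b) = realize a \<otimes>\<^bsub>Aut V X\<^esub> realize b"
proof -
  obtain \<tau> t \<tau>' t' where ab: "a = (\<tau>, t)" "b = (\<tau>', t')" "\<tau> \<in> carrier PF" "t \<in> carrier H" "\<tau>' \<in> carrier PF" "t' \<in> carrier H"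
    using assms by (auto simp: carrier_G)
  have p: "\<tau> permutes V" "\<tau>' permutes V" using ab by (auto simp: perm_carrier)
  have invV: "inv' \<tau> v \<in> V" if "v \<in> V" for v using that permutes_in_image[OF permutes_inv[OF p(1)]] by simp
  have Aut: "realize a \<in> carrier (Aut V X)" "realize b \<in> carrier (Aut V X)"
    using realize_Aut ab by auto
  then have Bij: "realize a \<in> Bij X" "realize b \<in> Bij X" by (auto simp: Aut_def)
  let ?c = "(\<tau> \<circ> \<tau>', rescale V t (permute_coords V \<tau> t'))"
  have mult: "a \<otimes>\<^bsub>G\<^esub> b = ?c"
    by (simp add: semidirect_def ab perm_group_def diag_group_def)
  have c: "realize ?c \<in> carrier (Aut V X)" by (rule realize_Aut[OF G_closed[OF ab(3-6)]])
  have "realize ?c x = realize a (realize b x)" if x: "x \<in> X" for x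
  proof (rule X_ext)
    have bx: "realize b x \<in> X" using Bij_imp_funcset[OF Bij(2)] x by blast
    show "realize a (realize b x) \<in> X" using Bij_imp_funcset[OF Bij(1)] bx by blast
    show "realize ?c x \<in> X" using c x Bij_imp_funcset[of "realize ?c" X] by (auto simp: Aut_def)
    fix v assume v: "v \<in> V"
    have "inv' (\<tau> \<circ> \<tau>') v = inv' \<tau>' (inv' \<tau> v)"
      using permutes_bij[OF p(1)] permutes_bij[OF p(2)] by (simp add: o_inv_distrib)
    then show "realize ?c x v = realize a (realize b x) v"
      using v invV[OF v] bx x
      by (simp add: ab(1,2) realize_apply rescale_def permute_coords_def inv_into_perm[OF p(1)] mult.assoc)
  qed
  then have "realize ?c = compose X (realize a) (realize b)"
    by (intro extensionalityI[of _ X]) (auto simp: realize_def compose_def)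
  then show ?thesis unfolding mult by (simp add: Aut_def BijGroup_def Bij)
qed

lemma realize_inj: "inj_on realize (carrier G)"
proof (rule inj_onI)
  fix a b assume "a \<in> carrier G" "b \<in> carrier G" and eq: "realize a = realize b"
  then obtain \<tau> t \<tau>' t' where ab: "a = (\<tau>, t)" "b = (\<tau>', t')" "\<tau> \<in> carrier PF" "t \<in> carrier H" "\<tau>' \<in> carrier PF" "t' \<in> carrier H"
    by (auto simp: carrier_G)
  have p: "\<tau> permutes V" "\<tau>' permutes V" using ab by (auto simp: perm_carrier)
  have invV: "inv' \<tau> v \<in> V" "inv' \<tau>' v \<in> V" if "v \<in> V" for v
    using that permutes_in_image[OF permutes_inv[OF p(1)]] permutes_in_image[OF permutes_inv[OF p(2)]] by auto
  have t: "t v \<noteq> 0" "t' v \<noteq> 0" if "v \<in> V" for v using ab that by (auto simp: diag_carrier)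
  have e: "t v * x (inv' \<tau> v) = t' v * x (inv' \<tau>' v)" if "x \<in> X" "v \<in> V" for x v
    using realize_apply[OF that, of \<tau> t] realize_apply[OF that, of \<tau>' t'] eq ab(1,2) by simp
  have inv_eq: "inv' \<tau> v = inv' \<tau>' v" if v: "v \<in> V" for v
  proof (rule coords_independent[OF invV[OF v]])
    show "x (inv' \<tau> v) = t' v / t v * x (inv' \<tau>' v)" if "x \<in> X" for x
      using e[OF that v] t(1)[OF v] by (simp add: field_simps)
  qed
  have "inv' \<tau> = inv' \<tau>'"
  proof
    fix v show "inv' \<tau> v = inv' \<tau>' v"
      using inv_eq permutes_not_in[OF permutes_inv[OF p(1)]] permutes_not_in[OF permutes_inv[OF p(2)]]
      by (cases "v \<in> V") auto
  qed
  then have \<tau>: "\<tau> = \<tau>'" using permutes_inv_inv[OF p(1)] permutes_inv_inv[OF p(2)] by metis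
  have "t = t'"
  proof (rule PiE_ext)
    show "t \<in> V \<rightarrow>\<^sub>E (UNIV - {0})" "t' \<in> V \<rightarrow>\<^sub>E (UNIV - {0})" using ab by (auto simp: diag_carrier)
    fix v assume v: "v \<in> V"
    obtain x where x: "x \<in> X" "x (inv' \<tau> v) \<noteq> 0"
      using coord_nonzero[OF invV(1)[OF v]] unfolding zext_def zero_fun_def by (metis (mono_tags, lifting))
    show "t v = t' v" using e[OF x(1) v] x(2) by (simp add: \<tau>)
  qed
  then show "a = b" using \<tau> ab by simp
qed

lemma regular_on_reg:
  assumes "regular_on V X f" "v \<in> V" shows "zext (\<lambda>x. f x v) \<in> reg"
proof -
  obtain g where g: "g v \<in> poly_ring V" "\<And>x. x \<in> X \<Longrightarrow> f x v = eval_at x (g v)"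
    using assms unfolding regular_on_def by blast
  have "zext (\<lambda>x. f x v) = zext (\<lambda>x. eval_at x (g v))" by (rule zext_cong) (rule g(2))
  then show ?thesis using reg_eval[OF g(1)] by simp
qed

lemma realize_surj:
  assumes \<phi>: "\<phi> \<in> carrier (Aut V X)"
  shows "\<exists>a\<in>carrier G. realize a = \<phi>"
proof -
  let ?\<psi> = "inv_into X \<phi>"
  have B: "bij_betw \<phi> X X" and ext: "\<phi> \<in> extensional X" and reg: "regular_on V X \<phi>" "regular_on V X ?\<psi>"
    using \<phi> by (auto simp: Aut_def Bij_def)
  have \<phi>X: "\<phi> x \<in> X" "?\<psi> x \<in> X" "?\<psi> (\<phi> x) = x" "\<phi> (?\<psi> x) = x" if "x \<in> X" for x
    using that B bij_betw_apply[OF B] bij_betw_apply[OF bij_betw_inv_into[OF B]]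
      bij_betw_inv_into_left[OF B] bij_betw_inv_into_right[OF B] by auto
  have a: "automorphism \<phi> ?\<psi>"
    unfolding automorphism_def using \<phi>X regular_on_reg[OF reg(1)] regular_on_reg[OF reg(2)] by blast
  obtain \<sigma>0 m where \<sigma>0: "bij_betw \<sigma>0 V V" and m: "\<And>v. v \<in> V \<Longrightarrow> m v \<noteq> (0::'k)"
    and eq0: "\<And>x v. x \<in> X \<Longrightarrow> v \<in> V \<Longrightarrow> \<phi> x v = m v * x (\<sigma>0 v)"
    using automorphism_monomial[OF a] by blast
  have mem: "(\<Sum>g\<in>\<gamma> ` V. mon g (\<lambda>v. m v * x (\<sigma>0 v))) = 0" if x: "x \<in> X" for x
  proof -
    have "mon g (\<phi> x) = mon g (\<lambda>v. m v * x (\<sigma>0 v))" for g by (rule mon_cong) (rule eq0[OF x])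
    then show ?thesis using in_X[OF \<phi>X(1)[OF x]] by simp
  qed
  define \<sigma> where "\<sigma> v = (if v \<in> V then \<sigma>0 v else v)" for v
  have "bij_betw \<sigma> V V" using \<sigma>0 by (simp add: \<sigma>_def cong: bij_betw_cong)
  then have p: "\<sigma> permutes V" by (rule bij_imp_permutes) (simp add: \<sigma>_def)
  have eq: "\<phi> x v = m v * x (\<sigma> v)" if "x \<in> X" "v \<in> V" for x v
    using eq0[OF that] that(2) by (simp add: \<sigma>_def)
  have "eval_at (\<lambda>v. x (\<sigma> v)) F = eval_at x F" for x
  proof -
    have "mon g (\<lambda>v. x (\<sigma> v)) = mon g (\<lambda>v. x (\<sigma>0 v))" for g
      by (rule mon_cong) (simp add: \<sigma>_def)
    then show ?thesis using sum_mon_permute[OF \<sigma>0 m mem, of x] by (simp add: eval_at_F)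
  qed
  then have \<sigma>P: "\<sigma> \<in> carrier PF" using p by (simp add: perm_carrier)
  define \<tau> where "\<tau> = inv' \<sigma>"
  have \<tau>P: "\<tau> \<in> carrier PF" unfolding \<tau>_def by (rule perm_inverse[OF \<sigma>P])
  have inv\<tau>: "inv' \<tau> = \<sigma>" unfolding \<tau>_def by (rule permutes_inv_inv[OF p])
  define t where "t = restrict m V"
  have \<phi>_eq: "\<phi> x = rescale V t (pull \<sigma> x)" if x: "x \<in> X" for x
    by (rule affine_eqI)
      (use \<phi>X(1)[OF x] in \<open>simp_all add: in_X_iff rescale_def restrict_affine pull_def t_def eq[OF x]\<close>)
  have pull_\<tau>: "pull \<sigma> (pull \<tau> x) = x" if "x \<in> affine_space V" for x
    by (rule affine_eqI[OF _ that])
      (simp_all add: pull_def restrict_affine \<tau>_def permutes_inverses[OF p] permutes_in_image[OF p])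
  have pull_\<sigma>: "pull \<tau> (pull \<sigma> x) = x" if "x \<in> affine_space V" for x
    by (rule affine_eqI[OF _ that])
      (simp_all add: pull_def restrict_affine \<tau>_def permutes_inverses[OF p] permutes_in_image[OF permutes_inv[OF p]])
  have t0: "t v \<noteq> 0" if "v \<in> V" for v using m[OF that] that by (simp add: t_def)
  have "rescale V t x \<in> X \<longleftrightarrow> x \<in> X" if x: "x \<in> affine_space V" for x
  proof
    assume "x \<in> X"
    then have "pull \<tau> x \<in> X" using pull_in_X[OF \<tau>P x] by simp
    from \<phi>_eq[OF this] \<phi>X(1)[OF this] show "rescale V t x \<in> X" by (simp only: pull_\<tau>[OF x])
  next
    assume r: "rescale V t x \<in> X"
    let ?y = "?\<psi> (rescale V t x)"
    have y: "?y \<in> X" by (rule \<phi>X(2)[OF r])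
    have "rescale V t (pull \<sigma> ?y) = rescale V t x" using \<phi>_eq[OF y] \<phi>X(4)[OF r] by simp
    then have "t v * pull \<sigma> ?y v = t v * x v" if "v \<in> V" for v
      using rescale_apply[OF that] by metis
    then have "pull \<sigma> ?y v = x v" if "v \<in> V" for v
      using t0[OF that] that mult_left_cancel by blast
    then have "pull \<sigma> ?y = x" by (intro affine_eqI x) (simp_all add: pull_def restrict_affine)
    moreover have "pull \<sigma> ?y \<in> X" using pull_in_X[OF \<sigma>P, of ?y] y by (simp add: in_X_iff)
    ultimately show "x \<in> X" by simp
  qed
  moreover have "t \<in> V \<rightarrow>\<^sub>E (UNIV - {0})" using t0 by (auto simp: t_def)
  ultimately have tH: "t \<in> carrier H" by (simp add: diag_carrier)
  have "realize (\<tau>, t) = \<phi>"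
  proof (rule extensionalityI[of _ X])
    show "realize (\<tau>, t) \<in> extensional X" by (simp add: realize_def)
    show "realize (\<tau>, t) x = \<phi> x" if "x \<in> X" for x
      using \<phi>_eq[OF that] that by (simp add: realize_def inv\<tau>)
  qed (rule ext)
  then show ?thesis using \<tau>P tH carrier_G by blast
qed

theorem Aut_iso_semidirect: "Aut V X \<cong> G"
proof -
  have bij: "bij_betw realize (carrier G) (carrier (Aut V X))"
    unfolding bij_betw_def
  proof (intro conjI realize_inj subset_antisym subsetI)
    fix \<phi> assume "\<phi> \<in> realize ` carrier G"
    then show "\<phi> \<in> carrier (Aut V X)" using realize_Aut by (auto simp: carrier_G)
  next
    fix \<phi> assume "\<phi> \<in> carrier (Aut V X)"
    then show "\<phi> \<in> realize ` carrier G" using realize_surj by blast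
  qed
  let ?h = "inv_into (carrier G) realize"
  have bij': "bij_betw ?h (carrier (Aut V X)) (carrier G)" by (rule bij_betw_inv_into[OF bij])
  have "?h \<in> hom (Aut V X) G"
  proof (rule homI)
    fix f g assume f: "f \<in> carrier (Aut V X)" and g: "g \<in> carrier (Aut V X)"
    show hf: "?h f \<in> carrier G" by (rule bij_betw_apply[OF bij' f])
    have hg: "?h g \<in> carrier G" by (rule bij_betw_apply[OF bij' g])
    have closed: "?h f \<otimes>\<^bsub>G\<^esub> ?h g \<in> carrier G"
    proof -
      obtain \<tau> t \<tau>' t' where "?h f = (\<tau>, t)" "?h g = (\<tau>', t')"
        "\<tau> \<in> carrier PF" "t \<in> carrier H" "\<tau>' \<in> carrier PF" "t' \<in> carrier H"
        using hf hg by (auto simp: carrier_G)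
      moreover have "(\<tau>, t) \<otimes>\<^bsub>G\<^esub> (\<tau>', t') = (\<tau> \<circ> \<tau>', rescale V t (permute_coords V \<tau> t'))" for \<tau> t \<tau>' t'
        by (simp add: semidirect_def perm_group_def diag_group_def)
      ultimately show ?thesis using G_closed by (simp add: carrier_G)
    qed
    have "realize (?h f \<otimes>\<^bsub>G\<^esub> ?h g) = f \<otimes>\<^bsub>Aut V X\<^esub> g"
      unfolding realize_mult[OF hf hg] using bij_betw_inv_into_right[OF bij] f g by simp
    then show "?h (f \<otimes>\<^bsub>Aut V X\<^esub> g) = ?h f \<otimes>\<^bsub>G\<^esub> ?h g"
      using bij_betw_inv_into_left[OF bij closed] by simp
  qed
  then have "?h \<in> iso (Aut V X) G" using bij' by (simp add: iso_def)
  then show ?thesis by (auto simp: is_iso_def)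
qed

end

section \<open>The polynomial of the theorem\<close>

text \<open>A label of the monomial in which the variable occurs. Indices start from \<open>1\<close>, so \<open>X i 0\<close> is free to stand for
  the \<open>i\<close>-th monomial in several variables.\<close>

fun group_of :: "svar \<Rightarrow> svar" where
  "group_of (X i j) = X i 0"
| "group_of (Y i j) = Y i j"

fun exponent_of :: "(nat \<Rightarrow> nat \<Rightarrow> nat) \<Rightarrow> (nat \<Rightarrow> nat) \<Rightarrow> svar \<Rightarrow> nat" where
  "exponent_of l q (X i j) = l i j"
| "exponent_of l q (Y i j) = q i"

lemma finite_sep_vars: "finite (sep_vars m n s k)"
proof -
  have "sep_vars m n s k = (\<lambda>(i, j). X i j) ` (SIGMA i:{1..m}. {1..n i}) \<union> (\<lambda>(i, j). Y i j) ` (SIGMA i:{1..s}. {1..k i})"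
    by (auto simp: sep_vars_def)
  then show ?thesis by (simp add: finite_SigmaI)
qed

lemma X_in_sep_vars [simp]: "X i j \<in> sep_vars m n s k \<longleftrightarrow> i \<in> {1..m} \<and> j \<in> {1..n i}"
  and Y_in_sep_vars [simp]: "Y i j \<in> sep_vars m n s k \<longleftrightarrow> i \<in> {1..s} \<and> j \<in> {1..k i}"
  by (auto simp: sep_vars_def)

lemma sep_vars_cases:
  assumes "v \<in> sep_vars m n s k"
  obtains i j where "v = X i j" "i \<in> {1..m}" "j \<in> {1..n i}"
  | i j where "v = Y i j" "i \<in> {1..s}" "j \<in> {1..k i}"
  using assms by (cases v) auto

lemma sep_poly_eq_sum_groups:
  assumes n: "\<And>i. i \<in> {1..m} \<Longrightarrow> n i > 1"
  shows "sep_poly m n l s k q =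
    (\<Sum>g\<in>group_of ` sep_vars m n s k.
       \<Prod>v\<in>{v \<in> sep_vars m n s k. group_of v = g}. var v ^ exponent_of l q v)"
    (is "_ = (\<Sum>g\<in>_. ?M g)")
proof -
  let ?A = "(\<lambda>i. X i 0) ` {1..m}" and ?B = "(\<lambda>(i, j). Y i j) ` (SIGMA i:{1..s}. {1..k i})"
  have img: "group_of ` sep_vars m n s k = ?A \<union> ?B"
  proof (intro subset_antisym subsetI)
    fix g assume "g \<in> group_of ` sep_vars m n s k"
    then obtain v where "v \<in> sep_vars m n s k" "g = group_of v" by blast
    then show "g \<in> ?A \<union> ?B"
      by (cases v) (auto intro: image_eqI[of _ _ "(_, _)"])
  next
    fix g assume "g \<in> ?A \<union> ?B"
    then show "g \<in> group_of ` sep_vars m n s k"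
    proof
      assume "g \<in> ?A"
      then obtain i where i: "g = X i 0" "i \<in> {1..m}" by blast
      then have "X i 1 \<in> sep_vars m n s k" using n[OF i(2)] by simp
      moreover have "g = group_of (X i 1)" using i by simp
      ultimately show ?thesis by blast
    next
      assume "g \<in> ?B"
      then obtain i j where ij: "g = Y i j" "i \<in> {1..s}" "j \<in> {1..k i}" by auto
      then have "Y i j \<in> sep_vars m n s k" by simp
      moreover have "g = group_of (Y i j)" using ij by simp
      ultimately show ?thesis by blast
    qed
  qed
  have MX: "?M (X i 0) = (\<Prod>j=1..n i. var (X i j) ^ l i j)" if "i \<in> {1..m}" for i
  proof -
    have "{v \<in> sep_vars m n s k. group_of v = X i 0} = X i ` {1..n i}"
      using that by (auto elim!: sep_vars_cases)
    then show ?thesis by (simp add: prod.reindex inj_on_def)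
  qed
  have MY: "?M (Y i j) = var (Y i j) ^ q i" if "i \<in> {1..s}" "j \<in> {1..k i}" for i j
  proof -
    have "{v \<in> sep_vars m n s k. group_of v = Y i j} = {Y i j}"
      using that by (auto elim!: sep_vars_cases)
    then show ?thesis by simp
  qed
  have "(\<Sum>g\<in>group_of ` sep_vars m n s k. ?M g) = sum ?M ?A + sum ?M ?B"
    unfolding img by (rule sum.union_disjoint) (auto intro!: finite_SigmaI)
  also have "sum ?M ?A = (\<Sum>i=1..m. ?M (X i 0))"
    by (rule sum.reindex_cong[of "\<lambda>i. X i 0"]) (auto simp: inj_on_def)
  also have "\<dots> = (\<Sum>i=1..m. \<Prod>j=1..n i. var (X i j) ^ l i j)"
    by (rule sum.cong[OF refl]) (rule MX)
  also have "sum ?M ?B = (\<Sum>p\<in>(SIGMA i:{1..s}. {1..k i}). ?M (case p of (i, j) \<Rightarrow> Y i j))"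
    by (rule sum.reindex_cong[of "\<lambda>(i, j). Y i j"]) (auto simp: inj_on_def)
  also have "\<dots> = (\<Sum>p\<in>(SIGMA i:{1..s}. {1..k i}). (\<lambda>(i, j). var (Y i j) ^ q i) p)"
    by (rule sum.cong[OF refl]) (clarsimp simp del: One_nat_def, rule MY, simp_all)
  also have "\<dots> = (\<Sum>i=1..s. \<Sum>j=1..k i. var (Y i j) ^ q i)"
    by (rule sum.Sigma[symmetric]) auto
  finally show ?thesis unfolding sep_poly_def by (rule sym)
qed

theorem theorem2p7:
  fixes m s :: nat
    and n k q :: "nat \<Rightarrow> nat"
    and l :: "nat \<Rightarrow> nat \<Rightarrow> nat"
    and F :: "(svar, 'k::{alg_closed_field, field_char_0}) mpoly"
    and V :: "svar set"
  assumes "\<And>i. i \<in> {1..m} \<Longrightarrow> n i > 1"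
    and "\<And>i j. i \<in> {1..m} \<Longrightarrow> j \<in> {1..n i} \<Longrightarrow> l i j > 0"
    and "\<And>i. i \<in> {1..s} \<Longrightarrow> k i > 0"
    and "\<And>i. i \<in> {1..s} \<Longrightarrow> q i > 0"
    and "\<And>i j. i \<in> {1..s} \<Longrightarrow> j \<in> {1..s} \<Longrightarrow> i < j \<Longrightarrow> q i > q j"
    and "\<not> degenerate m n l s k q"
    and "V = sep_vars m n s k"
    and "F = sep_poly m n l s k q"
    and "rigid V (zero_set V F)"
  shows "Aut V (zero_set V F) \<cong>
    semidirect (perm_group V F) (diag_group V F) (permute_coords V)"
proof -
  note n = assms(1) and l = assms(2) and k = assms(3) and q = assms(4) and q_decr = assms(5)
    and nondegenerate = assms(6) and V = assms(7) and F = assms(8) and rigid = assms(9)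
  have X_V: "X i j \<in> V \<longleftrightarrow> i \<in> {1..m} \<and> j \<in> {1..n i}" for i j by (simp add: V)
  have Y_V: "Y i j \<in> V \<longleftrightarrow> i \<in> {1..s} \<and> j \<in> {1..k i}" for i j by (simp add: V)
  have m0: "X 1 1 \<in> V \<and> X 1 2 \<in> V" if "m \<noteq> 0"
    using n[of 1] that by (simp add: X_V)
  have s0: "Y i 1 \<in> V" if "i \<in> {1..s}" for i
    using k[OF that] that by (simp add: Y_V)
  have one_var: "V \<noteq> {v}" for v
  proof
    assume v: "V = {v}"
    have m: "m = 0"
    proof (rule ccontr)
      assume "m \<noteq> 0"
      with m0 v have "X 1 1 = v" "X 1 2 = v" by auto
      then show False by auto
    qed
    have "v \<in> V" using v by simp
    with m obtain i j where ij: "v = Y i j" "i \<in> {1..s}" "j \<in> {1..k i}"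
      by (cases v) (simp_all add: X_V Y_V)
    have "i' = i" if "i' \<in> {1..s}" for i'
      using s0[OF that] v ij(1) by simp
    from this[of 1] this[of s] have s: "s = 1" "i = 1" using ij(2) by auto
    have "k 1 = 1"
      using s0[of 1] s v ij Y_V[of 1 "k 1"] by auto
    then show False using nondegenerate m s unfolding degenerate_def by blast
  qed
  have two_vars: "exponent_of l q v \<noteq> 2 \<or> exponent_of l q w \<noteq> 2"
    if vw: "V = {v, w}" and ne: "group_of v \<noteq> group_of w" for v w
  proof (rule ccontr)
    assume "\<not> ?thesis"
    then have two: "exponent_of l q u = 2" if "u \<in> V" for u using that vw by auto
    have m: "m = 0"
    proof (rule ccontr)
      assume "m \<noteq> 0"
      then have "X 1 1 \<in> {v, w}" "X 1 2 \<in> {v, w}" using m0 vw by auto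
      then have "v = X 1 1 \<and> w = X 1 2 \<or> v = X 1 2 \<and> w = X 1 1" by auto
      then show False using ne by auto
    qed
    have q2: "q i = 2" if "i \<in> {1..s}" for i using two[OF s0[OF that]] by simp
    have "s \<le> 1"
    proof (rule ccontr)
      assume "\<not> s \<le> 1"
      then show False using q_decr[of 1 2] q2[of 1] q2[of 2] by simp
    qed
    moreover have "v \<in> V" using vw by simp
    with m obtain i j where "v = Y i j" "i \<in> {1..s}"
      by (cases v) (simp_all add: X_V Y_V)
    ultimately have s: "s = 1" by auto
    have "V = Y 1 ` {1..k 1}"
      using m s by (auto simp: V elim!: sep_vars_cases)
    then have "card V = k 1" by (simp add: card_image inj_on_def)
    moreover have "card V = 2" using vw ne by (auto simp: card_insert_if)
    ultimately show False using nondegenerate m s q2[of 1] unfolding degenerate_def by simp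
  qed
  have one_monomial: "exponent_of l q v = exponent_of l q w"
    if same: "\<And>v w. v \<in> V \<Longrightarrow> w \<in> V \<Longrightarrow> group_of v = group_of w" and v: "v \<in> V" and w: "w \<in> V" for v w
  proof (cases "m = 0")
    case True
    then obtain i j i' j' where "v = Y i j" "w = Y i' j'"
      using v w by (cases v; cases w) (auto simp: X_V)
    then show ?thesis using same[OF v w] by simp
  next
    case False
    have "group_of u = X 1 0" if "u \<in> V" for u
      using same[OF that, of "X 1 1"] m0[OF False] by simp
    then have X1: "\<exists>j. u = X 1 j" if "u \<in> V" for u using that by (cases u) fastforce+
    have "m = 1" using X1[of "X m 1"] n[of m] False by (auto simp: X_V)
    moreover have "s = 0" using X1[OF s0, of 1] by (cases "s = 0") auto
    ultimately have l1: "l 1 j = l 1 1" if "j \<in> {1..n 1}" for j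
      using nondegenerate that unfolding degenerate_def by blast
    obtain j j' where vw: "v = X 1 j" "w = X 1 j'" using X1[OF v] X1[OF w] by blast
    have j: "j \<in> {1..n 1}" "j' \<in> {1..n 1}" using v w unfolding vw X_V by auto
    show ?thesis unfolding vw exponent_of.simps l1[OF j(1)] l1[OF j(2)] by (rule refl)
  qed
  interpret separated V group_of "exponent_of l q" F
  proof
    show "finite V" unfolding V by (rule finite_sep_vars)
    show "exponent_of l q v > 0" if "v \<in> V" for v
      using that l q unfolding V by (auto elim!: sep_vars_cases)
    show "F = (\<Sum>g\<in>group_of ` V. \<Prod>v\<in>{v \<in> V. group_of v = g}. var v ^ exponent_of l q v)"
      unfolding F V by (rule sep_poly_eq_sum_groups) (rule n)
  qed (fact rigid one_var two_vars one_monomial)+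
  show ?thesis by (rule Aut_iso_semidirect)
qed

end
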